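(* For every space bound $s(n)\in o(\log n)$, QTM-WOMs are strictly superior to PTM-WOMs in terms of language recognition with bounded error in space $s$. That is, every language recognized with bounded error by an $s(n)$-space PTM-WOM is recognized with bounded error by an $s(n)$-space QTM-WOM, and there is a language recognized with bounded error by an $s(n)$-space QTM-WOM but not by any $s(n)$-space PTM-WOM.
   Context: A PTM is a standard probabilistic Turing machine with a two-way read-only input tape (containing ¢$w$\$ for input $w\in\Sigma^*$) and one two-way read/write work tape. A PTM-WOM additionally has a write-only memory (WOM): a two-way tape with finite alphabet $\Gamma$ containing the blank symbol and the empty symbol $\varepsilon$, whose content is never read. In each step the machine writes a symbol of $\Gamma$ on the square under the WOM head (writing $\varepsilon$ leaves the square unchanged) and moves the WOM head left, right, or not at all, the transition not depending on the WOM content. A QTM-WOM has the same components (finite state set, two-way read-only input tape, read/write work tape, WOM tape) together with a finite register with alphabet $\Omega$ partitioned into "accept", "reject" and "continue" symbols. Depending on the state and the scanned input and work tape symbols, in one step it changes state, writes on the work tape, moves the input and work heads, writes on the WOM and moves the WOM head, and writes $\omega\in\Omega$ in the register, with a given transition amplitude in $\mathbb C$ (amplitudes are efficiently computable numbers). A configuration consists of the state, the head positions and the contents of the work and WOM tapes (not the register). With $E_\omega$ the matrix of one-step amplitudes between configurations with $\omega$ written in the register, the machine must be well-formed: $\sum_{\omega\in\Omega}E_\omega^\dagger E_\omega=I$. After each step the register is observed. The machine halts and accepts (rejects) if an accept (reject) symbol is seen; otherwise the register is reset to its initial symbol and the computation continues. Space: a machine uses space $s(n)$ if, on every input of length $n$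 and every computation path, at most $s(n)$ squares of the read/write work tape are used. The WOM is not counted. Recognition: $L\subseteq\Sigma^*$ is recognized by $\mathcal M$ with bounded error if there is $\epsilon$ with $0\le\epsilon<\frac12$ such that every $w\in L$ is accepted with probability at least $1-\epsilon$ and every $w\notin L$ is rejected with probability at least $1-\epsilon$. *)

theory Defs
  imports "HOL-Probability.Probability" "HOL-Library.Landau_Symbols"
begin

section \<open>Efficiently computable numbers\<close>

text \<open>
  A number is efficiently computable if a deterministic algorithm approximates it to within
  \<open>2\<^sup>-\<^sup>n\<close> in time polynomial in \<open>n\<close>.  The algorithms are while programs over finitely many
  registers holding natural numbers.  One instruction lengthens the binary representation of the
  register contents by at most one bit (constants aside), and two registers, manipulated by
  halving and doubling, can hold the two halves of a Turing machine tape.  Hence this unit-cost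
  model is polynomially related to Turing machines.
\<close>

datatype prog =
    Const nat nat
  | Add nat nat nat
  | Sub nat nat nat
  | Half nat nat
  | Seq prog prog
  | While nat prog

inductive runs :: "prog \<Rightarrow> (nat \<Rightarrow> nat) \<Rightarrow> nat \<Rightarrow> (nat \<Rightarrow> nat) \<Rightarrow> bool" where
  Const: "runs (Const d k) r 1 (r(d := k))"
| Add: "runs (Add d x y) r 1 (r(d := r x + r y))"
| Sub: "runs (Sub d x y) r 1 (r(d := r x - r y))"
| Half: "runs (Half d x) r 1 (r(d := r x div 2))"
| Seq: "runs p r t r' \<Longrightarrow> runs q r' t' r'' \<Longrightarrow> runs (Seq p q) r (t + t') r''"
| While_exit: "r x = 0 \<Longrightarrow> runs (While x p) r 1 r"
| While_loop: "r x \<noteq> 0 \<Longrightarrow> runs p r t r' \<Longrightarrow> runs (While x p) r' t' r''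
    \<Longrightarrow> runs (While x p) r (1 + t + t') r''"

text \<open>The time bound is polynomial in the number \<open>n\<close> itself, not in its binary length.\<close>

definition poly_time :: "(nat \<Rightarrow> nat) \<Rightarrow> bool" where
  "poly_time f \<longleftrightarrow>
     (\<exists>p k. \<forall>n. \<exists>t r. runs p ((\<lambda>_. 0)(0 := n)) t r \<and> r 0 = f n \<and> t \<le> k * (n + 1) ^ k)"

text \<open>Approximating the absolute value suffices, as the sign is a single fixed bit.\<close>

definition eff_real :: "real \<Rightarrow> bool" where
  "eff_real x \<longleftrightarrow> (\<exists>f. poly_time f \<and> (\<forall>n. \<bar>\<bar>x\<bar> - real (f n) / 2 ^ n\<bar> \<le> 1 / 2 ^ n))"

definition eff_complex :: "complex \<Rightarrow> bool" where
  "eff_complex z \<longleftrightarrow> eff_real (Re z) \<and> eff_real (Im z)"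


section \<open>Machines with a work tape and a write-only memory\<close>

text \<open>
  States and symbols are natural numbers, and \<open>0\<close> is the blank symbol of both the work tape and
  the WOM.  \<open>Lend\<close> and \<open>Rend\<close> are the end-markers of the input tape.
\<close>

datatype in_sym = Lend | Sym nat | Rend

datatype move = MLeft | MStay | MRight

fun shift :: "move \<Rightarrow> int" where
  "shift MLeft = -1"
| "shift MStay = 0"
| "shift MRight = 1"

text \<open>
  The empty symbol, which leaves the WOM square unchanged, is \<open>None\<close> in \<open>wom_write\<close>; it is
  therefore not an element of the alphabet \<open>wom_alph\<close> of possible WOM contents.
\<close>

record action =
  next_state :: nat
  work_write :: nat
  in_move :: move
  work_move :: move
  wom_write :: "nat option"
  wom_move :: move

record wom_machine =
  states :: "nat set"
  start :: nat
  work_alph :: "nat set"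
  wom_alph :: "nat set"

record config =
  state :: nat
  in_pos :: int
  work_pos :: int
  work_tape :: "int \<Rightarrow> nat"
  wom_pos :: int
  wom_tape :: "int \<Rightarrow> nat"

definition wf_machine :: "('b) wom_machine_scheme \<Rightarrow> bool" where
  "wf_machine M \<longleftrightarrow> finite (states M) \<and> start M \<in> states M
     \<and> finite (work_alph M) \<and> 0 \<in> work_alph M \<and> finite (wom_alph M) \<and> 0 \<in> wom_alph M"

definition in_syms :: "nat set \<Rightarrow> in_sym set" where
  "in_syms \<Sigma> = {Lend, Rend} \<union> Sym ` \<Sigma>"

definition scanned :: "nat list \<Rightarrow> int \<Rightarrow> in_sym" where
  "scanned w i =
     (if i \<le> 0 then Lend else if i \<le> int (length w) then Sym (w ! nat (i - 1)) else Rend)"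

text \<open>The actions possible when the input head scans \<open>\<sigma>\<close>: it may not leave the marked input.\<close>

definition actions :: "('b) wom_machine_scheme \<Rightarrow> in_sym \<Rightarrow> action set" where
  "actions M \<sigma> = {a. next_state a \<in> states M \<and> work_write a \<in> work_alph M
     \<and> wom_write a \<in> insert None (Some ` wom_alph M)
     \<and> (\<sigma> = Lend \<longrightarrow> in_move a \<noteq> MLeft) \<and> (\<sigma> = Rend \<longrightarrow> in_move a \<noteq> MRight)}"

definition configs :: "('b) wom_machine_scheme \<Rightarrow> nat list \<Rightarrow> config set" where
  "configs M w = {c. state c \<in> states M \<and> 0 \<le> in_pos c \<and> in_pos c \<le> int (length w) + 1
     \<and> range (work_tape c) \<subseteq> work_alph M \<and> finite {i. work_tape c i \<noteq> 0}
     \<and> range (wom_tape c) \<subseteq> wom_alph M \<and> finite {i. wom_tape c i \<noteq> 0}}"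

definition init_config :: "('b) wom_machine_scheme \<Rightarrow> config" where
  "init_config M = \<lparr>state = start M, in_pos = 0, work_pos = 0, work_tape = (\<lambda>_. 0),
     wom_pos = 0, wom_tape = (\<lambda>_. 0)\<rparr>"

definition apply_action :: "action \<Rightarrow> config \<Rightarrow> config" where
  "apply_action a c =
     \<lparr>state = next_state a,
      in_pos = in_pos c + shift (in_move a),
      work_pos = work_pos c + shift (work_move a),
      work_tape = (work_tape c)(work_pos c := work_write a),
      wom_pos = wom_pos c + shift (wom_move a),
      wom_tape = (case wom_write a of None \<Rightarrow> wom_tape c
                  | Some g \<Rightarrow> (wom_tape c)(wom_pos c := g))\<rparr>"

text \<open>
  The squares used along a finite path are those scanned by the work head, except that a path
  along which the work head never moves and its square stays blank uses no square at all.
\<close>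

definition squares_used :: "config list \<Rightarrow> nat" where
  "squares_used cs =
     (if \<forall>c\<in>set cs. work_pos c = 0 \<and> work_tape c = (\<lambda>_. 0) then 0
      else card (work_pos ` set cs))"

definition bounded_error ::
    "nat set \<Rightarrow> nat list set \<Rightarrow> (nat list \<Rightarrow> real) \<Rightarrow> (nat list \<Rightarrow> real) \<Rightarrow> bool" where
  "bounded_error \<Sigma> L acc rej \<longleftrightarrow>
     (\<exists>\<epsilon>::real. 0 \<le> \<epsilon> \<and> \<epsilon> < 1/2 \<and>
        (\<forall>w\<in>lists \<Sigma>. (w \<in> L \<longrightarrow> acc w \<ge> 1 - \<epsilon>) \<and> (w \<notin> L \<longrightarrow> rej w \<ge> 1 - \<epsilon>)))"


section \<open>Probabilistic machines\<close>

record ptm_wom = wom_machine +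
  acc_state :: nat
  rej_state :: nat
  ptrans :: "nat \<Rightarrow> in_sym \<Rightarrow> nat \<Rightarrow> action pmf"

definition wf_ptm :: "nat set \<Rightarrow> ptm_wom \<Rightarrow> bool" where
  "wf_ptm \<Sigma> M \<longleftrightarrow> wf_machine M
     \<and> acc_state M \<in> states M \<and> rej_state M \<in> states M \<and> acc_state M \<noteq> rej_state M
     \<and> (\<forall>q\<in>states M - {acc_state M, rej_state M}. \<forall>\<sigma>\<in>in_syms \<Sigma>. \<forall>g\<in>work_alph M.
          set_pmf (ptrans M q \<sigma> g) \<subseteq> actions M \<sigma>
          \<and> (\<forall>a. eff_real (pmf (ptrans M q \<sigma> g) a)))"

definition pstep :: "ptm_wom \<Rightarrow> nat list \<Rightarrow> config \<Rightarrow> config pmf" where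
  "pstep M w c =
     (if state c \<in> {acc_state M, rej_state M} then return_pmf c
      else map_pmf (\<lambda>a. apply_action a c)
             (ptrans M (state c) (scanned w (in_pos c)) (work_tape c (work_pos c))))"

definition pdist :: "ptm_wom \<Rightarrow> nat list \<Rightarrow> nat \<Rightarrow> config pmf" where
  "pdist M w t = ((\<lambda>\<mu>. bind_pmf \<mu> (pstep M w)) ^^ t) (return_pmf (init_config M))"

text \<open>Halting configurations are absorbing, so the probabilities below increase with \<open>t\<close>.\<close>

definition ptm_acc :: "ptm_wom \<Rightarrow> nat list \<Rightarrow> real" where
  "ptm_acc M w = (SUP t. measure_pmf.prob (pdist M w t) {c. state c = acc_state M})"

definition ptm_rej :: "ptm_wom \<Rightarrow> nat list \<Rightarrow> real" where
  "ptm_rej M w = (SUP t. measure_pmf.prob (pdist M w t) {c. state c = rej_state M})"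

definition ptm_paths :: "ptm_wom \<Rightarrow> nat list \<Rightarrow> config list set" where
  "ptm_paths M w = {cs. cs \<noteq> [] \<and> hd cs = init_config M
     \<and> successively (\<lambda>c c'. c' \<in> set_pmf (pstep M w c)) cs}"

definition ptm_wom_recognizable :: "nat set \<Rightarrow> (nat \<Rightarrow> nat) \<Rightarrow> nat list set \<Rightarrow> bool" where
  "ptm_wom_recognizable \<Sigma> s L \<longleftrightarrow>
     (\<exists>M. wf_ptm \<Sigma> M
        \<and> (\<forall>w\<in>lists \<Sigma>. \<forall>cs\<in>ptm_paths M w. squares_used cs \<le> s (length w))
        \<and> bounded_error \<Sigma> L (ptm_acc M) (ptm_rej M))"


section \<open>Quantum machines\<close>

text \<open>
  The register alphabet consists of \<open>acc_regs\<close>, \<open>rej_regs\<close> and \<open>cont_regs\<close>.  The register has its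
  initial symbol at the beginning of every step, so that symbol does not enter the transitions.
  \<open>qtrans M q \<sigma> g a \<omega>\<close> is the amplitude of performing \<open>a\<close> and writing \<open>\<omega>\<close> in the register in
  state \<open>q\<close> when \<open>\<sigma>\<close> and \<open>g\<close> are scanned on the input and work tape.
\<close>

record qtm_wom = wom_machine +
  acc_regs :: "nat set"
  rej_regs :: "nat set"
  cont_regs :: "nat set"
  qtrans :: "nat \<Rightarrow> in_sym \<Rightarrow> nat \<Rightarrow> action \<Rightarrow> nat \<Rightarrow> complex"

definition regs :: "qtm_wom \<Rightarrow> nat set" where
  "regs M = acc_regs M \<union> rej_regs M \<union> cont_regs M"

text \<open>
  The entry of \<open>E\<^sub>\<omega>\<close> in row \<open>c'\<close> and column \<open>c\<close>.  Different actions can lead to the same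
  configuration (writing the empty symbol, or the symbol already present); their amplitudes add.
\<close>

definition qstep :: "qtm_wom \<Rightarrow> nat list \<Rightarrow> nat \<Rightarrow> config \<Rightarrow> config \<Rightarrow> complex" where
  "qstep M w \<omega> c' c =
     (let \<sigma> = scanned w (in_pos c) in
        \<Sum>a\<in>{a\<in>actions M \<sigma>. apply_action a c = c'}.
          qtrans M (state c) \<sigma> (work_tape c (work_pos c)) a \<omega>)"

text \<open>
  Each column has finitely many non-zero entries, so the infinite sums over configurations here
  and below are finite sums in disguise.
\<close>

definition well_formed :: "nat set \<Rightarrow> qtm_wom \<Rightarrow> bool" where
  "well_formed \<Sigma> M \<longleftrightarrow>
     (\<forall>w\<in>lists \<Sigma>. \<forall>c1\<in>configs M w. \<forall>c2\<in>configs M w.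
        (\<Sum>\<omega>\<in>regs M. \<Sum>\<^sub>\<infinity>c'\<in>configs M w. cnj (qstep M w \<omega> c' c1) * qstep M w \<omega> c' c2)
          = (if c1 = c2 then 1 else 0))"

definition wf_qtm :: "nat set \<Rightarrow> qtm_wom \<Rightarrow> bool" where
  "wf_qtm \<Sigma> M \<longleftrightarrow> wf_machine M
     \<and> finite (regs M)
     \<and> acc_regs M \<inter> rej_regs M = {} \<and> acc_regs M \<inter> cont_regs M = {}
     \<and> rej_regs M \<inter> cont_regs M = {}
     \<and> (\<forall>q\<in>states M. \<forall>\<sigma>\<in>in_syms \<Sigma>. \<forall>g\<in>work_alph M. \<forall>a\<in>actions M \<sigma>. \<forall>\<omega>\<in>regs M.
          eff_complex (qtrans M q \<sigma> g a \<omega>))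
     \<and> well_formed \<Sigma> M"

text \<open>
  \<open>qvec M w \<omega>s\<close> is the unnormalized state vector after the register symbols \<open>\<omega>s\<close>, latest first,
  have been observed; its squared norm is the probability of that sequence of observations.
\<close>

fun qvec :: "qtm_wom \<Rightarrow> nat list \<Rightarrow> nat list \<Rightarrow> config \<Rightarrow> complex" where
  "qvec M w [] c = (if c = init_config M then 1 else 0)"
| "qvec M w (\<omega> # \<omega>s) c = (\<Sum>\<^sub>\<infinity>c'\<in>configs M w. qstep M w \<omega> c c' * qvec M w \<omega>s c')"

definition obs_prob :: "qtm_wom \<Rightarrow> nat list \<Rightarrow> nat list \<Rightarrow> real" where
  "obs_prob M w \<omega>s = (\<Sum>\<^sub>\<infinity>c\<in>configs M w. (cmod (qvec M w \<omega>s c))\<^sup>2)"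

definition qtm_acc :: "qtm_wom \<Rightarrow> nat list \<Rightarrow> real" where
  "qtm_acc M w = (\<Sum>\<^sub>\<infinity>(\<omega>, \<omega>s)\<in>acc_regs M \<times> lists (cont_regs M). obs_prob M w (\<omega> # \<omega>s))"

definition qtm_rej :: "qtm_wom \<Rightarrow> nat list \<Rightarrow> real" where
  "qtm_rej M w = (\<Sum>\<^sub>\<infinity>(\<omega>, \<omega>s)\<in>rej_regs M \<times> lists (cont_regs M). obs_prob M w (\<omega> # \<omega>s))"

text \<open>Along a path, only the last step may write a symbol that halts the computation.\<close>

definition qtm_paths :: "qtm_wom \<Rightarrow> nat list \<Rightarrow> config list set" where
  "qtm_paths M w = {cs. cs \<noteq> [] \<and> hd cs = init_config M
     \<and> successively (\<lambda>c c'. \<exists>\<omega>\<in>cont_regs M. qstep M w \<omega> c' c \<noteq> 0) (butlast cs)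
     \<and> successively (\<lambda>c c'. \<exists>\<omega>\<in>regs M. qstep M w \<omega> c' c \<noteq> 0) cs}"

definition qtm_wom_recognizable :: "nat set \<Rightarrow> (nat \<Rightarrow> nat) \<Rightarrow> nat list set \<Rightarrow> bool" where
  "qtm_wom_recognizable \<Sigma> s L \<longleftrightarrow>
     (\<exists>M. wf_qtm \<Sigma> M
        \<and> (\<forall>w\<in>lists \<Sigma>. \<forall>cs\<in>qtm_paths M w. squares_used cs \<le> s (length w))
        \<and> bounded_error \<Sigma> L (qtm_acc M) (qtm_rej M))"

end

theory Submission
  imports Defs "HOL-Real_Asymp.Real_Asymp"
begin

text \<open>
  The WOM does not influence a probabilistic machine.  A quantum machine without use of its WOM
  simulates it by recording every random choice in the register, with the square roots of the
  probabilities as amplitudes.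

  The separating language consists of the words \<open>x2x\<close> over the alphabet \<open>{0, 1, 2}\<close> with \<open>x\<close>
  free of 2.  On input \<open>x2y\<close> a quantum machine writes \<open>x\<close> on its WOM in one branch of a superposition
  and \<open>y\<close> in another.  The branches interfere at the end of the input iff \<open>x = y\<close>, and no work tape is
  needed.

  A probabilistic machine in space \<open>o(log n)\<close> has only \<open>d = n\<^bsup>o(1)\<^esup>\<close> work configurations.  What it can
  learn from \<open>x\<close> is a table of \<open>O(d\<^sup>2)\<close> exit probabilities from the left part of the input.
  A positive entry is at least \<open>p\<close> to the power of the number of configurations, where \<open>p\<close> is the
  least transition probability, so up to a factor \<open>exp \<delta>\<close> in each entry there are fewer than \<open>2 ^ m\<close> tables for
  words of length \<open>m\<close>.  If \<open>x\<close> and \<open>x'\<close> share a table up to this factor, the probabilities of accepting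
  \<open>x2x\<close> and \<open>x'2x\<close> differ by a bounded factor, because changing one stochastic row of an absorbing
  chain by factors in \<open>[1/t, t]\<close> changes its absorption probabilities by a factor at most \<open>t\<^sup>2\<close>.
\<close>

section \<open>Rewards in absorbing Markov chains\<close>

text \<open>Closeness of tables is multiplicative because the input head may cross into the left
  part arbitrarily often: additive errors would grow with the number of crossings, whereas a factor
  is paid once per row of the condensed chain. A row must be stochastic for this, yet a machine may
  run forever inside the left part. Its exit probabilities are therefore conditioned on leaving,
  which only increases both absorption probabilities. Upper bounds suffice: in the condensed chain
  for x'2x acceptance and rejection add up to at most 1, so certain enough rejection of x'2x limits
  acceptance there, and hence acceptance of x2x. With \<delta> of order 1/d the factors of all d + 1
  rows multiply to a constant, while the logarithm of the number of tables is only of order d^2 log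
  m. On the quantum side the obstacle is well-formedness. The simulation records in the register
  also the state and the scanned symbols, so that a step can be undone from the observed symbol, and
  its amplitudes call for a square root in polynomial time.\<close>

fun reward_upto :: "'a set \<Rightarrow> ('a \<Rightarrow> 'a \<Rightarrow> real) \<Rightarrow> ('a \<Rightarrow> real) \<Rightarrow> nat \<Rightarrow> 'a \<Rightarrow> real" where
  "reward_upto S K r 0 c = 0"
| "reward_upto S K r (Suc t) c = r c + (\<Sum>d\<in>S. K c d * reward_upto S K r t d)"

definition total_reward :: "'a set \<Rightarrow> ('a \<Rightarrow> 'a \<Rightarrow> real) \<Rightarrow> ('a \<Rightarrow> real) \<Rightarrow> 'a \<Rightarrow> real" where
  "total_reward S K r c = (SUP t. reward_upto S K r t c)"

text \<open>Rows may sum to less than 1, the missing mass being absorbed with another outcome or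
  lost. So one \<open>K\<close> can form a chain with each of two rewards and with their
  sum.\<close>

definition exit_chain :: "'a set \<Rightarrow> ('a \<Rightarrow> 'a \<Rightarrow> real) \<Rightarrow> ('a \<Rightarrow> real) \<Rightarrow> bool" where
  "exit_chain S K r \<longleftrightarrow> finite S \<and> (\<forall>c\<in>S. 0 \<le> r c \<and> (\<forall>d\<in>S. 0 \<le> K c d) \<and> r c + (\<Sum>d\<in>S. K c d) \<le> 1)"

lemma reward_upto_nonneg:
  assumes "exit_chain S K r" "c \<in> S"
  shows "0 \<le> reward_upto S K r t c"
  using assms(2)
proof (induction t arbitrary: c)
  case (Suc t)
  then show ?case using assms(1) by (auto simp: exit_chain_def intro!: add_nonneg_nonneg sum_nonneg mult_nonneg_nonneg)
qed simp

text \<open>Iteration from 0 never overtakes a nonnegative supersolution, as the step is monotone.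
  Upper bounds rest on this rather than on the fixpoint equation, which has further solutions if
  some states never exit.\<close>

lemma reward_upto_le_supersolution:
  assumes "exit_chain S K r" "c \<in> S"
    and "\<And>c. c \<in> S \<Longrightarrow> 0 \<le> g c"
    and "\<And>c. c \<in> S \<Longrightarrow> r c + (\<Sum>d\<in>S. K c d * g d) \<le> g c"
  shows "reward_upto S K r t c \<le> g c"
  using assms(2)
proof (induction t arbitrary: c)
  case 0
  then show ?case using assms(3) by simp
next
  case (Suc t)
  have "reward_upto S K r (Suc t) c \<le> r c + (\<Sum>d\<in>S. K c d * g d)"
    using Suc assms(1) by (auto simp: exit_chain_def intro!: sum_mono mult_left_mono)
  then show ?case using assms(4)[OF Suc.prems] by linarith
qed

lemma reward_upto_le_1:
  assumes "exit_chain S K r" "c \<in> S"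
  shows "reward_upto S K r t c \<le> 1"
  using reward_upto_le_supersolution[OF assms, of "\<lambda>_. 1"] assms(1) by (auto simp: exit_chain_def)

lemma reward_upto_mono:
  assumes "exit_chain S K r" "c \<in> S"
  shows "reward_upto S K r t c \<le> reward_upto S K r (Suc t) c"
  using assms(2)
proof (induction t arbitrary: c)
  case 0
  then show ?case using assms(1) by (simp add: exit_chain_def)
next
  case (Suc t)
  have "(\<Sum>d\<in>S. K c d * reward_upto S K r t d) \<le> (\<Sum>d\<in>S. K c d * reward_upto S K r (Suc t) d)"
    using Suc assms(1) by (intro sum_mono mult_left_mono) (auto simp: exit_chain_def)
  then show ?case by simp
qed

lemma bdd_above_reward_upto:
  assumes "exit_chain S K r" "c \<in> S"
  shows "bdd_above (range (\<lambda>t. reward_upto S K r t c))"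
  using reward_upto_le_1[OF assms] by (auto intro!: bdd_aboveI[of _ 1])

lemma tendsto_total_reward:
  assumes "exit_chain S K r" "c \<in> S"
  shows "(\<lambda>t. reward_upto S K r t c) \<longlonglongrightarrow> total_reward S K r c"
  unfolding total_reward_def
  by (rule LIMSEQ_incseq_SUP[OF bdd_above_reward_upto[OF assms]])
     (intro incseq_SucI reward_upto_mono[OF assms])

lemma reward_upto_le_total_reward:
  assumes "exit_chain S K r" "c \<in> S"
  shows "reward_upto S K r t c \<le> total_reward S K r c"
  unfolding total_reward_def by (rule cSUP_upper[OF _ bdd_above_reward_upto[OF assms]]) simp

lemma total_reward_nonneg:
  assumes "exit_chain S K r" "c \<in> S"
  shows "0 \<le> total_reward S K r c"
  using reward_upto_le_total_reward[OF assms, of 0] by simp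

lemma total_reward_le_supersolution:
  assumes "exit_chain S K r" "c \<in> S"
    and "\<And>c. c \<in> S \<Longrightarrow> 0 \<le> g c"
    and "\<And>c. c \<in> S \<Longrightarrow> r c + (\<Sum>d\<in>S. K c d * g d) \<le> g c"
  shows "total_reward S K r c \<le> g c"
  unfolding total_reward_def
  by (rule cSUP_least) (use reward_upto_le_supersolution[OF assms] in auto)

lemma total_reward_le_1:
  assumes "exit_chain S K r" "c \<in> S"
  shows "total_reward S K r c \<le> 1"
  unfolding total_reward_def by (rule cSUP_least) (use reward_upto_le_1[OF assms] in auto)

lemma total_reward_fixpoint:
  assumes "exit_chain S K r" "c \<in> S"
  shows "total_reward S K r c = r c + (\<Sum>d\<in>S. K c d * total_reward S K r d)"
proof -
  have "(\<lambda>t. reward_upto S K r (Suc t) c) \<longlonglongrightarrow> r c + (\<Sum>d\<in>S. K c d * total_reward S K r d)"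
    using tendsto_total_reward[OF assms(1)] by (auto intro!: tendsto_intros)
  moreover have "(\<lambda>t. reward_upto S K r (Suc t) c) \<longlonglongrightarrow> total_reward S K r c"
    using LIMSEQ_Suc[OF tendsto_total_reward[OF assms]] .
  ultimately show ?thesis using LIMSEQ_unique by blast
qed

text \<open>One minus the value for \<open>q\<close> is a supersolution for \<open>r\<close>,
  because the rows with both rewards sum to at most 1.\<close>

lemma total_reward_add_le_1:
  assumes "exit_chain S K (\<lambda>c. r c + q c)" "\<And>c. c \<in> S \<Longrightarrow> 0 \<le> r c \<and> 0 \<le> q c" "c \<in> S"
  shows "total_reward S K r c + total_reward S K q c \<le> 1"
proof -
  have *: "exit_chain S K r" "exit_chain S K q"
    using assms(1,2) unfolding exit_chain_def by fastforce+
  have "total_reward S K r c \<le> 1 - total_reward S K q c"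
  proof (rule total_reward_le_supersolution[OF *(1) assms(3)])
    fix c assume c: "c \<in> S"
    show "0 \<le> 1 - total_reward S K q c" using total_reward_le_1[OF *(2) c] by simp
    have "(\<Sum>d\<in>S. K c d * (1 - total_reward S K q d)) = (\<Sum>d\<in>S. K c d) - (\<Sum>d\<in>S. K c d * total_reward S K q d)"
      by (simp add: algebra_simps sum_subtractf)
    also have "\<dots> = (\<Sum>d\<in>S. K c d) - (total_reward S K q c - q c)"
      using total_reward_fixpoint[OF *(2) c] by simp
    finally show "r c + (\<Sum>d\<in>S. K c d * (1 - total_reward S K q d)) \<le> 1 - total_reward S K q c"
      using assms(1) c by (auto simp: exit_chain_def)
  qed
  then show ?thesis by simp
qed

text \<open>The set of states with positive reward within \<open>k\<close> steps stabilizes after at most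
  \<open>card S\<close> steps, whence the exponent.\<close>

lemma total_reward_gap:
  assumes ch: "exit_chain S K r" and c: "c \<in> S" and p: "0 < p" "p \<le> 1"
    and r: "\<And>c. c \<in> S \<Longrightarrow> r c = 0 \<or> p \<le> r c"
    and K: "\<And>c d. c \<in> S \<Longrightarrow> d \<in> S \<Longrightarrow> K c d = 0 \<or> p \<le> K c d"
  shows "total_reward S K r c = 0 \<or> p ^ card S \<le> total_reward S K r c"
proof -
  have fin: "finite S" using ch by (simp add: exit_chain_def)
  define A where "A k = {c \<in> S. 0 < reward_upto S K r k c}" for k
  have low: "p ^ k \<le> reward_upto S K r k c" if "c \<in> A k" for k c
    using that
  proof (induction k arbitrary: c)
    case 0
    then show ?case by (simp add: A_def)
  next
    case (Suc k)
    then have cS: "c \<in> S" and pos: "0 < reward_upto S K r (Suc k) c" by (auto simp: A_def)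
    have nn: "0 \<le> K c d * reward_upto S K r k d" if "d \<in> S" for d
      using ch cS that reward_upto_nonneg[OF ch that] by (auto simp: exit_chain_def)
    have r0: "0 \<le> r c" using ch cS by (auto simp: exit_chain_def)
    show ?case
    proof (cases "r c = 0")
      case False
      then have "p \<le> r c" using r[OF cS] by simp
      moreover have "p ^ Suc k \<le> p" using p by (simp add: mult_left_le power_le_one)
      ultimately show ?thesis using sum_nonneg[of S "\<lambda>d. K c d * reward_upto S K r k d"] nn by simp
    next
      case True
      have "\<exists>d\<in>S. 0 < K c d * reward_upto S K r k d"
      proof (rule ccontr)
        assume "\<not> ?thesis"
        then have "(\<Sum>d\<in>S. K c d * reward_upto S K r k d) \<le> 0" by (intro sum_nonpos) force
        then show False using pos True by simp
      qed
      then obtain d where d: "d \<in> S" "0 < K c d * reward_upto S K r k d" by blast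
      then have "K c d \<noteq> 0" "reward_upto S K r k d > 0"
        using reward_upto_nonneg[OF ch d(1), of k] by (auto simp: zero_less_mult_iff)
      then have "p \<le> K c d" "p ^ k \<le> reward_upto S K r k d"
        using K[OF cS d(1)] Suc.IH[of d] d by (auto simp: A_def)
      then have "p ^ Suc k \<le> K c d * reward_upto S K r k d"
        using p by (auto intro: mult_mono)
      also have "\<dots> \<le> (\<Sum>d\<in>S. K c d * reward_upto S K r k d)"
        using nn d(1) fin by (intro member_le_sum) auto
      finally show ?thesis using r0 by simp
    qed
  qed
  \<comment> \<open>\<open>A (Suc k)\<close> is determined by \<open>A k\<close> alone, so the sets
    stay constant after the first repetition.\<close>
  have step: "A (Suc (Suc k)) = A (Suc k)" if "A (Suc k) = A k" for k
  proof -
    have "(0 < reward_upto S K r (Suc (Suc k)) c) = (0 < reward_upto S K r (Suc k) c)" if cS: "c \<in> S" for c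
    proof -
      have pos: "0 < r c + (\<Sum>d\<in>S. K c d * reward_upto S K r j d) \<longleftrightarrow> 0 < r c \<or> (\<exists>d\<in>S. 0 < K c d \<and> d \<in> A j)" for j
      proof -
        have nn: "0 \<le> K c d" "0 \<le> reward_upto S K r j d" if "d \<in> S" for d
          using ch cS that reward_upto_nonneg[OF ch that] by (auto simp: exit_chain_def)
        have r0: "0 \<le> r c" using ch cS by (auto simp: exit_chain_def)
        have "0 < r c + (\<Sum>d\<in>S. K c d * reward_upto S K r j d) \<longleftrightarrow> 0 < r c \<or> 0 < (\<Sum>d\<in>S. K c d * reward_upto S K r j d)"
          using r0 nn by (smt (verit, best) mult_nonneg_nonneg sum_nonneg)
        also have "0 < (\<Sum>d\<in>S. K c d * reward_upto S K r j d) \<longleftrightarrow> (\<exists>d\<in>S. 0 < K c d * reward_upto S K r j d)"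
          using nn sum_nonneg_eq_0_iff[OF fin, of "\<lambda>d. K c d * reward_upto S K r j d"]
            sum_nonneg[of S "\<lambda>d. K c d * reward_upto S K r j d"]
          by (smt (verit, best) mult_nonneg_nonneg)
        finally show ?thesis using nn by (auto simp: A_def zero_less_mult_iff) (meson not_less)+
      qed
      show ?thesis using pos[of "Suc k"] pos[of k] \<open>A (Suc k) = A k\<close> by simp
    qed
    then show ?thesis by (auto simp: A_def)
  qed
  have mono: "A k \<subseteq> A (Suc k)" for k
    using reward_upto_mono[OF ch, of _ k] by (auto simp: A_def simp del: reward_upto.simps intro: less_le_trans)
  \<comment> \<open>Until the first repetition every step adds an element, which can happen at most
    \<open>card S\<close> times.\<close>
  have stab: "A (Suc k) = A k \<or> Suc k \<le> card (A (Suc k))" for k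
  proof (induction k)
    case 0
    have "finite (A (Suc 0))" using fin by (simp add: A_def)
    moreover have "A 0 = {}" by (simp add: A_def)
    ultimately show ?case by (cases "A (Suc 0) = {}") (auto simp: Suc_le_eq card_gt_0_iff)
  next
    case (Suc k)
    show ?case
    proof (cases "A (Suc (Suc k)) = A (Suc k)")
      case False
      then have "A (Suc k) \<noteq> A k" using step by blast
      then have "Suc k \<le> card (A (Suc k))" using Suc by blast
      moreover have "card (A (Suc k)) < card (A (Suc (Suc k)))"
        using False mono[of "Suc k"] fin by (intro psubset_card_mono) (auto simp: A_def)
      ultimately show ?thesis by simp
    qed simp
  qed
  have "card (A (Suc (card S))) \<le> card S" using fin by (intro card_mono) (auto simp: A_def)
  then have base: "A (Suc (card S)) = A (card S)" using stab[of "card S"] by linarith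
  have all: "A (card S + k) = A (card S)" for k
  proof -
    have "A (card S + k) = A (card S) \<and> A (Suc (card S + k)) = A (card S + k)"
      by (induction k) (use base step in auto)
    then show ?thesis by simp
  qed
  have sub: "A k \<subseteq> A (card S)" for k
  proof -
    have "A k \<subseteq> A (k + j)" for j by (induction j) (use mono in auto)
    from this[of "card S"] show ?thesis using all[of k] by (simp add: add.commute)
  qed
  show ?thesis
  proof (cases "c \<in> A (card S)")
    case True
    then show ?thesis using low reward_upto_le_total_reward[OF ch c, of "card S"] by fastforce
  next
    case False
    then have "reward_upto S K r t c \<le> 0" for t using sub[of t] c by (force simp: A_def)
    then have "total_reward S K r c \<le> 0" unfolding total_reward_def by (intro cSUP_least) auto
    then show ?thesis using total_reward_nonneg[OF ch c] by simp
  qed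
qed

lemma total_reward_cong:
  assumes "\<And>c. c \<in> S \<Longrightarrow> r c = r' c" "\<And>c d. c \<in> S \<Longrightarrow> d \<in> S \<Longrightarrow> K c d = K' c d" "c \<in> S"
  shows "total_reward S K r c = total_reward S K' r' c"
proof -
  have "reward_upto S K r t c = reward_upto S K' r' t c" if "c \<in> S" for t c
    using that by (induction t arbitrary: c) (simp_all add: assms)
  then show ?thesis using assms(3) by (simp add: total_reward_def)
qed

text \<open>An exit through \<open>q\<close> is worth \<open>H\<close>. The combined reward r + q *
  H need not form an \<open>exit_chain\<close>, so the comparison with a supersolution is repeated
  for the two iterations together.\<close>

lemma total_reward_scale_add_le:
  assumes 1: "exit_chain S K r" and 2: "exit_chain S K q" and c: "c \<in> S" and H: "0 \<le> H"
    and g: "\<And>c. c \<in> S \<Longrightarrow> 0 \<le> g c"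
    "\<And>c. c \<in> S \<Longrightarrow> r c + q c * H + (\<Sum>d\<in>S. K c d * g d) \<le> g c"
  shows "total_reward S K r c + total_reward S K q c * H \<le> g c"
proof -
  have "reward_upto S K r t c + reward_upto S K q t c * H \<le> g c" if "c \<in> S" for t c
    using that
  proof (induction t arbitrary: c)
    case (Suc t)
    have "reward_upto S K r (Suc t) c + reward_upto S K q (Suc t) c * H
       = r c + q c * H + (\<Sum>d\<in>S. K c d * (reward_upto S K r t d + reward_upto S K q t d * H))"
      by (simp add: algebra_simps sum.distrib sum_distrib_left sum_distrib_right)
    also have "\<dots> \<le> r c + q c * H + (\<Sum>d\<in>S. K c d * g d)"
      using Suc 1 by (auto simp: exit_chain_def intro!: sum_mono mult_left_mono)
    also have "\<dots> \<le> g c" using g(2) Suc.prems by blast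
    finally show ?case .
  qed (use g in simp)
  moreover have "(\<lambda>t. reward_upto S K r t c + reward_upto S K q t c * H)
     \<longlonglongrightarrow> total_reward S K r c + total_reward S K q c * H"
    using tendsto_total_reward[OF 1 c] tendsto_total_reward[OF 2 c] by (intro tendsto_intros)
  ultimately show ?thesis using c by (intro LIMSEQ_le_const2) auto
qed

text \<open>Let \<open>\<alpha> d\<close> be the reward collected from \<open>d\<close> before the first visit to \<open>i\<close> and \<open>\<beta> d\<close> the
  probability of that visit; neither depends on row \<open>i\<close>.  The value at \<open>i\<close> is
  \<open>(r i + \<Sum>K i d * \<alpha> d) / (1 - \<Sum>K i d * \<beta> d)\<close>, and since row \<open>i\<close> is stochastic, the
  denominator is a sum of its entries with nonnegative coefficients.\<close>

lemma total_reward_perturb_row: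
  assumes ch: "exit_chain S K r" and ch': "exit_chain S K' r'" and i: "i \<in> S" and c: "c \<in> S" and t: "1 \<le> t"
    and same: "\<And>c. c \<in> S \<Longrightarrow> c \<noteq> i \<Longrightarrow> r c = r' c"
      "\<And>c d. c \<in> S \<Longrightarrow> d \<in> S \<Longrightarrow> c \<noteq> i \<Longrightarrow> K c d = K' c d"
    and one: "r i + q + (\<Sum>d\<in>S. K i d) = 1" "r' i + q' + (\<Sum>d\<in>S. K' i d) = 1"
    and close: "r i \<le> t * r' i" "r' i \<le> t * r i" "q' \<le> t * q"
      "\<And>d. d \<in> S \<Longrightarrow> K i d \<le> t * K' i d" "\<And>d. d \<in> S \<Longrightarrow> K' i d \<le> t * K i d"
  shows "total_reward S K r c \<le> t ^ 2 * total_reward S K' r' c"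
proof -
  let ?S = "S - {i}" and ?h = "total_reward S K' r'"
  have fin: "finite S" using ch by (simp add: exit_chain_def)
  have split: "(\<Sum>d\<in>S. f d) = f i + (\<Sum>d\<in>?S. f d)" for f :: "'a \<Rightarrow> real"
    using fin i by (simp add: sum.remove)
  have bound: "0 \<le> r c" "0 \<le> K c i" "r c + (K c i + sum (K c) ?S) \<le> 1" if "c \<in> S" for c
    using ch that i unfolding exit_chain_def split by auto
  have bound': "r c + sum (K c) ?S \<le> 1" "K c i + sum (K c) ?S \<le> 1" if "c \<in> S" for c
    using bound[OF that] by linarith+
  have chA: "exit_chain ?S K r"
    using ch bound' unfolding exit_chain_def by blast
  have chB: "exit_chain ?S K (\<lambda>c. K c i)"
    using fin bound bound' ch unfolding exit_chain_def by blast
  define \<alpha> where "\<alpha> d = (if d = i then 0 else total_reward ?S K r d)" for d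
  define \<beta> where "\<beta> d = (if d = i then 1 else total_reward ?S K (\<lambda>c. K c i) d)" for d
  have \<alpha>0: "0 \<le> \<alpha> d" and \<beta>0: "0 \<le> \<beta> d" if "d \<in> S" for d
    using that total_reward_nonneg[OF chA, of d] total_reward_nonneg[OF chB, of d] by (auto simp: \<alpha>_def \<beta>_def)
  have \<beta>1: "\<beta> d \<le> 1" if "d \<in> S" for d
    using that total_reward_le_1[OF chB, of d] by (auto simp: \<beta>_def)
  have \<alpha>eq: "\<alpha> d = r d + (\<Sum>e\<in>S. K d e * \<alpha> e)" if "d \<in> S" "d \<noteq> i" for d
    using that total_reward_fixpoint[OF chA, of d] by (simp add: \<alpha>_def split)
  have \<beta>eq: "\<beta> d = (\<Sum>e\<in>S. K d e * \<beta> e)" if "d \<in> S" "d \<noteq> i" for d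
    using that total_reward_fixpoint[OF chB, of d] by (simp add: \<beta>_def split)
  have h0: "0 \<le> ?h d" if "d \<in> S" for d using total_reward_nonneg[OF ch' that] .
  \<comment> \<open>Rows other than \<open>i\<close> agree, so \<alpha> and \<beta> also describe
    the second chain until it visits \<open>i\<close>, from where it is worth
    \<open>?h i\<close>.\<close>
  have h'ge: "\<alpha> d + \<beta> d * ?h i \<le> ?h d" if "d \<in> S" for d
  proof (cases "d = i")
    case False
    have "total_reward ?S K r d + total_reward ?S K (\<lambda>c. K c i) d * ?h i \<le> ?h d"
    proof (rule total_reward_scale_add_le[OF chA chB])
      fix c assume "c \<in> ?S"
      then have "?h c = r c + (\<Sum>d\<in>S. K c d * ?h d)"
        using total_reward_fixpoint[OF ch', of c] same by simp
      then show "r c + K c i * ?h i + (\<Sum>d\<in>?S. K c d * ?h d) \<le> ?h c" by (simp add: split)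
    qed (use that False h0 i in auto)
    then show ?thesis using False by (simp add: \<alpha>_def \<beta>_def)
  qed (simp add: \<alpha>_def \<beta>_def)
  define a a' b b' where "a = r i + (\<Sum>d\<in>S. K i d * \<alpha> d)" and "a' = r' i + (\<Sum>d\<in>S. K' i d * \<alpha> d)"
    and "b = (\<Sum>d\<in>S. K i d * \<beta> d)" and "b' = (\<Sum>d\<in>S. K' i d * \<beta> d)"
  have aa: "a \<le> t * a'"
  proof -
    have "(\<Sum>d\<in>S. K i d * \<alpha> d) \<le> (\<Sum>d\<in>S. t * (K' i d * \<alpha> d))"
      using close(4) \<alpha>0 by (intro sum_mono) (metis mult.assoc mult_right_mono)
    then show ?thesis using close(1) by (simp add: a_def a'_def distrib_left sum_distrib_left)
  qed
  \<comment> \<open>Closeness of \<open>b\<close> and \<open>b'\<close> says nothing about 1 - b and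
    1 - b'. Stochasticity rewrites these differences as sums of nonnegative terms, to which the
    factor \<open>t\<close> carries over.\<close>
  have b_eq: "1 - b = r i + q + (\<Sum>d\<in>S. K i d * (1 - \<beta> d))" "1 - b' = r' i + q' + (\<Sum>d\<in>S. K' i d * (1 - \<beta> d))"
    using one by (simp_all add: b_def b'_def right_diff_distrib sum_subtractf)
  have bb: "1 - b' \<le> t * (1 - b)"
  proof -
    have "(\<Sum>d\<in>S. K' i d * (1 - \<beta> d)) \<le> (\<Sum>d\<in>S. t * (K i d * (1 - \<beta> d)))"
      using close(5) \<beta>1 by (intro sum_mono) (metis diff_ge_0_iff_ge mult.assoc mult_right_mono)
    then show ?thesis unfolding b_eq using close(2,3) by (simp add: distrib_left sum_distrib_left)
  qed
  \<comment> \<open>The fixpoint equation at \<open>i\<close> in a form without division, since 1 -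
    b' may be 0.\<close>
  have hi: "a' \<le> ?h i * (1 - b')"
  proof -
    have "(\<Sum>d\<in>S. K' i d * (\<alpha> d + \<beta> d * ?h i)) \<le> (\<Sum>d\<in>S. K' i d * ?h d)"
      using ch' i h'ge by (intro sum_mono mult_left_mono) (auto simp: exit_chain_def)
    then have "a' + b' * ?h i \<le> ?h i"
      unfolding a'_def b'_def
      using total_reward_fixpoint[OF ch' i]
      by (simp only: distrib_left sum.distrib sum_distrib_right mult.assoc)
    moreover have "?h i * (1 - b') = ?h i - b' * ?h i" by (simp add: algebra_simps)
    ultimately show ?thesis by linarith
  qed
  let ?H = "t ^ 2 * ?h i"
  \<comment> \<open>The supersolution inequality at row \<open>i\<close>. One factor
    \<open>t\<close> stems from the numerator, the other from the denominator.\<close>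
  have key: "a + b * ?H \<le> ?H"
  proof -
    have "t * a' \<le> t * (?h i * (1 - b'))" using hi t by (intro mult_left_mono) auto
    then have "a \<le> t * (?h i * (1 - b'))" using aa by linarith
    also have "\<dots> \<le> t * (?h i * (t * (1 - b)))"
      using bb h0[OF i] t by (intro mult_left_mono) auto
    also have "\<dots> = ?H - b * ?H" by (simp add: algebra_simps power2_eq_square)
    finally show ?thesis by simp
  qed
  have "total_reward S K r c \<le> \<alpha> c + \<beta> c * ?H"
  proof (rule total_reward_le_supersolution[OF ch c])
    fix c assume cS: "c \<in> S"
    show "0 \<le> \<alpha> c + \<beta> c * ?H" using \<alpha>0 \<beta>0 cS h0[OF i] by simp
    have s: "(\<Sum>d\<in>S. K c d * (\<alpha> d + \<beta> d * ?H)) = (\<Sum>d\<in>S. K c d * \<alpha> d) + (\<Sum>d\<in>S. K c d * \<beta> d) * ?H"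
      by (simp add: distrib_left sum.distrib sum_distrib_right mult.assoc)
    show "r c + (\<Sum>d\<in>S. K c d * (\<alpha> d + \<beta> d * ?H)) \<le> \<alpha> c + \<beta> c * ?H"
    proof (cases "c = i")
      case True
      moreover have "\<alpha> i = 0" "\<beta> i = 1" by (simp_all add: \<alpha>_def \<beta>_def)
      ultimately show ?thesis using key unfolding s by (simp add: a_def b_def)
    next
      case False
      show ?thesis using \<alpha>eq[OF cS False] by (simp only: s \<beta>eq[OF cS False, symmetric])
    qed
  qed
  also have "\<dots> \<le> t ^ 2 * (\<alpha> c + \<beta> c * ?h i)"
  proof -
    have "1 \<le> t\<^sup>2" using t by simp
    then have "1 * \<alpha> c \<le> t ^ 2 * \<alpha> c" by (rule mult_right_mono) (rule \<alpha>0[OF c])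
    then show ?thesis by (simp add: algebra_simps)
  qed
  also have "\<dots> \<le> t ^ 2 * ?h c" using h'ge[OF c] by (intro mult_left_mono) auto
  finally show ?thesis .
qed

text \<open>Rows are exchanged one at a time. Every hybrid chain consists of rows of the two given
  ones, so the hypotheses persist, and each exchange costs \<open>t ^ 2\<close>.\<close>

lemma total_reward_perturb_rows:
  assumes ch: "exit_chain S K r" and ch': "exit_chain S K' r'" and c: "c \<in> S" and t: "1 \<le> t"
    and A: "A \<subseteq> S"
    and same: "\<And>c. c \<in> S - A \<Longrightarrow> r c = r' c"
      "\<And>c d. c \<in> S - A \<Longrightarrow> d \<in> S \<Longrightarrow> K c d = K' c d"
    and one: "\<And>c. c \<in> A \<Longrightarrow> r c + q c + (\<Sum>d\<in>S. K c d) = 1" "\<And>c. c \<in> A \<Longrightarrow> r' c + q' c + (\<Sum>d\<in>S. K' c d) = 1"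
    and close: "\<And>c. c \<in> A \<Longrightarrow> r c \<le> t * r' c" "\<And>c. c \<in> A \<Longrightarrow> r' c \<le> t * r c" "\<And>c. c \<in> A \<Longrightarrow> q' c \<le> t * q c"
      "\<And>c d. c \<in> A \<Longrightarrow> d \<in> S \<Longrightarrow> K c d \<le> t * K' c d" "\<And>c d. c \<in> A \<Longrightarrow> d \<in> S \<Longrightarrow> K' c d \<le> t * K c d"
  shows "total_reward S K r c \<le> t ^ (2 * card A) * total_reward S K' r' c"
proof -
  have "finite S" using ch by (simp add: exit_chain_def)
  then have "finite A" using A finite_subset by blast
  then show ?thesis using A same one close ch
  proof (induction A arbitrary: K r rule: finite_induct)
    case empty
    have "total_reward S K r c = total_reward S K' r' c"
      by (rule total_reward_cong[OF _ _ c]) (use empty in auto)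
    then show ?case by simp
  next
    case (insert i A)
    let ?K = "\<lambda>c. if c = i then K' i else K c" and ?r = "\<lambda>c. if c = i then r' i else r c"
    have ch1: "exit_chain S ?K ?r" using insert.prems(11) ch' by (auto simp: exit_chain_def)
    have "total_reward S K r c \<le> t ^ 2 * total_reward S ?K ?r c"
      by (rule total_reward_perturb_row[OF insert.prems(11) ch1 _ c t, where i = i and q = "q i" and q' = "q' i"])
         (use insert.prems in auto)
    also have "total_reward S ?K ?r c \<le> t ^ (2 * card A) * total_reward S K' r' c"
      by (rule insert.IH) (use insert.prems insert.hyps ch1 in auto)
    finally show ?case using insert.hyps t by (simp add: power_add mult.assoc power2_eq_square)
  qed
qed

section \<open>Square roots of efficiently computable numbers\<close>

lemma runs_While:
  assumes step: "\<And>j r. I (Suc j) r \<Longrightarrow> r x \<noteq> 0 \<and> (\<exists>t\<le>T. \<exists>r'. runs p r t r' \<and> I j r')"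
    and stop: "\<And>r. I 0 r \<Longrightarrow> r x = 0"
    and init: "I j r"
  shows "\<exists>t\<le>1 + j * (T + 1). \<exists>r'. runs (While x p) r t r' \<and> I 0 r'"
  using init
proof (induction j arbitrary: r)
  case 0
  then show ?case using runs.While_exit[of r x p] stop by auto
next
  case (Suc j)
  obtain t r' where 1: "r x \<noteq> 0" "t \<le> T" "runs p r t r'" "I j r'" using step[OF Suc.prems] by blast
  obtain t' r'' where 2: "t' \<le> 1 + j * (T + 1)" "runs (While x p) r' t' r''" "I 0 r''"
    using Suc.IH[OF 1(4)] by blast
  have "runs (While x p) r (1 + t + t') r''" using runs.While_loop[OF 1(1) 1(3) 2(2)] .
  moreover have "1 + t + t' \<le> 1 + Suc j * (T + 1)" using 1(2) 2(1) by simp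
  ultimately show ?case using 2(3) by blast
qed

text \<open>On loop-free programs result and running time are functions that simplification can
  evaluate, so that only loops need invariants.\<close>

fun straight :: "prog \<Rightarrow> bool" where
  "straight (Seq p q) \<longleftrightarrow> straight p \<and> straight q"
| "straight (While x p) \<longleftrightarrow> False"
| "straight _ \<longleftrightarrow> True"

fun exec :: "prog \<Rightarrow> (nat \<Rightarrow> nat) \<Rightarrow> nat \<Rightarrow> nat" where
  "exec (Const d k) r = r(d := k)"
| "exec (Add d x y) r = r(d := r x + r y)"
| "exec (Sub d x y) r = r(d := r x - r y)"
| "exec (Half d x) r = r(d := r x div 2)"
| "exec (Seq p q) r = exec q (exec p r)"
| "exec (While x p) r = r"

fun run_time :: "prog \<Rightarrow> nat" where
  "run_time (Seq p q) = run_time p + run_time q"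
| "run_time _ = 1"

lemma runs_straight: "straight p \<Longrightarrow> runs p r (run_time p) (exec p r)"
  by (induction p arbitrary: r) (auto intro: runs.intros[simplified])

lemma runs_straightI: "straight p \<Longrightarrow> run_time p = t \<Longrightarrow> exec p r = r' \<Longrightarrow> runs p r t r'"
  using runs_straight by blast

text \<open>A conditional is a loop whose body clears the guard.\<close>

lemma runs_If:
  assumes "straight p" "\<And>r. exec p r x = 0"
  shows "\<exists>t\<le>2 + run_time p. runs (While x p) r t (if r x = 0 then r else exec p r)"
proof (cases "r x = 0")
  case True
  then show ?thesis using runs.While_exit[of r x p] by (auto intro!: exI[of _ 1])
next
  case False
  have "runs (While x p) r (1 + run_time p + 1) (exec p r)"
    using False runs_straight[OF assms(1)] assms(2) by (blast intro: runs.While_loop runs.While_exit)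
  then show ?thesis using False by (auto intro!: exI[of _ "1 + run_time p + 1"])
qed

text \<open>The digit-by-digit square root of the number \<open>X\<close> in register 0.  The first loop finds in
  register 1 the least power of 4 exceeding \<open>X\<close>.  In the second loop, with \<open>4 ^ j\<close> in register 1,
  there is \<open>y\<close> with \<open>y\<^sup>2 \<le> X < (y + 2 ^ j)\<^sup>2\<close> such that register 0 holds \<open>X - y\<^sup>2\<close> and register 2
  holds \<open>2 ^ j * y\<close>.\<close>

definition sqrt_pre :: prog where
  "sqrt_pre = Seq (Const 1 1) (Seq (Const 3 0) (Add 3 0 3))"

definition sqrt_grow :: prog where
  "sqrt_grow = Seq (Add 1 1 1) (Seq (Add 1 1 1) (Seq (Const 3 1) (Seq (Add 3 0 3) (Sub 3 3 1))))"

text \<open>Subtraction is truncated: register 3, the remainder plus 1 minus the trial amount in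
  register 4, is nonzero exactly if that amount fits into the remainder. It guards the conditional
  subtraction.\<close>

definition sqrt_digit_pre :: prog where
  "sqrt_digit_pre = Seq (Half 1 1) (Seq (Half 1 1) (Seq (Add 4 2 1) (Seq (Const 5 1) (Seq (Add 3 0 5) (Seq (Sub 3 3 4) (Half 2 2))))))"

definition sqrt_digit_sub :: prog where
  "sqrt_digit_sub = Seq (Sub 0 0 4) (Seq (Add 2 2 1) (Const 3 0))"

definition sqrt_digit :: prog where
  "sqrt_digit = Seq sqrt_digit_pre (Seq (While 3 sqrt_digit_sub) (Seq (Const 5 1) (Sub 6 1 5)))"

definition sqrt_mid :: prog where
  "sqrt_mid = Seq (Const 2 0) (Seq (Const 5 1) (Sub 6 1 5))"

text \<open>Division by 4 with rounding, which drops the two guard digits of the root.\<close>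

definition sqrt_post :: prog where
  "sqrt_post = Seq (Const 5 2) (Seq (Add 2 2 5) (Seq (Half 2 2) (Half 0 2)))"

definition sqrt_prog :: prog where
  "sqrt_prog = Seq sqrt_pre (Seq (While 3 sqrt_grow) (Seq sqrt_mid (Seq (While 6 sqrt_digit) sqrt_post)))"

lemma runs_sqrt_digit:
  assumes r: "r 1 = 4 ^ Suc j" "r 2 = 2 ^ Suc j * y" "y\<^sup>2 \<le> X" "r 0 = X - y\<^sup>2" "X < (y + 2 ^ Suc j)\<^sup>2"
  shows "\<exists>t\<le>14. \<exists>r'. runs sqrt_digit r t r' \<and> r' 1 = 4 ^ j \<and> r' 6 = 4 ^ j - 1 \<and>
    (\<exists>y. r' 2 = 2 ^ j * y \<and> y\<^sup>2 \<le> X \<and> r' 0 = X - y\<^sup>2 \<and> X < (y + 2 ^ j)\<^sup>2)"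
proof -
  have st: "straight sqrt_digit_pre" "straight sqrt_digit_sub" by (simp_all add: sqrt_digit_pre_def sqrt_digit_sub_def)
  define r1 where "r1 = exec sqrt_digit_pre r"
  define r2 where "r2 = (if r1 3 = 0 then r1 else exec sqrt_digit_sub r1)"
  define r3 where "r3 = exec (Seq (Const 5 1) (Sub 6 1 5)) r2"
  have 1: "runs sqrt_digit_pre r 7 r1"
    by (rule runs_straightI) (simp_all add: r1_def sqrt_digit_pre_def)
  obtain t where 2: "t \<le> 5" "runs (While 3 sqrt_digit_sub) r1 t r2"
    using runs_If[OF st(2), of 3 r1] by (auto simp: r2_def sqrt_digit_sub_def)
  have 3: "runs (Seq (Const 5 1) (Sub 6 1 5)) r2 2 r3"
    by (rule runs_straightI) (simp_all add: r3_def)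
  have run: "runs sqrt_digit r (7 + (t + 2)) r3"
    unfolding sqrt_digit_def by (rule runs.Seq[OF 1 runs.Seq[OF 2(2) 3]])
  have v: "r1 0 = X - y\<^sup>2" "r1 1 = 4 ^ j" "r1 4 = 2 ^ Suc j * y + 4 ^ j" "r1 2 = 2 ^ j * y"
    "r1 3 = X - y\<^sup>2 + 1 - (2 ^ Suc j * y + 4 ^ j)"
    using r by (simp_all add: r1_def sqrt_digit_pre_def)
  have pow4: "((2::nat) ^ j)\<^sup>2 = 4 ^ j" by (simp flip: power_mult_distrib add: power2_eq_square)
  have sq: "(y + 2 ^ j)\<^sup>2 = y\<^sup>2 + (2 ^ Suc j * y + 4 ^ j)"
    by (simp add: power2_sum flip: pow4)
  show ?thesis
  proof (cases "(y + 2 ^ j)\<^sup>2 \<le> X")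
    case True
    then have "r1 3 \<noteq> 0" unfolding v sq by simp
    then have "r3 1 = 4 ^ j" "r3 6 = 4 ^ j - 1" "r3 2 = 2 ^ j * (y + 2 ^ j)" "r3 0 = X - (y + 2 ^ j)\<^sup>2"
      using True unfolding sq by (simp_all add: r3_def r2_def sqrt_digit_sub_def v v[simplified] distrib_left flip: power_mult_distrib)
    moreover have "X < (y + 2 ^ j + 2 ^ j)\<^sup>2" using r(5) by (simp add: mult_2 add.assoc)
    ultimately show ?thesis using run 2(1) True by (intro exI[of _ "7 + (t + 2)"]) auto
  next
    case False
    then have "r1 3 = 0" using r(3) unfolding v sq by simp
    then have "r3 1 = 4 ^ j" "r3 6 = 4 ^ j - 1" "r3 2 = 2 ^ j * y" "r3 0 = X - y\<^sup>2"
      by (simp_all add: r3_def r2_def v v[simplified])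
    then show ?thesis using run 2(1) False r(3) by (intro exI[of _ "7 + (t + 2)"]) auto
  qed
qed

lemma runs_sqrt_prog:
  assumes X: "r 0 = X" "X < 4 ^ k"
  shows "\<exists>t\<le>40 * (k + 1). \<exists>r' y. runs sqrt_prog r t r' \<and> r' 0 = (y + 2) div 4 \<and> y\<^sup>2 \<le> X \<and> X < (y + 1)\<^sup>2"
proof -
  define K where "K = (LEAST k. X < 4 ^ k)"
  have K: "X < 4 ^ K" "K \<le> k" unfolding K_def using X LeastI[of "\<lambda>k. X < 4 ^ k" k] Least_le[of "\<lambda>k. X < 4 ^ k" k] by auto
  have less: "4 ^ i \<le> X" if "i < K" for i using not_less_Least[OF that[unfolded K_def]] by simp
  \<comment> \<open>\<open>j\<close> is the number of iterations left. Register 3 is 0 exactly if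
    the power of 4 exceeds \<open>X\<close>.\<close>
  let ?I = "\<lambda>j r. j \<le> K \<and> r (1::nat) = (4::nat) ^ (K - j) \<and> r 0 = X \<and> r 3 = X + 1 - 4 ^ (K - j)"
  define r1 where "r1 = exec sqrt_pre r"
  have 1: "runs sqrt_pre r 3 r1" by (rule runs_straightI) (simp_all add: r1_def sqrt_pre_def)
  have "\<exists>t\<le>1 + K * (5 + 1). \<exists>r'. runs (While 3 sqrt_grow) r1 t r' \<and> ?I 0 r'"
  proof (rule runs_While[where I = ?I])
    fix j r assume I: "?I (Suc j) r"
    have "runs sqrt_grow r 5 (exec sqrt_grow r)" by (rule runs_straightI) (simp_all add: sqrt_grow_def)
    moreover have "?I j (exec sqrt_grow r)"
    proof -
      have "(4::nat) ^ (K - j) = 4 * 4 ^ (K - Suc j)" using I by (metis Suc_diff_le diff_Suc_Suc power_Suc)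
      then show ?thesis using I by (simp add: sqrt_grow_def)
    qed
    moreover have "r 3 \<noteq> 0" using I less[of "K - Suc j"] by simp
    ultimately show "r 3 \<noteq> 0 \<and> (\<exists>t\<le>5. \<exists>r'. runs sqrt_grow r t r' \<and> ?I j r')" by blast
  next
    show "?I 0 r \<Longrightarrow> r 3 = 0" for r using K by simp
    show "?I K r1" using X by (simp add: r1_def sqrt_pre_def)
  qed
  then obtain t2 r2 where 2: "t2 \<le> 1 + K * (5 + 1)" "runs (While 3 sqrt_grow) r1 t2 r2" "r2 1 = 4 ^ K" "r2 0 = X"
    by auto
  define r3 where "r3 = exec sqrt_mid r2"
  have 3: "runs sqrt_mid r2 3 r3" by (rule runs_straightI) (simp_all add: r3_def sqrt_mid_def)
  let ?J = "\<lambda>j r. r (1::nat) = (4::nat) ^ j \<and> r 6 = 4 ^ j - 1 \<and>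
    (\<exists>y. r 2 = 2 ^ j * y \<and> y\<^sup>2 \<le> X \<and> r 0 = X - y\<^sup>2 \<and> X < (y + 2 ^ j)\<^sup>2)"
  have "\<exists>t\<le>1 + K * (14 + 1). \<exists>r'. runs (While 6 sqrt_digit) r3 t r' \<and> ?J 0 r'"
  proof (rule runs_While[where I = ?J])
    fix j r assume J: "?J (Suc j) r"
    then obtain y where "r 2 = 2 ^ Suc j * y" "y\<^sup>2 \<le> X" "r 0 = X - y\<^sup>2" "X < (y + 2 ^ Suc j)\<^sup>2" by blast
    from runs_sqrt_digit[OF _ this] J
    have "\<exists>t\<le>14. \<exists>r'. runs sqrt_digit r t r' \<and> ?J j r'" by simp
    moreover have "r 6 \<noteq> 0" using J one_less_power[of "4::nat" "Suc j"] by simp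
    ultimately show "r 6 \<noteq> 0 \<and> (\<exists>t\<le>14. \<exists>r'. runs sqrt_digit r t r' \<and> ?J j r')" by blast
  next
    show "?J 0 r \<Longrightarrow> r 6 = 0" for r by simp
    have "(2 ^ K)\<^sup>2 = (4::nat) ^ K" by (simp flip: power_mult_distrib add: power2_eq_square)
    then show "?J K r3" using 2 K by (simp add: r3_def sqrt_mid_def)
  qed
  then obtain t4 r4 y where 4: "t4 \<le> 1 + K * (14 + 1)" "runs (While 6 sqrt_digit) r3 t4 r4"
    "r4 2 = y" "y\<^sup>2 \<le> X" "X < (y + 1)\<^sup>2" by auto
  have 5: "runs sqrt_post r4 4 (exec sqrt_post r4)"
    by (rule runs_straightI) (simp_all add: sqrt_post_def)
  have "runs sqrt_prog r (3 + (t2 + (3 + (t4 + 4)))) (exec sqrt_post r4)"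
    unfolding sqrt_prog_def by (rule runs.Seq[OF 1 runs.Seq[OF 2(2) runs.Seq[OF 3 runs.Seq[OF 4(2) 5]]]])
  moreover have "exec sqrt_post r4 0 = (y + 2) div 4"
    using 4(3) by (simp add: sqrt_post_def div_mult2_eq[symmetric])
  moreover have "3 + (t2 + (3 + (t4 + 4))) \<le> 40 * (k + 1)" using 2(1) 4(1) K(2) by simp
  ultimately show ?thesis using 4(4,5) by blast
qed

lemma approx_divide:
  fixes x :: real
  assumes "0 < P" "\<bar>x * P - D\<bar> \<le> 1"
  shows "\<bar>x - D / P\<bar> \<le> 1 / P"
proof -
  have "x - D / P = (x * P - D) / P" using assms(1) by (simp add: field_simps)
  then show ?thesis using assms by (simp add: divide_right_mono)
qed

text \<open>The root is taken of an approximation with 2 * (n + 2) binary digits, as a root halves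
  their number. By subadditivity of the square root and truncation to an integer, \<open>y\<close>
  differs from \<open>sqrt x * 2 ^ (n + 2)\<close> by at most 2. Together with rounding the
  deviation stays below 4 units, which the division by 4 turns into one unit of the last
  place.\<close>

lemma eff_real_sqrt:
  assumes x: "eff_real x" "0 \<le> x" "x \<le> 1"
  shows "eff_real (sqrt x)"
proof -
  obtain f where f: "poly_time f" and fx: "\<And>n. \<bar>x - real (f n) / 2 ^ n\<bar> \<le> 1 / 2 ^ n"
    using x by (auto simp: eff_real_def)
  obtain p k where p: "\<And>n. \<exists>t r. runs p ((\<lambda>_. 0)(0 := n)) t r \<and> r 0 = f n \<and> t \<le> k * (n + 1) ^ k"
    using f unfolding poly_time_def by blast
  \<comment> \<open>The auxiliary register is cleared again, as \<open>p\<close> is specified only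
    for runs in which all registers but the input are 0. The root program makes no such
    demand.\<close>
  define pre where "pre = Seq (Const 1 2) (Seq (Add 0 0 1) (Seq (Add 0 0 0) (Const 1 0)))"
  define q where "q = Seq pre (Seq p sqrt_prog)"
  define X where "X n = f (2 * (n + 2))" for n
  have X4: "\<bar>x - real (X n) / 4 ^ (n + 2)\<bar> \<le> 1 / 4 ^ (n + 2)" for n
    using fx[of "2 * (n + 2)"] unfolding X_def power_mult by simp
  have Xlt: "X n < 4 ^ (n + 3)" for n
  proof -
    have "real (X n) / 4 ^ (n + 2) \<le> 1 + 1 / 4 ^ (n + 2)" using X4[of n] x by linarith
    then have "real (X n) \<le> 4 ^ (n + 2) + 1" by (simp add: field_simps)
    also have "\<dots> < 4 ^ (n + 3)"
      using one_le_power[of "4::real" "n + 2"] by (simp add: power_add)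
    finally show ?thesis by (metis of_nat_less_iff of_nat_numeral of_nat_power)
  qed
  have main: "\<exists>t r y. runs q ((\<lambda>_. 0)(0 := n)) t r \<and> r 0 = (y + 2) div 4 \<and> y\<^sup>2 \<le> X n \<and> X n < (y + 1)\<^sup>2
       \<and> t \<le> 4 + k * (2 * (n + 2) + 1) ^ k + 40 * (n + 4)" for n
  proof -
    obtain t r where 1: "runs p ((\<lambda>_. 0)(0 := 2 * (n + 2))) t r" "r 0 = X n" "t \<le> k * (2 * (n + 2) + 1) ^ k"
      using p unfolding X_def by blast
    obtain t' r' y where 2: "t' \<le> 40 * (n + 3 + 1)" "runs sqrt_prog r t' r'" "r' 0 = (y + 2) div 4" "y\<^sup>2 \<le> X n" "X n < (y + 1)\<^sup>2"
      using runs_sqrt_prog[of r "X n" "n + 3"] 1(2) Xlt[of n] by blast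
    have "runs pre ((\<lambda>_. 0)(0 := n)) 4 ((\<lambda>_. 0)(0 := 2 * (n + 2)))"
      by (rule runs_straightI) (auto simp: pre_def fun_eq_iff)
    then have "runs q ((\<lambda>_. 0)(0 := n)) (4 + (t + t')) r'"
      unfolding q_def using 1(1) 2(2) by (blast intro: runs.Seq)
    then show ?thesis using 2 1(3) by (intro exI[of _ "4 + (t + t')"] exI[of _ r'] exI[of _ y]) auto
  qed
  then obtain T R y where m: "\<And>n. runs q ((\<lambda>_. 0)(0 := n)) (T n) (R n)" "\<And>n. R n 0 = (y n + 2) div 4"
    "\<And>n. (y n)\<^sup>2 \<le> X n" "\<And>n. X n < (y n + 1)\<^sup>2" "\<And>n. T n \<le> 4 + k * (2 * (n + 2) + 1) ^ k + 40 * (n + 4)"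
    by metis
  \<comment> \<open>The 5 comes from 2 * (n + 2) + 1 \<le> 5 * (n + 1), and 164 from 4 + 40 * (n +
    4) \<le> 164 * (n + 1). The summand \<open>k\<close> makes \<open>k'\<close> large enough as an
    exponent.\<close>
  define k' where "k' = k * 5 ^ k + k + 164"
  have time: "4 + k * (2 * (n + 2) + 1) ^ k + 40 * (n + 4) \<le> k' * (n + 1) ^ k'" for n
  proof -
    have "(2 * (n + 2) + 1) ^ k \<le> (5 * (n + 1)) ^ k" by (intro power_mono) auto
    also have "\<dots> = 5 ^ k * (n + 1) ^ k" by (rule power_mult_distrib)
    also have "\<dots> \<le> 5 ^ k * (n + 1) ^ k'" by (intro mult_left_mono power_increasing) (auto simp: k'_def)
    finally have 1: "k * (2 * (n + 2) + 1) ^ k \<le> k * 5 ^ k * (n + 1) ^ k'" by (simp add: mult.assoc)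
    have "(n + 1) ^ 1 \<le> (n + 1) ^ k'" by (intro power_increasing) (auto simp: k'_def)
    then have "164 * (n + 1) \<le> 164 * (n + 1) ^ k'" by simp
    moreover have "4 + 40 * (n + 4) \<le> 164 * (n + 1)" by simp
    moreover have "k' * (n + 1) ^ k' \<ge> k * 5 ^ k * (n + 1) ^ k' + 164 * (n + 1) ^ k'"
      by (simp add: k'_def distrib_right)
    ultimately show ?thesis using 1 by linarith
  qed
  have "poly_time (\<lambda>n. (y n + 2) div 4)"
    unfolding poly_time_def using m(1,2,5) time le_trans by blast
  moreover have "\<bar>\<bar>sqrt x\<bar> - real ((y n + 2) div 4) / 2 ^ n\<bar> \<le> 1 / 2 ^ n" for n
  proof -
    let ?m = "2 ^ (n + 2) :: real"
    have sq: "sqrt (4 ^ (n + 2)) = ?m"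
      by (rule real_sqrt_unique) (simp_all flip: power_mult_distrib add: power2_eq_square)
    have y1: "real (y n) \<le> sqrt (X n)" using m(3)[of n] by (intro real_le_rsqrt) (metis of_nat_le_iff of_nat_power)
    have y2: "sqrt (X n) \<le> real (y n) + 1"
    proof (rule real_le_lsqrt)
      have "real (X n) \<le> real ((y n + 1)\<^sup>2)" using m(4)[of n] by linarith
      then show "real (X n) \<le> (real (y n) + 1)\<^sup>2" by (simp add: add.commute)
    qed auto
    have b1: "x * 4 ^ (n + 2) \<le> X n + 1" "real (X n) \<le> x * 4 ^ (n + 2) + 1"
      using X4[of n] by (simp_all add: abs_le_iff field_simps)
    have sqm: "sqrt x * ?m = sqrt (x * 4 ^ (n + 2))" by (simp only: real_sqrt_mult sq)
    also have "sqrt (x * 4 ^ (n + 2)) \<le> sqrt (x * 4 ^ (n + 2))" ..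
    also have "\<dots> \<le> sqrt (real (X n) + 1)" using b1 by simp
    also have "\<dots> \<le> sqrt (X n) + sqrt 1" by (rule sqrt_add_le_add_sqrt) auto
    finally have up: "sqrt x * ?m \<le> real (y n) + 2" using y2 by simp
    have "sqrt (X n) \<le> sqrt (x * 4 ^ (n + 2) + 1)" using b1 by simp
    also have "\<dots> \<le> sqrt (x * 4 ^ (n + 2)) + sqrt 1" using x by (intro sqrt_add_le_add_sqrt) auto
    also have "\<dots> = sqrt x * ?m + 1" by (simp only: sqm real_sqrt_one)
    finally have lo: "real (y n) - 1 \<le> sqrt x * ?m" using y1 by simp
    have d: "4 * real ((y n + 2) div 4) \<le> real (y n) + 2" "real (y n) \<le> 4 * real ((y n + 2) div 4) + 1"
    proof -
      have "4 * ((y n + 2) div 4) \<le> y n + 2" "y n \<le> 4 * ((y n + 2) div 4) + 1" by linarith+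
      then show "4 * real ((y n + 2) div 4) \<le> real (y n) + 2" "real (y n) \<le> 4 * real ((y n + 2) div 4) + 1" by linarith+
    qed
    have "\<bar>sqrt x * ?m - 4 * real ((y n + 2) div 4)\<bar> \<le> 4" using up lo d by linarith
    then have "\<bar>sqrt x * 2 ^ n - real ((y n + 2) div 4)\<bar> \<le> 1" by (simp add: power_add)
    then show ?thesis using x by (intro approx_divide) auto
  qed
  ultimately show ?thesis unfolding eff_real_def by blast
qed

text \<open>Eighths cover the constants 0 and 1 and the radicands 1/8, 3/8 and 1/2 of the machine
  that compares words.\<close>

lemma eff_real_eighths: "eff_real (real k / 8)"
proof -
  define body where "body = Seq (Add 1 1 1) (Sub 0 0 2)"
  define pre where "pre = Seq (Const 1 k) (Const 2 1)"
  define post where "post = Seq (Half 1 1) (Seq (Half 1 1) (Half 0 1))"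
  let ?q = "Seq pre (Seq (While 0 body) post)"
  have "\<exists>t r. runs ?q ((\<lambda>_. 0)(0 := n)) t r \<and> r 0 = 2 ^ n * k div 8 \<and> t \<le> 9 * (n + 1) ^ 9" for n
  proof -
    let ?I = "\<lambda>j r. j \<le> n \<and> r (0::nat) = j \<and> r 1 = 2 ^ (n - j) * k \<and> r 2 = 1"
    define r1 where "r1 = exec pre ((\<lambda>_. 0)(0 := n))"
    have 1: "runs pre ((\<lambda>_. 0)(0 := n)) 2 r1"
      by (rule runs_straightI) (simp_all add: r1_def pre_def)
    have "\<exists>t\<le>1 + n * (2 + 1). \<exists>r'. runs (While 0 body) r1 t r' \<and> ?I 0 r'"
    proof (rule runs_While[where I = ?I])
      fix j r assume I: "?I (Suc j) r"
      have "runs body r 2 (exec body r)" by (rule runs_straightI) (simp_all add: body_def)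
      moreover have "?I j (exec body r)"
      proof -
        have "(2::nat) ^ (n - j) = 2 * 2 ^ (n - Suc j)" using I by (metis Suc_diff_le diff_Suc_Suc power_Suc)
        then show ?thesis using I by (simp add: body_def)
      qed
      ultimately show "r 0 \<noteq> 0 \<and> (\<exists>t\<le>2. \<exists>r'. runs body r t r' \<and> ?I j r')" using I by auto
    next
      show "?I 0 r \<Longrightarrow> r 0 = 0" for r by simp
      show "?I n r1" by (simp add: r1_def pre_def)
    qed
    then obtain t r where 2: "t \<le> 1 + n * 3" "runs (While 0 body) r1 t r" "r 1 = 2 ^ n * k" by auto
    have 3: "runs post r 3 (exec post r)" by (rule runs_straightI) (simp_all add: post_def)
    have "runs ?q ((\<lambda>_. 0)(0 := n)) (2 + (t + 3)) (exec post r)" by (rule runs.Seq[OF 1 runs.Seq[OF 2(2) 3]])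
    moreover have "exec post r 0 = 2 ^ n * k div 8" using 2(3) by (simp add: post_def div_mult2_eq[symmetric])
    moreover have "2 + (t + 3) \<le> 9 * (n + 1) ^ 9"
    proof -
      have "(n + 1) ^ 1 \<le> (n + 1) ^ 9" by (intro power_increasing) auto
      then have "9 * (n + 1) \<le> 9 * (n + 1) ^ 9" by simp
      moreover have "2 + (t + 3) \<le> 9 * (n + 1)" using 2(1) by simp
      ultimately show ?thesis by (rule le_trans[rotated])
    qed
    ultimately show ?thesis by blast
  qed
  then have "poly_time (\<lambda>n. 2 ^ n * k div 8)" unfolding poly_time_def by blast
  moreover have "\<bar>\<bar>real k / 8\<bar> - real (2 ^ n * k div 8) / 2 ^ n\<bar> \<le> 1 / 2 ^ n" for n
  proof -
    have "8 * (2 ^ n * k div 8) \<le> 2 ^ n * k" "2 ^ n * k \<le> 8 * (2 ^ n * k div 8) + 8" by linarith+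
    then have "real (8 * (2 ^ n * k div 8)) \<le> real (2 ^ n * k)" "real (2 ^ n * k) \<le> real (8 * (2 ^ n * k div 8) + 8)"
      using of_nat_le_iff by blast+
    then have "\<bar>\<bar>real k / 8\<bar> * 2 ^ n - real (2 ^ n * k div 8)\<bar> \<le> 1"
      by (simp add: abs_le_iff mult.commute)
    then show ?thesis by (intro approx_divide) auto
  qed
  ultimately show ?thesis unfolding eff_real_def by blast
qed

lemma eff_real_minus: "eff_real x \<Longrightarrow> eff_real (- x)"
  by (simp add: eff_real_def)

lemma eff_real_0: "eff_real 0" and eff_real_1: "eff_real 1"
  using eff_real_eighths[of 0] eff_real_eighths[of 8] by simp_all

lemma eff_complex_of_real: "eff_real x \<Longrightarrow> eff_complex (complex_of_real x)"
  by (simp add: eff_complex_def eff_real_0)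

section \<open>Observation probabilities of quantum machines\<close>

lemma finite_actions:
  assumes "wf_machine M"
  shows "finite (actions M \<sigma>)"
proof -
  have mv: "finite (UNIV :: move set)"
  proof -
    have "(UNIV :: move set) = {MLeft, MStay, MRight}" using move.exhaust by auto
    then show ?thesis by (metis finite.emptyI finite_insert)
  qed
  let ?f = "\<lambda>(q, g, d, e, v, f). \<lparr>next_state = q, work_write = g, in_move = d, work_move = e, wom_write = v, wom_move = f\<rparr>"
  have "actions M \<sigma> \<subseteq> ?f ` (states M \<times> work_alph M \<times> UNIV \<times> UNIV \<times> insert None (Some ` wom_alph M) \<times> UNIV)"
  proof
    fix a assume "a \<in> actions M \<sigma>"
    then show "a \<in> ?f ` (states M \<times> work_alph M \<times> UNIV \<times> UNIV \<times> insert None (Some ` wom_alph M) \<times> UNIV)"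
      by (cases a) (auto simp: actions_def image_iff)
  qed
  moreover have "finite \<dots>"
    using assms mv by (intro finite_imageI finite_cartesian_product) (auto simp: wf_machine_def)
  ultimately show ?thesis by (rule finite_subset)
qed

lemma init_config_in_configs:
  assumes "wf_machine M"
  shows "init_config M \<in> configs M w"
  using assms by (auto simp: init_config_def configs_def wf_machine_def)

lemma finite_support_upd:
  fixes f :: "int \<Rightarrow> nat"
  assumes "finite {i. f i \<noteq> 0}"
  shows "finite {i. (f(j := x)) i \<noteq> 0}"
  by (rule finite_subset[of _ "insert j {i. f i \<noteq> 0}"]) (use assms in auto)

lemma apply_action_in_configs:
  assumes c: "c \<in> configs M w" and a: "a \<in> actions M (scanned w (in_pos c))"
  shows "apply_action a c \<in> configs M w"
proof -
  have "0 \<le> in_pos c + shift (in_move a) \<and> in_pos c + shift (in_move a) \<le> int (length w) + 1"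
  proof (cases "in_move a")
    case MLeft
    then have "scanned w (in_pos c) \<noteq> Lend" using a by (auto simp: actions_def)
    then have "in_pos c > 0" by (auto simp: scanned_def split: if_splits)
    then show ?thesis using MLeft c by (simp add: configs_def)
  next
    case MStay
    then show ?thesis using c by (simp add: configs_def)
  next
    case MRight
    then have "scanned w (in_pos c) \<noteq> Rend" using a by (auto simp: actions_def)
    then have "in_pos c \<le> int (length w)" by (auto simp: scanned_def split: if_splits)
    then show ?thesis using MRight c by (simp add: configs_def)
  qed
  moreover have "finite {i. ((work_tape c)(work_pos c := work_write a)) i \<noteq> 0}"
    by (rule finite_support_upd) (use c in \<open>simp add: configs_def\<close>)
  moreover have "finite {i. (case wom_write a of None \<Rightarrow> wom_tape c | Some g \<Rightarrow> (wom_tape c)(wom_pos c := g)) i \<noteq> 0}"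
    using c finite_support_upd[of "wom_tape c"] by (cases "wom_write a") (simp_all add: configs_def)
  moreover have "range ((work_tape c)(work_pos c := work_write a)) \<subseteq> work_alph M"
    using c a by (auto simp: configs_def actions_def)
  moreover have "range (case wom_write a of None \<Rightarrow> wom_tape c | Some g \<Rightarrow> (wom_tape c)(wom_pos c := g)) \<subseteq> wom_alph M"
    using c a by (auto simp: configs_def actions_def split: option.splits)
  moreover have "next_state a \<in> states M" using a by (simp add: actions_def)
  ultimately show ?thesis unfolding configs_def apply_action_def by simp
qed

definition successors :: "'b wom_machine_scheme \<Rightarrow> nat list \<Rightarrow> config \<Rightarrow> config set" where
  "successors M w c = (\<lambda>a. apply_action a c) ` actions M (scanned w (in_pos c))"

lemma finite_successors: "wf_machine M \<Longrightarrow> finite (successors M w c)"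
  by (simp add: successors_def finite_actions)

lemma successors_subset_configs: "c \<in> configs M w \<Longrightarrow> successors M w c \<subseteq> configs M w"
  by (auto simp: successors_def apply_action_in_configs)

lemma qstep_nonzero_successor:
  assumes "qstep M w \<omega> c' c \<noteq> 0"
  shows "c' \<in> successors M w c"
proof (rule ccontr)
  assume "c' \<notin> successors M w c"
  then have "{a \<in> actions M (scanned w (in_pos c)). apply_action a c = c'} = {}"
    by (auto simp: successors_def)
  then have "qstep M w \<omega> c' c = 0" by (simp only: qstep_def Let_def sum.empty)
  then show False using assms by simp
qed

lemma infsum_eq_sum:
  assumes "finite F" "F \<subseteq> A" "\<And>x. x \<in> A - F \<Longrightarrow> f x = 0"
  shows "infsum f A = sum f F"
proof -
  have "infsum f A = infsum f F" by (rule infsum_cong_neutral) (use assms in auto)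
  then show ?thesis using assms(1) by simp
qed

definition qsupport :: "qtm_wom \<Rightarrow> nat list \<Rightarrow> nat list \<Rightarrow> config set" where
  "qsupport M w ws = {c \<in> configs M w. qvec M w ws c \<noteq> 0}"

lemma qvec_Cons_eq_sum:
  assumes "finite F" "qsupport M w ws \<subseteq> F" "F \<subseteq> configs M w"
  shows "qvec M w (\<omega> # ws) c = (\<Sum>c'\<in>F. qstep M w \<omega> c c' * qvec M w ws c')"
  unfolding qvec.simps
  by (rule infsum_eq_sum) (use assms in \<open>auto simp: qsupport_def\<close>)

lemma qsupport_Cons:
  assumes "finite (qsupport M w ws)"
  shows "qsupport M w (\<omega> # ws) \<subseteq> (\<Union>c\<in>qsupport M w ws. successors M w c)"
proof
  fix c assume "c \<in> qsupport M w (\<omega> # ws)"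
  then have "(\<Sum>c'\<in>qsupport M w ws. qstep M w \<omega> c c' * qvec M w ws c') \<noteq> 0"
    using qvec_Cons_eq_sum[OF assms order.refl, of \<omega> c] by (auto simp: qsupport_def)
  then obtain c' where "c' \<in> qsupport M w ws" "qstep M w \<omega> c c' \<noteq> 0"
    by (metis (no_types, lifting) mult_zero_left sum.neutral)
  then show "c \<in> (\<Union>c\<in>qsupport M w ws. successors M w c)" using qstep_nonzero_successor by blast
qed

lemma finite_qsupport:
  assumes "wf_machine M"
  shows "finite (qsupport M w ws)"
proof (induction ws)
  case Nil
  have "qsupport M w [] \<subseteq> {init_config M}" by (auto simp: qsupport_def)
  then show ?case by (rule finite_subset) simp
next
  case (Cons \<omega> ws)
  show ?case
    by (rule finite_subset[OF qsupport_Cons[OF Cons]]) (use Cons assms in \<open>auto simp: finite_successors\<close>)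
qed

lemma obs_prob_eq_sum:
  assumes "finite F" "qsupport M w ws \<subseteq> F" "F \<subseteq> configs M w"
  shows "obs_prob M w ws = (\<Sum>c\<in>F. (cmod (qvec M w ws c))\<^sup>2)"
  unfolding obs_prob_def by (rule infsum_eq_sum) (use assms in \<open>auto simp: qsupport_def\<close>)

lemma obs_prob_nonneg: "0 \<le> obs_prob M w ws"
  unfolding obs_prob_def by (rule infsum_nonneg) simp

lemma obs_prob_Nil:
  assumes "wf_machine M"
  shows "obs_prob M w [] = 1"
  using obs_prob_eq_sum[of "{init_config M}" M w "[]"] init_config_in_configs[OF assms, of w]
  by (auto simp: qsupport_def)

text \<open>Well-formedness says that the squared norms of all \<open>E\<^sub>\<omega> v\<close> add
  up to that of \<open>v\<close>. Expanding them gives a quadratic form in \<open>v\<close> over its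
  finite support, whose matrix is the identity.\<close>

lemma sum_obs_prob_Cons:
  assumes M: "wf_qtm \<Sigma> M" and w: "w \<in> lists \<Sigma>"
  shows "(\<Sum>\<omega>\<in>regs M. obs_prob M w (\<omega> # ws)) = obs_prob M w ws"
proof -
  have wf: "wf_machine M" using M by (simp add: wf_qtm_def)
  define F where "F = qsupport M w ws"
  define G where "G = (\<Union>c\<in>F. successors M w c)"
  define v where "v = qvec M w ws"
  define q where "q \<omega> c' c = qstep M w \<omega> c' c" for \<omega> c' c
  have F: "finite F" "F \<subseteq> configs M w" using finite_qsupport[OF wf] by (auto simp: F_def qsupport_def)
  have G: "finite G" "G \<subseteq> configs M w"
    using F finite_successors[OF wf] successors_subset_configs[of _ M w] unfolding G_def by blast+
  have sq: "complex_of_real ((cmod z)\<^sup>2) = cnj z * z" for z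
    using complex_norm_square[of z] by (simp add: mult.commute)
  have "complex_of_real (obs_prob M w (\<omega> # ws))
      = (\<Sum>c1\<in>F. \<Sum>c2\<in>F. cnj (v c1) * v c2 * (\<Sum>c'\<in>G. cnj (q \<omega> c' c1) * q \<omega> c' c2))" for \<omega>
  proof -
    have "obs_prob M w (\<omega> # ws) = (\<Sum>c\<in>G. (cmod (qvec M w (\<omega> # ws) c))\<^sup>2)"
      by (rule obs_prob_eq_sum) (use G qsupport_Cons[OF finite_qsupport[OF wf]] in \<open>auto simp: G_def F_def\<close>)
    also have "complex_of_real \<dots> = (\<Sum>c'\<in>G. cnj (\<Sum>c\<in>F. q \<omega> c' c * v c) * (\<Sum>c\<in>F. q \<omega> c' c * v c))"
      using qvec_Cons_eq_sum[OF F(1) _ F(2), of ws \<omega>] unfolding of_real_sum sq by (simp add: F_def q_def v_def)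
    also have "\<dots> = (\<Sum>c'\<in>G. \<Sum>c1\<in>F. \<Sum>c2\<in>F. cnj (v c1) * v c2 * (cnj (q \<omega> c' c1) * q \<omega> c' c2))"
      unfolding cnj_sum sum_product by (intro sum.cong) (simp_all add: mult_ac)
    also have "\<dots> = (\<Sum>c1\<in>F. \<Sum>c'\<in>G. \<Sum>c2\<in>F. cnj (v c1) * v c2 * (cnj (q \<omega> c' c1) * q \<omega> c' c2))"
      by (rule sum.swap)
    also have "\<dots> = (\<Sum>c1\<in>F. \<Sum>c2\<in>F. \<Sum>c'\<in>G. cnj (v c1) * v c2 * (cnj (q \<omega> c' c1) * q \<omega> c' c2))"
      by (intro sum.cong refl sum.swap)
    finally show ?thesis by (simp add: sum_distrib_left)
  qed
  then have "complex_of_real (\<Sum>\<omega>\<in>regs M. obs_prob M w (\<omega> # ws))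
      = (\<Sum>\<omega>\<in>regs M. \<Sum>c1\<in>F. \<Sum>c2\<in>F. cnj (v c1) * v c2 * (\<Sum>c'\<in>G. cnj (q \<omega> c' c1) * q \<omega> c' c2))"
    by simp
  also have "\<dots> = (\<Sum>c1\<in>F. \<Sum>\<omega>\<in>regs M. \<Sum>c2\<in>F. cnj (v c1) * v c2 * (\<Sum>c'\<in>G. cnj (q \<omega> c' c1) * q \<omega> c' c2))"
    by (rule sum.swap)
  also have "\<dots> = (\<Sum>c1\<in>F. \<Sum>c2\<in>F. \<Sum>\<omega>\<in>regs M. cnj (v c1) * v c2 * (\<Sum>c'\<in>G. cnj (q \<omega> c' c1) * q \<omega> c' c2))"
    by (intro sum.cong refl sum.swap)
  also have "\<dots> = (\<Sum>c1\<in>F. \<Sum>c2\<in>F. cnj (v c1) * v c2 * (if c1 = c2 then 1 else 0))"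
  proof (intro sum.cong refl)
    fix c1 c2 assume c: "c1 \<in> F" "c2 \<in> F"
    have "(\<Sum>\<omega>\<in>regs M. \<Sum>c'\<in>G. cnj (q \<omega> c' c1) * q \<omega> c' c2)
        = (\<Sum>\<omega>\<in>regs M. \<Sum>\<^sub>\<infinity>c'\<in>configs M w. cnj (q \<omega> c' c1) * q \<omega> c' c2)"
    proof (intro sum.cong refl infsum_eq_sum[symmetric] G)
      fix \<omega> c' assume "c' \<in> configs M w - G"
      then have "q \<omega> c' c1 = 0" using qstep_nonzero_successor c unfolding G_def q_def by blast
      then show "cnj (q \<omega> c' c1) * q \<omega> c' c2 = 0" by simp
    qed
    also have "\<dots> = (if c1 = c2 then 1 else 0)"
      using M w c F(2) unfolding wf_qtm_def well_formed_def q_def by blast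
    finally show "(\<Sum>\<omega>\<in>regs M. cnj (v c1) * v c2 * (\<Sum>c'\<in>G. cnj (q \<omega> c' c1) * q \<omega> c' c2))
        = cnj (v c1) * v c2 * (if c1 = c2 then 1 else 0)"
      by (simp only: sum_distrib_left[symmetric])
  qed
  also have "\<dots> = (\<Sum>c1\<in>F. cnj (v c1) * v c1)" using F(1) by (simp add: if_distrib cong: if_cong)
  also have "\<dots> = complex_of_real (obs_prob M w ws)"
    using obs_prob_eq_sum[OF F(1) _ F(2), of ws] by (simp only: sq of_real_sum F_def v_def order.refl)
  finally show ?thesis using of_real_eq_iff by blast
qed

lemma sum_lists_Suc:
  assumes "finite A"
  shows "(\<Sum>ws | set ws \<subseteq> A \<and> length ws = Suc n. f ws) = (\<Sum>ws | set ws \<subseteq> A \<and> length ws = n. \<Sum>a\<in>A. f (a # ws))"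
proof -
  have eq: "{ws. set ws \<subseteq> A \<and> length ws = Suc n} = (\<lambda>(ws, a). a # ws) ` ({ws. set ws \<subseteq> A \<and> length ws = n} \<times> A)"
    by (auto simp: length_Suc_conv image_iff)
  have "inj_on (\<lambda>(ws, a). a # ws) ({ws. set ws \<subseteq> A \<and> length ws = n} \<times> A)" by (auto simp: inj_on_def)
  then have "(\<Sum>ws | set ws \<subseteq> A \<and> length ws = Suc n. f ws)
     = (\<Sum>(ws, a)\<in>{ws. set ws \<subseteq> A \<and> length ws = n} \<times> A. f (a # ws))"
    unfolding eq by (subst sum.reindex) (auto simp: case_prod_unfold)
  also have "\<dots> = (\<Sum>ws | set ws \<subseteq> A \<and> length ws = n. \<Sum>a\<in>A. f (a # ws))"
    by (rule sum.cartesian_product[symmetric])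
  finally show ?thesis .
qed

text \<open>Each step splits the probability of a running history among the symbols that may follow
  it. The resulting bound by 1 on the halted histories makes the acceptance probability
  summable.\<close>

lemma sum_halting_obs_prob:
  assumes M: "wf_qtm \<Sigma> M" and w: "w \<in> lists \<Sigma>"
  shows "(\<Sum>k<T. \<Sum>ws | set ws \<subseteq> cont_regs M \<and> length ws = k. \<Sum>\<omega>\<in>acc_regs M \<union> rej_regs M. obs_prob M w (\<omega> # ws))
     + (\<Sum>ws | set ws \<subseteq> cont_regs M \<and> length ws = T. obs_prob M w ws) = 1"
proof (induction T)
  case 0
  have "{ws. set ws \<subseteq> cont_regs M \<and> length ws = 0} = {[]}" by auto
  then show ?case using M by (simp add: obs_prob_Nil wf_qtm_def)
next
  case (Suc T)
  have fin: "finite (acc_regs M \<union> rej_regs M)" "finite (cont_regs M)" "(acc_regs M \<union> rej_regs M) \<inter> cont_regs M = {}"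
    using M by (auto simp: wf_qtm_def regs_def)
  have "(\<Sum>\<omega>\<in>acc_regs M \<union> rej_regs M. obs_prob M w (\<omega> # ws)) + (\<Sum>\<omega>\<in>cont_regs M. obs_prob M w (\<omega> # ws)) = obs_prob M w ws" for ws
    using sum_obs_prob_Cons[OF M w, of ws] sum.union_disjoint[OF fin, of "\<lambda>\<omega>. obs_prob M w (\<omega> # ws)"]
    by (simp add: regs_def)
  then have "(\<Sum>ws | set ws \<subseteq> cont_regs M \<and> length ws = T. \<Sum>\<omega>\<in>acc_regs M \<union> rej_regs M. obs_prob M w (\<omega> # ws))
     + (\<Sum>ws | set ws \<subseteq> cont_regs M \<and> length ws = T. \<Sum>\<omega>\<in>cont_regs M. obs_prob M w (\<omega> # ws))
     = (\<Sum>ws | set ws \<subseteq> cont_regs M \<and> length ws = T. obs_prob M w ws)"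
    by (simp flip: sum.distrib)
  then show ?case using Suc unfolding sum_lists_Suc[OF fin(2)] sum.lessThan_Suc by linarith
qed

text \<open>An infinite sum that does not exist is 0 by convention. Summability is what makes finite
  partial sums lower bounds of \<open>qtm_acc\<close> and \<open>qtm_rej\<close>.\<close>

lemma summable_on_obs_prob:
  assumes M: "wf_qtm \<Sigma> M" and w: "w \<in> lists \<Sigma>" and A: "A \<subseteq> acc_regs M \<union> rej_regs M"
  shows "(\<lambda>(\<omega>, ws). obs_prob M w (\<omega> # ws)) summable_on (A \<times> lists (cont_regs M))"
proof (rule nonneg_bdd_above_summable_on)
  show "0 \<le> (case x of (\<omega>, ws) \<Rightarrow> obs_prob M w (\<omega> # ws))" for x
    by (cases x) (simp add: obs_prob_nonneg)
  let ?H = "acc_regs M \<union> rej_regs M"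
  have fin: "finite ?H" "finite (cont_regs M)" using M by (auto simp: wf_qtm_def regs_def)
  have finl: "finite {ws. set ws \<subseteq> cont_regs M \<and> length ws = k}" for k
    using fin(2) by (rule finite_lists_length_eq)
  show "bdd_above (sum (\<lambda>(\<omega>, ws). obs_prob M w (\<omega> # ws)) ` {F. F \<subseteq> A \<times> lists (cont_regs M) \<and> finite F})"
  proof (rule bdd_aboveI[of _ 1], safe)
    fix F assume F: "F \<subseteq> A \<times> lists (cont_regs M)" "finite F"
    define T where "T = Suc (Max (insert 0 ((length \<circ> snd) ` F)))"
    have T: "length (snd x) < T" if "x \<in> F" for x
      using F(2) that by (auto simp: T_def less_Suc_eq_le intro!: Max_ge)
    define B where "B = (SIGMA k:{..<T}. {ws. set ws \<subseteq> cont_regs M \<and> length ws = k} \<times> ?H)"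
    have "sum (\<lambda>(\<omega>, ws). obs_prob M w (\<omega> # ws)) F
        = sum (\<lambda>(k, ws, \<omega>). obs_prob M w (\<omega> # ws)) ((\<lambda>(\<omega>, ws). (length ws, ws, \<omega>)) ` F)"
      by (subst sum.reindex) (auto simp: inj_on_def intro!: sum.cong)
    also have "\<dots> \<le> sum (\<lambda>(k, ws, \<omega>). obs_prob M w (\<omega> # ws)) B"
    proof (rule sum_mono2)
      show "finite B" unfolding B_def using finl fin by auto
      show "(\<lambda>(\<omega>, ws). (length ws, ws, \<omega>)) ` F \<subseteq> B"
      proof (clarsimp simp: B_def)
        fix \<omega> ws assume x: "(\<omega>, ws) \<in> F"
        then show "length ws < T \<and> set ws \<subseteq> cont_regs M \<and> (\<omega> \<in> acc_regs M \<or> \<omega> \<in> rej_regs M)"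
          using F(1) A T[OF x] by auto
      qed
    qed (auto simp: obs_prob_nonneg)
    also have "\<dots> = (\<Sum>k<T. \<Sum>ws | set ws \<subseteq> cont_regs M \<and> length ws = k. \<Sum>\<omega>\<in>?H. obs_prob M w (\<omega> # ws))"
      unfolding B_def using finl fin
      by (simp add: sum.Sigma[symmetric] sum.cartesian_product[symmetric])
    also have "\<dots> \<le> 1"
      using sum_halting_obs_prob[OF M w, of T] sum_nonneg[of "{ws. set ws \<subseteq> cont_regs M \<and> length ws = T}" "obs_prob M w"]
      by (simp add: obs_prob_nonneg)
    finally show "sum (\<lambda>(\<omega>, ws). obs_prob M w (\<omega> # ws)) F \<le> 1" .
  qed
qed

lemma sum_obs_prob_le_qtm_acc:
  assumes "wf_qtm \<Sigma> M" "w \<in> lists \<Sigma>" "finite F" "F \<subseteq> acc_regs M \<times> lists (cont_regs M)"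
  shows "(\<Sum>(\<omega>, ws)\<in>F. obs_prob M w (\<omega> # ws)) \<le> qtm_acc M w"
  unfolding qtm_acc_def
  by (rule finite_sum_le_infsum) (use assms summable_on_obs_prob[OF assms(1,2)] in \<open>auto simp: obs_prob_nonneg\<close>)

lemma sum_obs_prob_le_qtm_rej:
  assumes "wf_qtm \<Sigma> M" "w \<in> lists \<Sigma>" "finite F" "F \<subseteq> rej_regs M \<times> lists (cont_regs M)"
  shows "(\<Sum>(\<omega>, ws)\<in>F. obs_prob M w (\<omega> # ws)) \<le> qtm_rej M w"
  unfolding qtm_rej_def
  by (rule finite_sum_le_infsum) (use assms summable_on_obs_prob[OF assms(1,2)] in \<open>auto simp: obs_prob_nonneg\<close>)

section \<open>Quantum simulation of probabilistic machines\<close>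

text \<open>The WOM is never read, so configurations matter only up to its content and head
  position. Resetting these gives a representative within the same type.\<close>

definition core :: "config \<Rightarrow> config" where
  "core c = c\<lparr>wom_pos := 0, wom_tape := (\<lambda>_. 0)\<rparr>"

lemma core_eq_iff:
  "core c = core d \<longleftrightarrow> state c = state d \<and> in_pos c = in_pos d \<and> work_pos c = work_pos d \<and> work_tape c = work_tape d"
  by (cases c; cases d) (auto simp: core_def)

lemma core_simps [simp]:
  "state (core c) = state c" "in_pos (core c) = in_pos c" "work_pos (core c) = work_pos c"
  "work_tape (core c) = work_tape c"
  by (simp_all add: core_def)

lemma core_core [simp]: "core (core c) = core c"
  by (simp add: core_def)

lemma squares_used_core:
  assumes "map core cs = map core ds"
  shows "squares_used cs = squares_used ds"
proof -
  have "squares_used cs = (if \<forall>c\<in>core ` set cs. work_pos c = 0 \<and> work_tape c = (\<lambda>_. 0) then 0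
      else card (work_pos ` core ` set cs))" for cs
    by (simp add: squares_used_def image_image)
  moreover have "core ` set cs = core ` set ds" by (metis assms set_map)
  ultimately show ?thesis by (simp only:)
qed

lemma scanned_in_in_syms: "w \<in> lists \<Sigma> \<Longrightarrow> scanned w i \<in> in_syms \<Sigma>"
  by (auto simp: scanned_def in_syms_def in_lists_conv_set)

section \<open>Hitting probabilities of a probabilistic machine\<close>

abbreviation halted :: "ptm_wom \<Rightarrow> config \<Rightarrow> bool" where
  "halted M c \<equiv> state c \<in> {acc_state M, rej_state M}"

abbreviation choice :: "ptm_wom \<Rightarrow> nat list \<Rightarrow> config \<Rightarrow> action pmf" where
  "choice M w c \<equiv> ptrans M (state c) (scanned w (in_pos c)) (work_tape c (work_pos c))"

definition hit :: "ptm_wom \<Rightarrow> nat list \<Rightarrow> nat \<Rightarrow> nat \<Rightarrow> config \<Rightarrow> real" where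
  "hit M w h t c = measure_pmf.prob (((\<lambda>\<mu>. bind_pmf \<mu> (pstep M w)) ^^ t) (return_pmf c)) {c. state c = h}"

lemma hit_0: "hit M w h 0 c = (if state c = h then 1 else 0)"
  by (simp add: hit_def)

lemma bind_funpow_bind:
  fixes f :: "'a \<Rightarrow> 'a pmf"
  shows "((\<lambda>\<mu>. bind_pmf \<mu> f) ^^ t) (bind_pmf \<nu> g) = bind_pmf \<nu> (\<lambda>x. ((\<lambda>\<mu>. bind_pmf \<mu> f) ^^ t) (g x))"
  by (induction t) (simp_all add: bind_assoc_pmf)

text \<open>The defining iteration appends steps at the end. Associativity of the monadic bind lets
  the first step be split off instead.\<close>

lemma hit_Suc: "hit M w h (Suc t) c = (LINT d|measure_pmf (pstep M w c). hit M w h t d)"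
proof -
  have "((\<lambda>\<mu>. bind_pmf \<mu> (pstep M w)) ^^ Suc t) (return_pmf c)
     = bind_pmf (pstep M w c) (\<lambda>d. ((\<lambda>\<mu>. bind_pmf \<mu> (pstep M w)) ^^ t) (return_pmf d))"
    using bind_funpow_bind[where f = "pstep M w" and t = t and \<nu> = "pstep M w c" and g = return_pmf]
    by (simp add: funpow_Suc_right bind_return_pmf bind_return_pmf' del: funpow.simps)
  moreover have "measure_pmf.prob (bind_pmf \<mu> N) X = (LINT x|measure_pmf \<mu>. measure_pmf.prob (N x) X)" for \<mu> and N :: "config \<Rightarrow> config pmf" and X
  proof -
    have "ennreal (measure_pmf.prob (bind_pmf \<mu> N) X) = (\<integral>\<^sup>+x. ennreal (measure_pmf.prob (N x) X) \<partial>measure_pmf \<mu>)"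
      by (simp flip: measure_pmf.emeasure_eq_measure)
    also have "\<dots> = ennreal (LINT x|measure_pmf \<mu>. measure_pmf.prob (N x) X)"
      by (intro nn_integral_eq_integral measure_pmf.integrable_const_bound[where B = 1]) auto
    finally show ?thesis by (simp add: integral_nonneg_AE)
  qed
  ultimately show ?thesis unfolding hit_def by simp
qed

lemma hit_Suc_halted:
  assumes "halted M c"
  shows "hit M w h (Suc t) c = hit M w h t c"
  using assms by (simp add: hit_Suc pstep_def)

lemma hit_halted:
  assumes "halted M c"
  shows "hit M w h t c = (if state c = h then 1 else 0)"
  using assms by (induction t) (simp_all add: hit_0 hit_Suc_halted)

lemma hit_Suc_running:
  assumes "\<not> halted M c" "finite A"
    "set_pmf (choice M w c) \<subseteq> A"
  shows "hit M w h (Suc t) c = (\<Sum>a\<in>A. pmf (choice M w c) a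
    * hit M w h t (apply_action a c))"
  using assms unfolding hit_Suc pstep_def
  by (subst if_not_P, simp, subst integral_map_pmf, subst integral_measure_pmf_real[of A]) (auto simp: mult.commute)

lemma ptm_acc_eq: "ptm_acc M w = (SUP t. hit M w (acc_state M) t (init_config M))"
  and ptm_rej_eq: "ptm_rej M w = (SUP t. hit M w (rej_state M) t (init_config M))"
  by (simp_all add: ptm_acc_def ptm_rej_def pdist_def hit_def)

definition wom_idle :: "action \<Rightarrow> action" where
  "wom_idle a = a\<lparr>wom_write := None, wom_move := MStay\<rparr>"

lemma core_apply_action_cong:
  "core c = core d \<Longrightarrow> core (apply_action a c) = core (apply_action a d)"
  by (auto simp: core_eq_iff apply_action_def)

lemma core_apply_wom_idle: "core (apply_action (wom_idle a) c) = core (apply_action a c)"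
  by (auto simp: core_eq_iff apply_action_def wom_idle_def)

lemma hit_core_cong:
  assumes "core c = core d"
  shows "hit M w h t c = hit M w h t d"
  using assms
proof (induction t arbitrary: c d)
  case 0
  then show ?case by (simp add: hit_0 core_eq_iff)
next
  case (Suc t)
  have "hit M w h t (apply_action a c) = hit M w h t (apply_action a d)" for a
    by (rule Suc.IH) (rule core_apply_action_cong[OF Suc.prems])
  moreover have "hit M w h t c = hit M w h t d" by (rule Suc.IH[OF Suc.prems])
  moreover have "state c = state d" "in_pos c = in_pos d" "work_pos c = work_pos d" "work_tape c = work_tape d"
    using Suc.prems by (simp_all add: core_eq_iff)
  ultimately show ?case by (simp add: hit_Suc pstep_def)
qed

definition idle :: "nat \<Rightarrow> nat \<Rightarrow> action" where
  "idle q g = \<lparr>next_state = q, work_write = g, in_move = MStay, work_move = MStay, wom_write = None, wom_move = MStay\<rparr>"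

lemma apply_idle: "apply_action (idle (state c) (work_tape c (work_pos c))) c = c"
  by (cases c) (simp add: idle_def apply_action_def)

lemma qstep_single_action:
  assumes "wf_machine M"
    and "\<And>a. qtrans M (state c) (scanned w (in_pos c)) (work_tape c (work_pos c)) a \<omega> = (if a = b then z else 0)"
    and "z \<noteq> 0 \<Longrightarrow> b \<in> actions M (scanned w (in_pos c))"
  shows "qstep M w \<omega> c' c = (if c' = apply_action b c then z else 0)"
proof -
  have "finite {a \<in> actions M (scanned w (in_pos c)). apply_action a c = c'}" using finite_actions[OF assms(1)] by simp
  then show ?thesis using assms(3) by (auto simp: qstep_def Let_def assms(2))
qed

locale ptm_simulation =
  fixes \<Sigma> :: "nat set" and M :: ptm_wom and code :: "nat \<times> in_sym \<times> nat \<times> action \<Rightarrow> nat"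
  assumes finite_alphabet: "finite \<Sigma>" and wf: "wf_ptm \<Sigma> M"
    and inj_code: "inj code"
begin

definition branches :: "(nat \<times> in_sym \<times> nat \<times> action) set" where
  "branches = {(q, \<sigma>, g, b). q \<in> states M - {acc_state M, rej_state M} \<and> \<sigma> \<in> in_syms \<Sigma> \<and> g \<in> work_alph M
     \<and> b \<in> set_pmf (ptrans M q \<sigma> g)}"

text \<open>The shift by 2 keeps the symbols 0 and 1 free for announcing acceptance and
  rejection.\<close>

definition branch_reg :: "nat \<times> in_sym \<times> nat \<times> action \<Rightarrow> nat" where
  "branch_reg k = code k + 2"

text \<open>A probabilistic machine halts by its state, a quantum machine by its register, so a
  halting state spends one idle step on the announcement. Otherwise the action recorded in \<omega>
  is performed without its WOM part, which could not be undone.\<close>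

definition sim_action :: "nat \<Rightarrow> in_sym \<Rightarrow> nat \<Rightarrow> nat \<Rightarrow> action" where
  "sim_action q \<sigma> g \<omega> = (if q \<in> {acc_state M, rej_state M} then idle q g
     else wom_idle (snd (snd (snd (inv branch_reg \<omega>)))))"

definition sim_amp :: "nat \<Rightarrow> in_sym \<Rightarrow> nat \<Rightarrow> nat \<Rightarrow> real" where
  "sim_amp q \<sigma> g \<omega> =
     (if q = acc_state M then (if \<omega> = 0 then 1 else 0)
      else if q = rej_state M then (if \<omega> = 1 then 1 else 0)
      else if \<exists>b\<in>set_pmf (ptrans M q \<sigma> g). \<omega> = branch_reg (q, \<sigma>, g, b)
      then sqrt (pmf (ptrans M q \<sigma> g) (snd (snd (snd (inv branch_reg \<omega>))))) else 0)"

definition sim :: qtm_wom where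
  "sim = \<lparr>states = states M, start = start M, work_alph = work_alph M, wom_alph = wom_alph M,
     acc_regs = {0}, rej_regs = {1}, cont_regs = branch_reg ` branches,
     qtrans = (\<lambda>q \<sigma> g a \<omega>. if a = sim_action q \<sigma> g \<omega> then complex_of_real (sim_amp q \<sigma> g \<omega>) else 0)\<rparr>"

abbreviation amp :: "nat list \<Rightarrow> nat \<Rightarrow> config \<Rightarrow> real" where
  "amp w \<omega> c \<equiv> sim_amp (state c) (scanned w (in_pos c)) (work_tape c (work_pos c)) \<omega>"

definition target :: "nat list \<Rightarrow> nat \<Rightarrow> config \<Rightarrow> config" where
  "target w \<omega> c = apply_action (sim_action (state c) (scanned w (in_pos c)) (work_tape c (work_pos c)) \<omega>) c"

lemma inj_branch_reg: "inj branch_reg"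
  by (rule injI) (simp add: branch_reg_def inj_eq[OF inj_code])

lemma inv_branch_reg [simp]: "inv branch_reg (branch_reg k) = k"
  by (rule inv_f_f[OF inj_branch_reg])

lemma branch_reg_eq_iff [simp]: "branch_reg k = branch_reg l \<longleftrightarrow> k = l"
  by (rule inj_eq[OF inj_branch_reg])

lemma wf_machine_M: "wf_machine M" and wf_machine_sim: "wf_machine sim"
  using wf by (simp_all add: wf_ptm_def wf_machine_def sim_def)

lemma actions_sim: "actions sim = actions M"
  by (auto simp: actions_def sim_def fun_eq_iff)

lemma configs_sim: "configs sim w = configs M w"
  by (auto simp: configs_def sim_def)

lemma init_sim: "init_config sim = init_config M"
  by (simp add: init_config_def sim_def)

lemma ptrans_actions:
  assumes "q \<in> states M" "q \<notin> {acc_state M, rej_state M}" "\<sigma> \<in> in_syms \<Sigma>" "g \<in> work_alph M" "b \<in> set_pmf (ptrans M q \<sigma> g)"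
  shows "b \<in> actions M \<sigma>"
proof -
  have "set_pmf (ptrans M q \<sigma> g) \<subseteq> actions M \<sigma>" using wf assms(1-4) by (simp add: wf_ptm_def)
  then show ?thesis using assms(5) by blast
qed

lemma finite_branches: "finite branches"
proof -
  have "finite (in_syms \<Sigma>)" using finite_alphabet by (simp add: in_syms_def)
  moreover have "branches \<subseteq> states M \<times> in_syms \<Sigma> \<times> work_alph M \<times> (\<Union>\<sigma>\<in>in_syms \<Sigma>. actions M \<sigma>)"
  proof
    fix k assume "k \<in> branches"
    then obtain q \<sigma> g b where k: "k = (q, \<sigma>, g, b)" "q \<in> states M" "q \<notin> {acc_state M, rej_state M}"
      "\<sigma> \<in> in_syms \<Sigma>" "g \<in> work_alph M" "b \<in> set_pmf (ptrans M q \<sigma> g)" by (auto simp: branches_def)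
    then show "k \<in> states M \<times> in_syms \<Sigma> \<times> work_alph M \<times> (\<Union>\<sigma>\<in>in_syms \<Sigma>. actions M \<sigma>)"
      using ptrans_actions[OF k(2-6)] by auto
  qed
  ultimately show ?thesis
    using finite_actions[OF wf_machine_M] wf_machine_M
    by (elim finite_subset) (auto simp: wf_machine_def)
qed

lemma config_scan:
  assumes "w \<in> lists \<Sigma>" "c \<in> configs M w"
  shows "state c \<in> states M" "scanned w (in_pos c) \<in> in_syms \<Sigma>" "work_tape c (work_pos c) \<in> work_alph M"
  using assms scanned_in_in_syms by (auto simp: configs_def)

lemma wom_idle_in_actions: "b \<in> actions M \<sigma> \<Longrightarrow> wom_idle b \<in> actions M \<sigma>"
  by (simp add: actions_def wom_idle_def)

lemma sim_action_in_actions: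
  assumes w: "w \<in> lists \<Sigma>" "c \<in> configs M w" and nz: "amp w \<omega> c \<noteq> 0"
  shows "sim_action (state c) (scanned w (in_pos c)) (work_tape c (work_pos c)) \<omega> \<in> actions M (scanned w (in_pos c))"
proof (cases "halted M c")
  case True
  then show ?thesis using config_scan[OF w] by (auto simp: sim_action_def idle_def actions_def)
next
  case False
  then obtain b where b: "b \<in> set_pmf (choice M w c)"
    "\<omega> = branch_reg (state c, scanned w (in_pos c), work_tape c (work_pos c), b)"
    using nz by (auto simp: sim_amp_def split: if_splits)
  then show ?thesis
    using False ptrans_actions[OF _ False _ _ b(1)] config_scan[OF w] wom_idle_in_actions by (auto simp: sim_action_def)
qed

lemma qstep_sim:
  assumes "w \<in> lists \<Sigma>" "c \<in> configs M w"
  shows "qstep sim w \<omega> c' c = (if c' = target w \<omega> c then complex_of_real (amp w \<omega> c) else 0)"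
  unfolding target_def
proof (rule qstep_single_action[OF wf_machine_sim])
  assume "complex_of_real (amp w \<omega> c) \<noteq> 0"
  then show "sim_action (state c) (scanned w (in_pos c)) (work_tape c (work_pos c)) \<omega> \<in> actions sim (scanned w (in_pos c))"
    unfolding actions_sim using sim_action_in_actions[OF assms] by simp
qed (simp add: sim_def)

lemma target_in_configs:
  assumes "w \<in> lists \<Sigma>" "c \<in> configs M w" "amp w \<omega> c \<noteq> 0"
  shows "target w \<omega> c \<in> configs M w"
  unfolding target_def by (rule apply_action_in_configs[OF assms(2) sim_action_in_actions[OF assms]])

lemma amp_running:
  assumes "\<not> halted M c" "amp w \<omega> c \<noteq> 0"
  obtains b where "b \<in> set_pmf (choice M w c)"
    "\<omega> = branch_reg (state c, scanned w (in_pos c), work_tape c (work_pos c), b)"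
  using assms by (auto simp: sim_amp_def split: if_splits)

lemma amp_halted_iff:
  assumes "amp w \<omega> c \<noteq> 0"
  shows "halted M c \<longleftrightarrow> \<omega> < 2"
proof (cases "halted M c")
  case True
  then show ?thesis using assms unfolding sim_amp_def by (cases "\<omega> = 0"; cases "\<omega> = 1") (auto split: if_splits)
next
  case False
  then obtain b where "\<omega> = branch_reg (state c, scanned w (in_pos c), work_tape c (work_pos c), b)"
    using amp_running[OF False assms] by blast
  then have "\<not> \<omega> < 2" by (simp add: branch_reg_def)
  then show ?thesis using False by blast
qed

text \<open>The observed symbol contains the state, the scanned symbols and the action. Hence the
  moves can be reverted and the overwritten work symbol is known; an announcement changes nothing at
  all.\<close>

lemma target_inj:
  assumes nz: "amp w \<omega> c \<noteq> 0" "amp w \<omega> d \<noteq> 0" and eq: "target w \<omega> c = target w \<omega> d"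
  shows "c = d"
proof (cases "halted M c \<or> halted M d")
  case True
  then have "halted M c" "halted M d"
    using nz amp_halted_iff by blast+
  then show ?thesis using eq by (auto simp: target_def sim_action_def apply_idle)
next
  case False
  then have run: "\<not> halted M c" "\<not> halted M d" by blast+
  obtain b where 1: "\<omega> = branch_reg (state c, scanned w (in_pos c), work_tape c (work_pos c), b)"
    using amp_running[OF run(1) nz(1)] by blast
  obtain b' where 2: "\<omega> = branch_reg (state d, scanned w (in_pos d), work_tape d (work_pos d), b')"
    using amp_running[OF run(2) nz(2)] by blast
  have same: "state c = state d" "work_tape c (work_pos c) = work_tape d (work_pos d)"
    using 2 unfolding 1 by simp_all
  have "inv branch_reg \<omega> = (state c, scanned w (in_pos c), work_tape c (work_pos c), b)" unfolding 1 by simp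
  then have e: "apply_action (wom_idle b) c = apply_action (wom_idle b) d"
    using eq run by (simp add: target_def sim_action_def)
  have wp: "work_pos c = work_pos d" using e by (simp add: apply_action_def)
  have "work_tape c i = work_tape d i" for i
  proof (cases "i = work_pos c")
    case True
    then show ?thesis using same(2) wp by simp
  next
    case False
    have "((work_tape c)(work_pos c := work_write b)) i = ((work_tape d)(work_pos d := work_write b)) i"
      using arg_cong[OF e, of work_tape] by (simp add: apply_action_def wom_idle_def fun_eq_iff)
    then show ?thesis using False wp by (simp split: if_splits)
  qed
  then have "work_tape c = work_tape d" by blast
  then show ?thesis using e same(1) wp
    by (cases c; cases d) (simp add: apply_action_def wom_idle_def)
qed

text \<open>Symbols recording another state or another scan have amplitude 0, so the sum over
  symbols is one over actions. The constant \<open>f\<close> yields normalization, a hitting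
  probability as \<open>f\<close> yields the simulation.\<close>

lemma sum_cont_amp:
  assumes w: "w \<in> lists \<Sigma>" "c \<in> configs M w" and run: "\<not> halted M c"
  defines "p \<equiv> choice M w c"
  shows "(\<Sum>\<omega>\<in>cont_regs sim. (amp w \<omega> c)\<^sup>2 * f (target w \<omega> c))
    = (\<Sum>b\<in>set_pmf p. pmf p b * f (apply_action (wom_idle b) c))"
proof -
  let ?k = "\<lambda>b. (state c, scanned w (in_pos c), work_tape c (work_pos c), b)"
  have sub: "?k ` set_pmf p \<subseteq> branches"
    using config_scan[OF w] run by (auto simp: branches_def p_def)
  have "(\<Sum>\<omega>\<in>cont_regs sim. (amp w \<omega> c)\<^sup>2 * f (target w \<omega> c))
     = (\<Sum>k\<in>branches. (amp w (branch_reg k) c)\<^sup>2 * f (target w (branch_reg k) c))"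
    by (simp add: sim_def sum.reindex[OF inj_on_subset[OF inj_branch_reg]])
  also have "\<dots> = (\<Sum>k\<in>?k ` set_pmf p. (amp w (branch_reg k) c)\<^sup>2 * f (target w (branch_reg k) c))"
  proof (rule sum.mono_neutral_right[OF finite_branches sub], intro ballI)
    fix k assume k: "k \<in> branches - ?k ` set_pmf p"
    have "amp w (branch_reg k) c = 0"
    proof (rule ccontr)
      assume "amp w (branch_reg k) c \<noteq> 0"
      then obtain b where "b \<in> set_pmf p" "branch_reg k = branch_reg (?k b)"
        using run by (auto simp: sim_amp_def p_def split: if_splits)
      then show False using k by auto
    qed
    then show "(amp w (branch_reg k) c)\<^sup>2 * f (target w (branch_reg k) c) = 0" by simp
  qed
  also have "\<dots> = (\<Sum>b\<in>set_pmf p. (amp w (branch_reg (?k b)) c)\<^sup>2 * f (target w (branch_reg (?k b)) c))"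
    by (subst sum.reindex) (auto simp: inj_on_def)
  also have "\<dots> = (\<Sum>b\<in>set_pmf p. pmf p b * f (apply_action (wom_idle b) c))"
  proof (intro sum.cong refl)
    fix b assume "b \<in> set_pmf p"
    then have "amp w (branch_reg (?k b)) c = sqrt (pmf p b)"
      using run by (auto simp: sim_amp_def p_def)
    then show "(amp w (branch_reg (?k b)) c)\<^sup>2 * f (target w (branch_reg (?k b)) c)
      = pmf p b * f (apply_action (wom_idle b) c)"
      using run by (simp add: target_def sim_action_def)
  qed
  finally show ?thesis .
qed

lemma finite_set_ptrans:
  assumes w: "w \<in> lists \<Sigma>" "c \<in> configs M w" and run: "\<not> halted M c"
  shows "finite (set_pmf (choice M w c))"
  using ptrans_actions[OF config_scan(1)[OF w] run config_scan(2,3)[OF w]] finite_actions[OF wf_machine_M]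
  by (meson finite_subset subsetI)

lemma finite_regs_sim: "finite (regs sim)" "0 \<notin> cont_regs sim" "1 \<notin> cont_regs sim" "regs sim = {0, 1} \<union> cont_regs sim"
  using finite_branches by (auto simp: regs_def sim_def branch_reg_def)

lemma amp_halted:
  assumes "halted M c" "\<omega> \<in> cont_regs sim"
  shows "amp w \<omega> c = 0"
proof -
  have "\<omega> \<noteq> 0" "\<omega> \<noteq> 1" using assms(2) finite_regs_sim(2,3) by (intro notI; simp)+
  then show ?thesis using assms(1) by (auto simp: sim_amp_def)
qed

lemma sum_regs_amp:
  assumes w: "w \<in> lists \<Sigma>" "c \<in> configs M w"
  shows "(\<Sum>\<omega>\<in>regs sim. (amp w \<omega> c)\<^sup>2) = 1"
proof -
  have fin: "finite (cont_regs sim)" using finite_regs_sim(1) by (simp add: regs_def)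
  have split: "(\<Sum>\<omega>\<in>regs sim. (amp w \<omega> c)\<^sup>2) = (amp w 0 c)\<^sup>2 + (amp w 1 c)\<^sup>2 + (\<Sum>\<omega>\<in>cont_regs sim. (amp w \<omega> c)\<^sup>2)"
    unfolding finite_regs_sim(4) using finite_regs_sim(2,3) fin by (simp add: add.assoc)
  show ?thesis
  proof (cases "halted M c")
    case True
    then have "(\<Sum>\<omega>\<in>cont_regs sim. (amp w \<omega> c)\<^sup>2) = 0" by (simp add: amp_halted)
    then show ?thesis using True wf unfolding split by (auto simp: sim_amp_def wf_ptm_def)
  next
    case False
    have "amp w 0 c = 0" "amp w 1 c = 0"
      using False amp_halted_iff[where w = w and \<omega> = 0 and c = c] amp_halted_iff[where w = w and \<omega> = 1 and c = c] by auto
    moreover have "(\<Sum>\<omega>\<in>cont_regs sim. (amp w \<omega> c)\<^sup>2) = 1"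
      using sum_cont_amp[OF w False, of "\<lambda>_. 1"] sum_pmf_eq_1[OF finite_set_ptrans[OF w False] order.refl] by simp
    ultimately show ?thesis unfolding split by simp
  qed
qed

text \<open>By injectivity the columns of each \<open>E\<^sub>\<omega>\<close> are orthogonal by
  themselves. Only their normalization involves all symbols together.\<close>

lemma wf_qtm_sim: "wf_qtm \<Sigma> sim"
proof -
  have "eff_complex (qtrans sim q \<sigma> g a \<omega>)"
    if "q \<in> states sim" "\<sigma> \<in> in_syms \<Sigma>" "g \<in> work_alph sim" for q \<sigma> g a \<omega>
  proof -
    have "eff_real (sim_amp q \<sigma> g \<omega>)"
    proof (cases "q \<in> {acc_state M, rej_state M}")
      case True
      then show ?thesis by (auto simp: sim_amp_def eff_real_0 eff_real_1)
    next
      case False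
      then have "eff_real (sqrt (pmf (ptrans M q \<sigma> g) b))" for b
        using wf that unfolding wf_ptm_def sim_def by (intro eff_real_sqrt) (auto simp: pmf_le_1)
      then show ?thesis using False unfolding sim_amp_def by (simp add: eff_real_0)
    qed
    then show ?thesis using eff_complex_of_real eff_complex_of_real[OF eff_real_0] by (simp add: sim_def)
  qed
  moreover have "well_formed \<Sigma> sim"
    unfolding well_formed_def configs_sim
  proof (intro ballI)
    fix w c1 c2 assume w: "w \<in> lists \<Sigma>" and c: "c1 \<in> configs M w" "c2 \<in> configs M w"
    have inner: "(\<Sum>\<^sub>\<infinity>c'\<in>configs M w. cnj (qstep sim w \<omega> c' c1) * qstep sim w \<omega> c' c2)
        = (if c1 = c2 then complex_of_real ((amp w \<omega> c1)\<^sup>2) else 0)" for \<omega>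
    proof (cases "amp w \<omega> c1 = 0")
      case True
      then have "qstep sim w \<omega> c' c1 = 0" for c' by (simp add: qstep_sim[OF w c(1)])
      then show ?thesis using True by auto
    next
      case False
      have "(\<Sum>\<^sub>\<infinity>c'\<in>configs M w. cnj (qstep sim w \<omega> c' c1) * qstep sim w \<omega> c' c2)
         = (\<Sum>c'\<in>{target w \<omega> c1}. cnj (qstep sim w \<omega> c' c1) * qstep sim w \<omega> c' c2)"
        by (rule infsum_eq_sum) (use target_in_configs[OF w c(1) False] in \<open>auto simp: qstep_sim[OF w] c\<close>)
      then show ?thesis using target_inj[OF False, of c2]
        by (auto simp: qstep_sim[OF w] c power2_eq_square)
    qed
    show "(\<Sum>\<omega>\<in>regs sim. \<Sum>\<^sub>\<infinity>c'\<in>configs M w. cnj (qstep sim w \<omega> c' c1) * qstep sim w \<omega> c' c2) = (if c1 = c2 then 1 else 0)"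
    proof (cases "c1 = c2")
      case True
      have "(\<Sum>\<omega>\<in>regs sim. complex_of_real ((amp w \<omega> c1)\<^sup>2)) = 1"
        by (simp only: of_real_sum[symmetric] sum_regs_amp[OF w c(1)] of_real_1)
      then show ?thesis using True unfolding inner by simp
    qed (simp add: inner)
  qed
  moreover have "acc_regs sim = {0}" "rej_regs sim = {1}" by (simp_all add: sim_def)
  ultimately show ?thesis
    using finite_regs_sim(1-3) wf_machine_sim unfolding wf_qtm_def by simp
qed

text \<open>The observed symbols determine the actions, so after any history the state vector is a
  multiple of a single configuration and nothing interferes.\<close>

fun end_config :: "nat list \<Rightarrow> nat list \<Rightarrow> config" where
  "end_config w [] = init_config M"
| "end_config w (\<omega> # ws) = target w \<omega> (end_config w ws)"

fun end_amp :: "nat list \<Rightarrow> nat list \<Rightarrow> real" where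
  "end_amp w [] = 1"
| "end_amp w (\<omega> # ws) = amp w \<omega> (end_config w ws) * end_amp w ws"

lemma qvec_sim:
  assumes w: "w \<in> lists \<Sigma>"
  shows "end_amp w ws \<noteq> 0 \<longrightarrow> end_config w ws \<in> configs M w"
    and "qvec sim w ws c = (if c = end_config w ws then complex_of_real (end_amp w ws) else 0)"
proof (induction ws arbitrary: c)
  case Nil
  {
    case 1
    then show ?case by (simp add: init_config_in_configs wf_machine_M)
  next
    case 2
    then show ?case by (simp add: init_sim)
  }
next
  case (Cons \<omega> ws)
  {
    case 1
    then show ?case using target_in_configs[OF w] Cons.IH(1) by simp
  next
    case 2
    show ?case
    proof (cases "end_amp w ws = 0")
      case True
      then show ?thesis using Cons.IH(2) by (simp add: if_distrib cong: if_cong)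
    next
      case False
      then have in_cf: "end_config w ws \<in> configs M w" using Cons.IH(1) by blast
      have "qvec sim w (\<omega> # ws) c = (\<Sum>c'\<in>{end_config w ws}. qstep sim w \<omega> c c' * qvec sim w ws c')"
        by (rule qvec_Cons_eq_sum) (use in_cf Cons.IH(2) in \<open>auto simp: configs_sim qsupport_def\<close>)
      then show ?thesis using Cons.IH(2) by (simp add: qstep_sim[OF w in_cf])
    qed
  }
qed

lemma obs_prob_sim:
  assumes w: "w \<in> lists \<Sigma>"
  shows "obs_prob sim w ws = (end_amp w ws)\<^sup>2"
proof (cases "end_amp w ws = 0")
  case True
  then have "qvec sim w ws c = 0" for c using qvec_sim(2)[OF w] by simp
  then show ?thesis using True by (simp add: obs_prob_def)
next
  case False
  then have "end_config w ws \<in> configs M w" using qvec_sim(1)[OF w] by blast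
  then have "obs_prob sim w ws = (\<Sum>c\<in>{end_config w ws}. (cmod (qvec sim w ws c))\<^sup>2)"
    using qvec_sim(2)[OF w] by (intro obs_prob_eq_sum) (auto simp: qsupport_def configs_sim)
  then show ?thesis using qvec_sim(2)[OF w] by simp
qed

text \<open>A run that first reaches \<open>h\<close> after k steps becomes a history of k
  continuing symbols followed by the announcement, whence the summation over k \<le> t instead of k
  < t.\<close>

lemma hit_eq_sum_obs_prob:
  assumes w: "w \<in> lists \<Sigma>" and h: "h = acc_state M \<and> \<omega>\<^sub>h = 0 \<or> h = rej_state M \<and> \<omega>\<^sub>h = 1"
  defines "L \<equiv> \<lambda>k. {ws. set ws \<subseteq> cont_regs sim \<and> length ws = k}"
  shows "hit M w h t (init_config M) = (\<Sum>k\<le>t. \<Sum>ws\<in>L k. obs_prob sim w (\<omega>\<^sub>h # ws))"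
proof -
  have fin: "finite (cont_regs sim)" using finite_regs_sim(1) by (simp add: regs_def)
  have neq: "acc_state M \<noteq> rej_state M" using wf by (simp add: wf_ptm_def)
  have amp_h: "(amp w \<omega>\<^sub>h c)\<^sup>2 = (if state c = h then 1 else 0)" for c
  proof (cases "halted M c")
    case True
    then show ?thesis using h neq by (auto simp: sim_amp_def)
  next
    case False
    have "amp w \<omega>\<^sub>h c = 0"
      by (rule ccontr, drule amp_halted_iff) (use False h in auto)
    then show ?thesis using False h by auto
  qed
  have obs_h: "obs_prob sim w (\<omega>\<^sub>h # ws) = (end_amp w ws)\<^sup>2 * (if state (end_config w ws) = h then 1 else 0)" for ws
    by (simp add: obs_prob_sim[OF w] power_mult_distrib amp_h)
  have step: "(end_amp w ws)\<^sup>2 * hit M w h (Suc n) (end_config w ws) = obs_prob sim w (\<omega>\<^sub>h # ws)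
     + (\<Sum>\<omega>\<in>cont_regs sim. (end_amp w (\<omega> # ws))\<^sup>2 * hit M w h n (end_config w (\<omega> # ws)))" for ws n
  proof (cases "end_amp w ws = 0")
    case True
    then show ?thesis by (simp add: obs_h)
  next
    case False
    let ?c = "end_config w ws"
    have c: "?c \<in> configs M w" using False qvec_sim(1)[OF w] by blast
    have right: "(\<Sum>\<omega>\<in>cont_regs sim. (end_amp w (\<omega> # ws))\<^sup>2 * hit M w h n (end_config w (\<omega> # ws)))
      = (end_amp w ws)\<^sup>2 * (\<Sum>\<omega>\<in>cont_regs sim. (amp w \<omega> ?c)\<^sup>2 * hit M w h n (target w \<omega> ?c))"
      by (simp add: sum_distrib_left power_mult_distrib mult_ac)
    show ?thesis
    proof (cases "halted M ?c")
      case True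
      have "(\<Sum>\<omega>\<in>cont_regs sim. (amp w \<omega> ?c)\<^sup>2 * hit M w h n (target w \<omega> ?c)) = 0"
        using amp_halted[OF True] by (intro sum.neutral) auto
      then show ?thesis unfolding right obs_h hit_halted[OF True] by simp
    next
      case run: False
      have "state ?c \<noteq> h" using run h by auto
      moreover have "hit M w h (Suc n) ?c = (\<Sum>\<omega>\<in>cont_regs sim. (amp w \<omega> ?c)\<^sup>2 * hit M w h n (target w \<omega> ?c))"
        unfolding sum_cont_amp[OF w c run] hit_Suc_running[OF run finite_set_ptrans[OF w c run] order.refl]
        using hit_core_cong[OF core_apply_wom_idle] by simp
      ultimately show ?thesis unfolding right obs_h by simp
    qed
  qed
  \<comment> \<open>The first \<open>j\<close> steps are transferred from the hitting probability to
    the histories. For j = t the remaining term becomes the summand k = t.\<close>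
  have "hit M w h t (init_config M) = (\<Sum>k<j. \<Sum>ws\<in>L k. obs_prob sim w (\<omega>\<^sub>h # ws))
     + (\<Sum>ws\<in>L j. (end_amp w ws)\<^sup>2 * hit M w h (t - j) (end_config w ws))" if "j \<le> t" for j
    using that
  proof (induction j)
    case 0
    have "L 0 = {[]}" by (auto simp: L_def)
    then show ?case by simp
  next
    case (Suc j)
    have tj: "t - j = Suc (t - Suc j)" using Suc.prems by simp
    have "(\<Sum>ws\<in>L j. (end_amp w ws)\<^sup>2 * hit M w h (t - j) (end_config w ws))
       = (\<Sum>ws\<in>L j. obs_prob sim w (\<omega>\<^sub>h # ws))
        + (\<Sum>ws\<in>L (Suc j). (end_amp w ws)\<^sup>2 * hit M w h (t - Suc j) (end_config w ws))"
      unfolding tj step sum.distrib L_def sum_lists_Suc[OF fin] ..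
    then show ?case using Suc by simp
  qed
  from this[of t] show ?thesis
    by (simp add: hit_0 obs_h flip: lessThan_Suc_atMost)
qed

text \<open>Lower bounds are enough, since \<open>bounded_error\<close> bounds only the correct
  outcome, and only from below. Finite partial sums provide them.\<close>

lemma hit_le_sim:
  assumes w: "w \<in> lists \<Sigma>"
  shows "hit M w (acc_state M) t (init_config M) \<le> qtm_acc sim w"
    "hit M w (rej_state M) t (init_config M) \<le> qtm_rej sim w"
proof -
  have fin: "finite (cont_regs sim)" using finite_regs_sim(1) by (simp add: regs_def)
  have regs: "acc_regs sim = {0}" "rej_regs sim = {1}" by (simp_all add: sim_def)
  let ?L = "\<lambda>k. {ws. set ws \<subseteq> cont_regs sim \<and> length ws = k}"
  have eq: "(\<Sum>k\<le>t. \<Sum>ws\<in>?L k. obs_prob sim w (a # ws)) = (\<Sum>(\<omega>, ws)\<in>{a} \<times> (\<Union>k\<le>t. ?L k). obs_prob sim w (\<omega> # ws))" for a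
  proof -
    have "(\<Sum>k\<le>t. \<Sum>ws\<in>?L k. obs_prob sim w (a # ws)) = (\<Sum>ws\<in>(\<Union>k\<le>t. ?L k). obs_prob sim w (a # ws))"
      using fin by (intro sum.UNION_disjoint[symmetric]) (auto simp: finite_lists_length_eq)
    then show ?thesis by (simp add: sum.cartesian_product[symmetric])
  qed
  have "(\<Sum>(\<omega>, ws)\<in>{0} \<times> (\<Union>k\<le>t. ?L k). obs_prob sim w (\<omega> # ws)) \<le> qtm_acc sim w"
    by (rule sum_obs_prob_le_qtm_acc[OF wf_qtm_sim w]) (use fin in \<open>auto simp: regs finite_lists_length_eq\<close>)
  then show "hit M w (acc_state M) t (init_config M) \<le> qtm_acc sim w"
    using hit_eq_sum_obs_prob[OF w, of "acc_state M" 0 t] eq[of 0] by simp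
  have "(\<Sum>(\<omega>, ws)\<in>{1} \<times> (\<Union>k\<le>t. ?L k). obs_prob sim w (\<omega> # ws)) \<le> qtm_rej sim w"
    by (rule sum_obs_prob_le_qtm_rej[OF wf_qtm_sim w]) (use fin in \<open>auto simp: regs finite_lists_length_eq\<close>)
  then show "hit M w (rej_state M) t (init_config M) \<le> qtm_rej sim w"
    using hit_eq_sum_obs_prob[OF w, of "rej_state M" 1 t] eq[of 1] by simp
qed

lemma ptm_le_sim:
  assumes "w \<in> lists \<Sigma>"
  shows "ptm_acc M w \<le> qtm_acc sim w" "ptm_rej M w \<le> qtm_rej sim w"
  unfolding ptm_acc_eq ptm_rej_eq by (intro cSUP_least hit_le_sim[OF assms]; simp)+

section \<open>Space used by the simulation\<close>

lemma sim_step_lifts: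
  assumes w: "w \<in> lists \<Sigma>" and c: "c \<in> configs M w" and step: "qstep sim w \<omega> c' c \<noteq> 0" and p: "core p = core c"
  shows "c' \<in> configs M w \<and> (\<exists>p'\<in>set_pmf (pstep M w p). core p' = core c')"
proof -
  have nz: "amp w \<omega> c \<noteq> 0" and c': "c' = target w \<omega> c"
    using step by (auto simp: qstep_sim[OF w c] split: if_splits)
  have eqs: "state p = state c" "in_pos p = in_pos c" "work_pos p = work_pos c" "work_tape p = work_tape c"
    using p by (simp_all add: core_eq_iff)
  show ?thesis
  proof (cases "halted M c")
    case True
    then have "target w \<omega> c = c" by (simp add: target_def sim_action_def apply_idle)
    then show ?thesis using True c c' p eqs by (simp add: pstep_def)
  next
    case False
    obtain b where b: "b \<in> set_pmf (choice M w c)"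
      "\<omega> = branch_reg (state c, scanned w (in_pos c), work_tape c (work_pos c), b)"
      using amp_running[OF False nz] by blast
    have "target w \<omega> c = apply_action (wom_idle b) c" using False by (simp add: target_def sim_action_def b(2))
    then have "core (apply_action b p) = core c'"
      unfolding c' using core_apply_wom_idle core_apply_action_cong[OF p] by simp
    moreover have "apply_action b p \<in> set_pmf (pstep M w p)"
      using False b(1) by (simp add: pstep_def eqs)
    ultimately show ?thesis using target_in_configs[OF w c nz] c' by blast
  qed
qed

text \<open>The space bound is transferred along paths that agree up to the WOM. The announcing step
  is matched by the self-loop of a halting configuration.\<close>

lemma sim_path_lifts:
  assumes w: "w \<in> lists \<Sigma>" and cs: "cs \<in> qtm_paths sim w"
  shows "\<exists>ps\<in>ptm_paths M w. map core ps = map core cs"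
proof -
  have "successively (\<lambda>c c'. \<exists>\<omega>\<in>regs sim. qstep sim w \<omega> c' c \<noteq> 0) cs" "cs \<noteq> []" "hd cs = init_config M"
    using cs by (simp_all add: qtm_paths_def init_sim)
  then have "last cs \<in> configs M w \<and> (\<exists>ps\<in>ptm_paths M w. map core ps = map core cs)"
  proof (induction cs rule: rev_induct)
    case (snoc c cs)
    show ?case
    proof (cases "cs = []")
      case True
      then show ?thesis using snoc.prems init_config_in_configs[OF wf_machine_M]
        by (intro conjI bexI[of _ "[init_config M]"]) (auto simp: ptm_paths_def)
    next
      case False
      then have IH: "last cs \<in> configs M w" "\<exists>ps\<in>ptm_paths M w. map core ps = map core cs"
        using snoc by (auto simp: successively_append_iff)
      obtain \<omega> where step: "qstep sim w \<omega> c (last cs) \<noteq> 0"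
        using snoc.prems(1) False by (auto simp: successively_append_iff)
      obtain ps where ps: "ps \<in> ptm_paths M w" "map core ps = map core cs" using IH(2) by blast
      have ne: "ps \<noteq> []" using ps(2) False by auto
      have "core (last ps) = core (last cs)" using ps(2) ne False by (metis last_map)
      from sim_step_lifts[OF w IH(1) step this] obtain p' where
        p': "p' \<in> set_pmf (pstep M w (last ps))" "core p' = core c" and c: "c \<in> configs M w" by blast
      have "ps @ [p'] \<in> ptm_paths M w"
        using ps(1) ne p'(1) by (simp add: ptm_paths_def successively_append_iff)
      then show ?thesis using c p'(2) ps(2) by (auto intro!: bexI[of _ "ps @ [p']"])
    qed
  qed simp
  then show ?thesis by blast
qed

end

definition sym_code :: "in_sym \<Rightarrow> nat" where
  "sym_code \<sigma> = (case \<sigma> of Lend \<Rightarrow> 0 | Rend \<Rightarrow> 1 | Sym n \<Rightarrow> n + 2)"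

definition branch_code :: "nat \<times> in_sym \<times> nat \<times> action \<Rightarrow> nat" where
  "branch_code = (\<lambda>(q, \<sigma>, g, b). to_nat (q, sym_code \<sigma>, g, next_state b, work_write b, shift (in_move b),
     shift (work_move b), wom_write b, shift (wom_move b)))"

lemma inj_branch_code: "inj branch_code"
proof (rule injI)
  fix x y assume eq: "branch_code x = branch_code y"
  have mv: "shift m = shift m' \<Longrightarrow> m = m'" for m m' by (cases m; cases m') simp_all
  have sym: "sym_code \<sigma> = sym_code \<sigma>' \<Longrightarrow> \<sigma> = \<sigma>'" for \<sigma> \<sigma>' by (cases \<sigma>; cases \<sigma>') (simp_all add: sym_code_def)
  obtain q \<sigma> g b q' \<sigma>' g' b' where xy: "x = (q, \<sigma>, g, b)" "y = (q', \<sigma>', g', b')" by (metis prod_cases4)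
  show "x = y"
    using eq mv sym unfolding xy branch_code_def prod.case to_nat_split prod.inject
    by (auto intro!: action.equality)
qed

theorem qtm_simulates_ptm:
  assumes \<Sigma>: "finite \<Sigma>" and ptm: "ptm_wom_recognizable \<Sigma> s L"
  shows "qtm_wom_recognizable \<Sigma> s L"
proof -
  obtain M where M: "wf_ptm \<Sigma> M"
    "\<And>w cs. w \<in> lists \<Sigma> \<Longrightarrow> cs \<in> ptm_paths M w \<Longrightarrow> squares_used cs \<le> s (length w)"
    "bounded_error \<Sigma> L (ptm_acc M) (ptm_rej M)"
    using ptm unfolding ptm_wom_recognizable_def by blast
  interpret ptm_simulation \<Sigma> M branch_code
    by unfold_locales (fact \<Sigma> M(1) inj_branch_code)+
  have "squares_used cs \<le> s (length w)" if w: "w \<in> lists \<Sigma>" "cs \<in> qtm_paths sim w" for w cs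
  proof -
    obtain ps where "ps \<in> ptm_paths M w" "map core ps = map core cs" using sim_path_lifts[OF w] by blast
    then show ?thesis using M(2)[OF w(1)] squares_used_core by metis
  qed
  moreover have "bounded_error \<Sigma> L (qtm_acc sim) (qtm_rej sim)"
    using M(3) ptm_le_sim unfolding bounded_error_def by (meson order.trans)
  ultimately show ?thesis using wf_qtm_sim unfolding qtm_wom_recognizable_def by blast
qed

section \<open>A quantum machine that compares two words by interference\<close>

definition twin_words :: "nat list set" where
  "twin_words = {x @ 2 # x | x. x \<in> lists {0, 1}}"

text \<open>States 1 and 3 belong to the branch that stores the part before the separator 2, states 2 and 4
  to the branch that stores the part after it.  A successful scan ends in state 3 or 4.\<close>

definition storing :: "nat \<Rightarrow> in_sym \<Rightarrow> bool" where
  "storing q \<sigma> \<longleftrightarrow> q \<in> {1, 4} \<and> \<sigma> \<in> {Sym 0, Sym 1}"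

definition flipping :: "nat \<Rightarrow> in_sym \<Rightarrow> bool" where
  "flipping q \<sigma> \<longleftrightarrow> q \<in> {1, 4} \<and> \<sigma> = Sym 1"

text \<open>Overwriting a WOM square is not reversible, but exchanging the symbols 0 and 1 is.  It is
  the superposition of all three writes with amplitude \<open>-1\<close> for the empty symbol, whose effect
  cancels against rewriting the symbol present.\<close>

definition wom_amp :: "nat \<Rightarrow> in_sym \<Rightarrow> nat option \<Rightarrow> real" where
  "wom_amp q \<sigma> v = (if flipping q \<sigma> then (if v = None then -1 else 1) else (if v = None then 1 else 0))"

text \<open>With the last amplitudes a superposition of states 3 and 4 in equal configurations accepts with
  probability \<open>3/4\<close>, and each of the two states alone rejects with probability \<open>5/8\<close>.\<close>

definition twin_amp :: "nat \<Rightarrow> in_sym \<Rightarrow> nat \<Rightarrow> nat \<Rightarrow> real" where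
  "twin_amp q \<sigma> q' \<omega> =
     (if q = 0 \<and> \<sigma> = Lend then (if \<omega> = 3 \<and> q' \<in> {1, 2} then sqrt (1/2) else 0)
      else if q \<in> {1, 2, 3, 4} \<and> \<sigma> \<in> {Sym 0, Sym 1} then (if \<omega> = 3 \<and> q' = q then 1 else 0)
      else if q \<in> {1, 2} \<and> \<sigma> = Sym 2 then (if \<omega> = 3 \<and> q' = q + 2 then 1 else 0)
      else if q \<in> {3, 4} \<and> \<sigma> = Rend then
        (if q' \<noteq> 5 then 0 else if \<omega> = 0 then sqrt (3/8) else if \<omega> = 1 then sqrt (1/8)
         else if \<omega> = 2 then (if q = 3 then sqrt (1/2) else - sqrt (1/2)) else 0)
      else (if \<omega> = 4 \<and> q' = q then 1 else 0))"

text \<open>Symbol 3 is the only one that continues, and it is tied to moving right. Symbol 4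
  rejects where the scan cannot go on; 0, 1 and 2 are the outcomes of the final measurement.\<close>

definition twin :: qtm_wom where
  "twin = \<lparr>states = {..<6}, start = 0, work_alph = {0}, wom_alph = {0, 1},
     acc_regs = {0}, rej_regs = {1, 2, 4}, cont_regs = {3},
     qtrans = (\<lambda>q \<sigma> g a \<omega>.
       if work_write a = 0 \<and> work_move a = MStay \<and> in_move a = (if \<omega> = 3 then MRight else MStay)
          \<and> wom_move a = (if storing q \<sigma> then MRight else MStay)
       then complex_of_real (twin_amp q \<sigma> (next_state a) \<omega> * wom_amp q \<sigma> (wom_write a)) else 0)\<rparr>"

definition twin_step :: "nat list \<Rightarrow> nat \<Rightarrow> config \<Rightarrow> nat \<Rightarrow> config" where
  "twin_step w \<omega> c q' =
     \<lparr>state = q', in_pos = in_pos c + (if \<omega> = 3 then 1 else 0), work_pos = work_pos c, work_tape = work_tape c,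
      wom_pos = wom_pos c + (if storing (state c) (scanned w (in_pos c)) then 1 else 0),
      wom_tape = (if flipping (state c) (scanned w (in_pos c))
        then (wom_tape c)(wom_pos c := 1 - wom_tape c (wom_pos c)) else wom_tape c)\<rparr>"

abbreviation scan_amp :: "nat list \<Rightarrow> config \<Rightarrow> nat \<Rightarrow> nat \<Rightarrow> real" where
  "scan_amp w c q' \<omega> \<equiv> twin_amp (state c) (scanned w (in_pos c)) q' \<omega>"

lemma wf_machine_twin: "wf_machine twin"
  by (simp add: wf_machine_def twin_def)

lemma twin_amp_nonzero_state: "twin_amp q \<sigma> q' \<omega> \<noteq> 0 \<Longrightarrow> q < 6 \<Longrightarrow> q' < 6"
  by (auto simp: twin_amp_def split: if_splits)

lemma twin_amp_Rend: "twin_amp q Rend q' 3 = 0"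
  by (auto simp: twin_amp_def)

lemma twin_configD:
  assumes "c \<in> configs twin w"
  shows "state c < 6" "work_tape c = (\<lambda>_. 0)" "wom_tape c i = 0 \<or> wom_tape c i = 1"
  using assms by (auto simp: configs_def twin_def)

text \<open>For a given \<omega> and target state at most three actions have nonzero amplitude, one
  for each WOM write. Summing those with the same effect leaves a single target configuration with
  the amplitude \<open>twin_amp\<close>.\<close>

lemma qstep_twin:
  assumes c: "c \<in> configs twin w"
  shows "qstep twin w \<omega> c' c
    = (if c' = twin_step w \<omega> c (state c') then complex_of_real (scan_amp w c (state c') \<omega>) else 0)"
proof -
  let ?q = "state c" and ?\<sigma> = "scanned w (in_pos c)"
  define act where "act v = \<lparr>next_state = state c', work_write = 0, in_move = (if \<omega> = 3 then MRight else MStay),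
    work_move = MStay, wom_write = v, wom_move = (if storing ?q ?\<sigma> then MRight else MStay)\<rparr>" for v
  let ?V = "{None, Some 0, Some (1::nat)}"
  let ?S = "{a \<in> actions twin ?\<sigma>. apply_action a c = c'}"
  let ?f = "\<lambda>a. qtrans twin ?q ?\<sigma> (work_tape c (work_pos c)) a \<omega>"
  have fin: "finite ?S" using finite_actions[OF wf_machine_twin] by simp
  show ?thesis
  proof (cases "twin_amp ?q ?\<sigma> (state c') \<omega> = 0")
    case True
    have "?f a = 0" if "a \<in> ?S" for a
    proof -
      have "next_state a = state c'" using that by (auto simp: apply_action_def)
      then show ?thesis using True by (simp add: twin_def)
    qed
    then have "qstep twin w \<omega> c' c = 0" by (simp add: qstep_def Let_def)
    then show ?thesis using True by simp
  next
    case False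
    have q': "state c' < 6" using twin_amp_nonzero_state[OF False] twin_configD(1)[OF c] by blast
    have acts: "act v \<in> actions twin ?\<sigma>" if "v \<in> ?V" for v
    proof -
      have "?\<sigma> \<noteq> Rend" if "\<omega> = 3" using False that twin_amp_Rend by metis
      then show ?thesis using that q' by (auto simp: act_def actions_def twin_def)
    qed
    have inj: "inj act" by (rule injI) (simp add: act_def)
    have "qstep twin w \<omega> c' c = (\<Sum>a\<in>?S. ?f a)" by (simp add: qstep_def Let_def)
    also have "\<dots> = (\<Sum>a\<in>act ` {v \<in> ?V. apply_action (act v) c = c'}. ?f a)"
    proof (rule sum.mono_neutral_right[OF fin])
      show "act ` {v \<in> ?V. apply_action (act v) c = c'} \<subseteq> ?S" using acts by blast
      show "\<forall>a\<in>?S - act ` {v \<in> ?V. apply_action (act v) c = c'}. ?f a = 0"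
      proof (intro ballI, rule ccontr)
        fix a assume a: "a \<in> ?S - act ` {v \<in> ?V. apply_action (act v) c = c'}" and nz: "?f a \<noteq> 0"
        have "next_state a = state c'" using a by (auto simp: apply_action_def)
        then have "a = act (wom_write a)"
          using nz by (cases a) (auto simp: act_def twin_def split: if_splits)
        moreover have "wom_write a \<in> ?V" using a by (auto simp: actions_def twin_def)
        ultimately show False using a by (metis (mono_tags, lifting) DiffE image_eqI mem_Collect_eq)
      qed
    qed
    also have "\<dots> = (\<Sum>v | v \<in> ?V \<and> apply_action (act v) c = c'. ?f (act v))"
      by (subst sum.reindex) (auto intro: inj_on_subset[OF inj])
    also have "\<dots> = (\<Sum>v\<in>?V. if apply_action (act v) c = c' then ?f (act v) else 0)"
      by (rule sum.inter_filter) simp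
    also have "\<dots> = (\<Sum>v\<in>?V. if apply_action (act v) c = c'
        then complex_of_real (twin_amp ?q ?\<sigma> (state c') \<omega>) * complex_of_real (wom_amp ?q ?\<sigma> v) else 0)"
      by (intro sum.cong) (auto simp: act_def twin_def)
    also have "\<dots> = (if c' = twin_step w \<omega> c (state c') then complex_of_real (twin_amp ?q ?\<sigma> (state c') \<omega>) else 0)"
    proof -
      have None: "apply_action (act None) c = (twin_step w \<omega> c (state c'))\<lparr>wom_tape := wom_tape c\<rparr>"
        using twin_configD(2)[OF c] by (simp add: act_def apply_action_def twin_step_def fun_eq_iff)
      have Some: "apply_action (act (Some g)) c = (twin_step w \<omega> c (state c'))\<lparr>wom_tape := (wom_tape c)(wom_pos c := g)\<rparr>" for g
        using twin_configD(2)[OF c] by (simp add: act_def apply_action_def twin_step_def fun_eq_iff)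
      show ?thesis
      proof (cases "flipping ?q ?\<sigma>")
        case True
        have other: "(wom_tape c)(wom_pos c := 1 - wom_tape c (wom_pos c)) \<noteq> wom_tape c"
          using twin_configD(3)[OF c, of "wom_pos c"] by (auto simp: fun_upd_idem_iff)
        have t: "twin_step w \<omega> c (state c') = apply_action (act (Some (1 - wom_tape c (wom_pos c)))) c"
          using True unfolding Some by (simp add: twin_step_def)
        have e: "apply_action (act (Some (wom_tape c (wom_pos c)))) c = apply_action (act None) c"
          unfolding Some None by simp
        consider "wom_tape c (wom_pos c) = 0" | "wom_tape c (wom_pos c) = 1"
          using twin_configD(3)[OF c, of "wom_pos c"] by argo
        then show ?thesis
        proof cases
          case 1
          then show ?thesis using t e True by (simp add: wom_amp_def eq_commute[of c'])
        next
          case 2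
          then show ?thesis using t e True by (simp add: wom_amp_def eq_commute[of c'])
        qed
      next
        case False
        then have "twin_step w \<omega> c (state c') = apply_action (act None) c"
          unfolding None by (simp add: twin_step_def)
        then show ?thesis using False by (simp add: wom_amp_def eq_commute[of c'])
      qed
    qed
    finally show ?thesis .
  qed
qed

lemma twin_step_in_configs:
  assumes c: "c \<in> configs twin w" and nz: "scan_amp w c q' \<omega> \<noteq> 0"
  shows "twin_step w \<omega> c q' \<in> configs twin w"
proof -
  have "qstep twin w \<omega> (twin_step w \<omega> c q') c \<noteq> 0"
    unfolding qstep_twin[OF c] using nz by (simp add: twin_step_def)
  then show ?thesis using qstep_nonzero_successor successors_subset_configs[OF c] by blast
qed

lemma twin_step_inj:
  assumes c: "c \<in> configs twin w" "d \<in> configs twin w" and q: "state c = state d"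
    and eq: "twin_step w \<omega> c q' = twin_step w \<omega> d q'"
  shows "c = d"
proof -
  have ip: "in_pos c = in_pos d" and wp: "work_pos c = work_pos d"
    using eq by (simp_all add: twin_step_def)
  have sc: "storing (state c) (scanned w (in_pos c)) = storing (state d) (scanned w (in_pos d))"
    "flipping (state c) (scanned w (in_pos c)) = flipping (state d) (scanned w (in_pos d))"
    using ip q by simp_all
  have mp: "wom_pos c = wom_pos d" using arg_cong[OF eq, of wom_pos] sc(1) by (simp add: twin_step_def)
  have "wom_tape c i = wom_tape d i" for i
  proof (cases "flipping (state d) (scanned w (in_pos d)) \<and> i = wom_pos d")
    case True
    have "wom_tape (twin_step w \<omega> c q') i = wom_tape (twin_step w \<omega> d q') i" using eq by simp
    then show ?thesis
      using True sc(2) mp twin_configD(3)[OF c(1), of i] twin_configD(3)[OF c(2), of i] by (auto simp: twin_step_def)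
  next
    case False
    have "wom_tape (twin_step w \<omega> c q') i = wom_tape (twin_step w \<omega> d q') i" using eq by simp
    then show ?thesis using False sc(2) mp by (auto simp: twin_step_def split: if_splits)
  qed
  then have "wom_tape c = wom_tape d" by blast
  then show ?thesis using ip wp q mp twin_configD(2)[OF c(1)] twin_configD(2)[OF c(2)]
    by (cases c; cases d) simp
qed

section \<open>Well-formedness of the comparing machine\<close>

lemma regs_twin: "regs twin = {0, 1, 2, 3, 4}"
  by (auto simp: regs_def twin_def)

text \<open>Under the symbols 3 and 4 no two states merge, so orthogonality holds for each of them
  separately. Merging is confined to the final symbols.\<close>

lemma twin_amp_same_state:
  assumes "\<omega> = 3 \<or> \<omega> = 4" "twin_amp q \<sigma> q' \<omega> \<noteq> 0" "twin_amp p \<sigma> q' \<omega> \<noteq> 0"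
  shows "q = p"
proof -
  have 3: "twin_amp q \<sigma> q' 3 \<noteq> 0 \<Longrightarrow> q = 0 \<and> \<sigma> = Lend \<or> q' = q \<and> \<sigma> \<in> {Sym 0, Sym 1} \<or> q' = q + 2 \<and> \<sigma> = Sym 2" for q
    by (auto simp: twin_amp_def split: if_splits)
  have 4: "twin_amp q \<sigma> q' 4 \<noteq> 0 \<Longrightarrow> q' = q" for q
    by (auto simp: twin_amp_def split: if_splits)
  show ?thesis using assms(1)
  proof
    assume "\<omega> = 3"
    then show ?thesis using 3[of q] 3[of p] assms(2,3) by auto
  next
    assume "\<omega> = 4"
    then show ?thesis using 4[of q] 4[of p] assms(2,3) by auto
  qed
qed

lemma lessThan_6: "{..<6::nat} = {0, 1, 2, 3, 4, 5}"
  by auto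

lemma sum_twin_amp_sq:
  assumes "q < 6"
  shows "(\<Sum>\<omega>\<in>{0, 1, 2, 3, 4}. \<Sum>q'<6. (twin_amp q \<sigma> q' \<omega>)\<^sup>2) = 1"
proof -
  have "q = 0 \<or> q = 1 \<or> q = 2 \<or> q = 3 \<or> q = 4 \<or> q = 5" using assms by linarith
  moreover have "\<sigma> = Lend \<or> \<sigma> = Rend \<or> \<sigma> = Sym 0 \<or> \<sigma> = Sym 1 \<or> \<sigma> = Sym 2 \<or> \<sigma> \<notin> {Lend, Rend, Sym 0, Sym 1, Sym 2}"
    by blast
  ultimately show ?thesis unfolding lessThan_6 by (elim disjE) (simp_all add: twin_amp_def)
qed

text \<open>Only states 3 and 4 merge, and their columns are orthogonal over the three symbols
  together: 3/8 + 1/8 - 1/2 = 0.\<close>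

lemma sum_twin_amp_final:
  assumes "q \<noteq> p"
  shows "(\<Sum>\<omega>\<in>{0, 1, 2}. \<Sum>q'<6. twin_amp q \<sigma> q' \<omega> * twin_amp p \<sigma> q' \<omega>) = 0"
proof (cases "\<sigma> = Rend \<and> q \<in> {3, 4} \<and> p \<in> {3, 4}")
  case True
  then have "q = 3 \<and> p = 4 \<or> q = 4 \<and> p = 3" using assms by auto
  then show ?thesis using True unfolding lessThan_6 by (elim disjE) (simp_all add: twin_amp_def)
next
  case False
  have "\<sigma> = Rend \<and> q \<in> {3, 4}" if "twin_amp q \<sigma> q' \<omega> \<noteq> 0" "\<omega> \<in> {0, 1, 2}" for q q' \<omega>
    using that by (auto simp: twin_amp_def split: if_splits)
  then have "twin_amp q \<sigma> q' \<omega> * twin_amp p \<sigma> q' \<omega> = 0" if "\<omega> \<in> {0, 1, 2}" for \<omega> q'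
    using False that by (metis mult_eq_0_iff)
  then show ?thesis by (intro sum.neutral ballI) auto
qed

lemma well_formed_twin: "well_formed \<Sigma> twin"
  unfolding well_formed_def
proof (intro ballI)
  fix w c d assume c: "c \<in> configs twin w" and d: "d \<in> configs twin w"
  let ?T = "twin_step w" and ?e = "\<lambda>\<omega> q'. if twin_step w \<omega> c q' = twin_step w \<omega> d q' then 1 else (0::real)"
  have inner: "(\<Sum>\<^sub>\<infinity>c'\<in>configs twin w. cnj (qstep twin w \<omega> c' c) * qstep twin w \<omega> c' d)
      = complex_of_real (\<Sum>q'<6. scan_amp w c q' \<omega> * scan_amp w d q' \<omega> * ?e \<omega> q')" for \<omega>
  proof -
    let ?g = "\<lambda>c'. cnj (qstep twin w \<omega> c' c) * qstep twin w \<omega> c' d"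
    let ?Q = "{q' \<in> {..<6}. scan_amp w c q' \<omega> \<noteq> 0}"
    have st: "state (?T \<omega> x q') = q'" for x q' by (simp add: twin_step_def)
    have "infsum ?g (configs twin w) = sum ?g (?T \<omega> c ` ?Q)"
    proof (rule infsum_eq_sum)
      show "?T \<omega> c ` ?Q \<subseteq> configs twin w" using twin_step_in_configs[OF c] by blast
      fix c' assume c': "c' \<in> configs twin w - ?T \<omega> c ` ?Q"
      then have "state c' < 6" using twin_configD(1) by blast
      then have "\<not> (c' = ?T \<omega> c (state c') \<and> scan_amp w c (state c') \<omega> \<noteq> 0)" using c' by blast
      then have "qstep twin w \<omega> c' c = 0" unfolding qstep_twin[OF c] by auto
      then show "?g c' = 0" by simp
    qed simp
    also have "\<dots> = (\<Sum>q'\<in>?Q. ?g (?T \<omega> c q'))"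
    proof (rule sum.reindex_cong[OF _ refl refl], rule inj_onI)
      show "x = y" if "?T \<omega> c x = ?T \<omega> c y" for x y using arg_cong[OF that, of state] st by simp
    qed
    also have "\<dots> = (\<Sum>q'<6. ?g (?T \<omega> c q'))"
      by (rule sum.mono_neutral_left) (auto simp: qstep_twin[OF c] st)
    also have "\<dots> = complex_of_real (\<Sum>q'<6. scan_amp w c q' \<omega> * scan_amp w d q' \<omega> * ?e \<omega> q')"
      unfolding of_real_sum by (intro sum.cong refl) (simp add: qstep_twin[OF c] qstep_twin[OF d] st)
    finally show ?thesis .
  qed
  have "(\<Sum>\<omega>\<in>regs twin. \<Sum>q'<6. scan_amp w c q' \<omega> * scan_amp w d q' \<omega> * ?e \<omega> q') = (if c = d then 1 else 0)"
  proof (cases "c = d")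
    case True
    then show ?thesis
      using sum_twin_amp_sq[OF twin_configD(1)[OF c], of "scanned w (in_pos c)"]
      unfolding regs_twin by (simp add: power2_eq_square)
  next
    case False
    have 1: "scan_amp w c q' \<omega> * scan_amp w d q' \<omega> * ?e \<omega> q' = 0" if \<omega>: "\<omega> = 3 \<or> \<omega> = 4" for \<omega> q'
    proof (rule ccontr)
      assume "\<not> ?thesis"
      then have nz: "scan_amp w c q' \<omega> \<noteq> 0" "scan_amp w d q' \<omega> \<noteq> 0" and eq: "?T \<omega> c q' = ?T \<omega> d q'"
        by (auto split: if_splits)
      have "in_pos c = in_pos d" using eq by (simp add: twin_step_def)
      then have "state c = state d" using twin_amp_same_state[OF \<omega> nz(1)] nz(2) by simp
      then show False using twin_step_inj[OF c d _ eq] False by blast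
    qed
    have 2: "(\<Sum>\<omega>\<in>{0, 1, 2}. \<Sum>q'<6. scan_amp w c q' \<omega> * scan_amp w d q' \<omega> * ?e \<omega> q') = 0"
    \<comment> \<open>For the final symbols, whether the two targets agree depends neither on
      \<omega> nor on the new state, so one pair of values decides for all.\<close>
    proof (cases "?T 0 c 0 = ?T 0 d 0")
      case True
      then have e: "?e \<omega> q' = 1" if "\<omega> \<in> {0, 1, 2}" for \<omega> q'
        using that by (auto simp: twin_step_def)
      have ip: "in_pos c = in_pos d" using True by (simp add: twin_step_def)
      have "state c \<noteq> state d" using twin_step_inj[OF c d _ True] False by blast
      then show ?thesis using sum_twin_amp_final[of "state c" "state d" "scanned w (in_pos d)"] e ip by simp
    next
      case False
      then have "?e \<omega> q' = 0" if "\<omega> \<in> {0, 1, 2}" for \<omega> q'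
        using that by (auto simp: twin_step_def)
      then show ?thesis by simp
    qed
    have "(\<Sum>\<omega>\<in>regs twin. \<Sum>q'<6. scan_amp w c q' \<omega> * scan_amp w d q' \<omega> * ?e \<omega> q')
       = (\<Sum>\<omega>\<in>{0, 1, 2}. \<Sum>q'<6. scan_amp w c q' \<omega> * scan_amp w d q' \<omega> * ?e \<omega> q')
       + (\<Sum>\<omega>\<in>{3, 4}. \<Sum>q'<6. scan_amp w c q' \<omega> * scan_amp w d q' \<omega> * ?e \<omega> q')"
      unfolding regs_twin by simp
    also have "(\<Sum>\<omega>\<in>{3, 4}. \<Sum>q'<6. scan_amp w c q' \<omega> * scan_amp w d q' \<omega> * ?e \<omega> q') = 0"
      by (intro sum.neutral ballI 1) auto
    finally show ?thesis using 2 False by simp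
  qed
  then show "(\<Sum>\<omega>\<in>regs twin. \<Sum>\<^sub>\<infinity>c'\<in>configs twin w.
      cnj (qstep twin w \<omega> c' c) * qstep twin w \<omega> c' d) = (if c = d then 1 else 0)"
    unfolding inner of_real_sum[symmetric] by simp
qed

lemma eff_real_twin_amp: "eff_real (twin_amp q \<sigma> q' \<omega> * wom_amp q \<sigma> v)"
proof -
  have "eff_real (sqrt (3/8))" "eff_real (sqrt (1/8))" "eff_real (sqrt (1/2))"
    using eff_real_sqrt[OF eff_real_eighths[of 3]] eff_real_sqrt[OF eff_real_eighths[of 1]]
      eff_real_sqrt[OF eff_real_eighths[of 4]] by simp_all
  then have "eff_real (twin_amp q \<sigma> q' \<omega>)"
    unfolding twin_amp_def by (simp add: eff_real_0 eff_real_1 eff_real_minus)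
  then show ?thesis using eff_real_minus eff_real_0 by (simp add: wom_amp_def)
qed

lemma wf_qtm_twin: "wf_qtm \<Sigma> twin"
proof -
  have "eff_complex (qtrans twin q \<sigma> g a \<omega>)" for q \<sigma> g a \<omega>
    using eff_complex_of_real[OF eff_real_twin_amp, of q \<sigma> "next_state a" \<omega> "wom_write a"] eff_complex_of_real[OF eff_real_0]
    by (simp add: twin_def)
  moreover have "finite (regs twin)" unfolding regs_twin by simp
  moreover have "acc_regs twin = {0}" "rej_regs twin = {1, 2, 4}" "cont_regs twin = {3}"
    by (simp_all add: twin_def)
  ultimately show ?thesis
    unfolding wf_qtm_def using wf_machine_twin well_formed_twin by simp
qed

section \<open>The state vector while the input is read\<close>

definition part1 :: "nat list \<Rightarrow> nat list" where
  "part1 v = takeWhile (\<lambda>a. a \<noteq> 2) v"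

definition part2 :: "nat list \<Rightarrow> nat list" where
  "part2 v = tl (dropWhile (\<lambda>a. a \<noteq> 2) v)"

definition tape_of :: "nat list \<Rightarrow> int \<Rightarrow> nat" where
  "tape_of u i = (if 0 \<le> i \<and> i < int (length u) then u ! nat i else 0)"

text \<open>The situation after the prefix \<open>v\<close>: the input head is at
  \<open>length v + 1\<close> because the left end-marker is square 0, and the WOM head stands just
  behind the stored word \<open>u\<close>.\<close>

definition branch_config :: "nat \<Rightarrow> nat list \<Rightarrow> nat list \<Rightarrow> config" where
  "branch_config q v u = \<lparr>state = q, in_pos = int (length v) + 1, work_pos = 0, work_tape = (\<lambda>_. 0),
     wom_pos = int (length u), wom_tape = tape_of u\<rparr>"

definition twin1 :: "nat list \<Rightarrow> config" where
  "twin1 v = branch_config (if 2 \<in> set v then 3 else 1) v (part1 v)"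

definition twin2 :: "nat list \<Rightarrow> config" where
  "twin2 v = branch_config (if 2 \<in> set v then 4 else 2) v (part2 v)"

lemma part1_snoc: "part1 (v @ [a]) = (if 2 \<in> set v \<or> a = 2 then part1 v else part1 v @ [a])"
proof (cases "2 \<in> set v")
  case False
  have 1: "part1 (v @ [a]) = v @ takeWhile (\<lambda>a. a \<noteq> 2) [a]"
    unfolding part1_def by (rule takeWhile_append2) (use False in auto)
  have 2: "part1 v = v"
    unfolding part1_def takeWhile_eq_all_conv using False by auto
  show ?thesis using False by (simp add: 1 2)
qed (auto simp: part1_def takeWhile_append)

lemma part2_snoc: "part2 (v @ [a]) = (if 2 \<in> set v then part2 v @ [a] else [])"
proof (cases "2 \<in> set v")
  case True
  then have "dropWhile (\<lambda>a. a \<noteq> 2) v \<noteq> []" by (auto simp: dropWhile_eq_Nil_conv)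
  then have "tl (dropWhile (\<lambda>a. a \<noteq> 2) v @ [a]) = part2 v @ [a]" unfolding part2_def by (rule tl_append2)
  moreover have "dropWhile (\<lambda>a. a \<noteq> 2) (v @ [a]) = dropWhile (\<lambda>a. a \<noteq> 2) v @ [a]"
    by (rule dropWhile_append1[OF True]) simp
  ultimately show ?thesis using True by (simp only: part2_def if_True)
next
  case False
  have "dropWhile (\<lambda>a. a \<noteq> 2) (v @ [a]) = dropWhile (\<lambda>a. a \<noteq> 2) [a]"
    by (rule dropWhile_append2) (use False in auto)
  then show ?thesis using False by (simp only: part2_def) simp
qed

lemma part2_no_sep: "2 \<notin> set v \<Longrightarrow> part2 v = []"
proof -
  assume "2 \<notin> set v"
  then have "dropWhile (\<lambda>a. a \<noteq> 2) v = []" by auto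
  then show "part2 v = []" by (simp only: part2_def list.sel)
qed

lemma tape_of_snoc: "tape_of (u @ [a]) = (tape_of u)(int (length u) := a)"
  by (auto simp: tape_of_def fun_eq_iff nth_append)

lemma tape_of_length: "tape_of u (int (length u)) = 0"
  by (simp add: tape_of_def)

lemma tape_of_eq_iff: "length u = length v \<Longrightarrow> tape_of u = tape_of v \<longleftrightarrow> u = v"
proof
  assume l: "length u = length v" and t: "tape_of u = tape_of v"
  show "u = v"
  proof (rule nth_equalityI[OF l])
    fix i assume "i < length u"
    then show "u ! i = v ! i" using fun_cong[OF t, of "int i"] l by (simp add: tape_of_def)
  qed
qed simp

lemma twin1_neq_twin2: "twin1 v \<noteq> twin2 v"
  by (simp add: twin1_def twin2_def branch_config_def)

lemma scanned_append: "scanned (v @ a # rest) (int (length v) + 1) = Sym a"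
  by (simp add: scanned_def nth_append)

lemma scanned_Rend: "scanned v (int (length v) + 1) = Rend"
  by (simp add: scanned_def)

lemma branch_config_in_configs:
  assumes "q < 6" "length v \<le> length w" "set u \<subseteq> {0, 1}"
  shows "branch_config q v u \<in> configs twin w"
proof -
  have "{i. tape_of u i \<noteq> 0} \<subseteq> {0..<int (length u)}" by (auto simp: tape_of_def)
  then have "finite {i. tape_of u i \<noteq> 0}" using finite_subset by blast
  moreover have "tape_of u i \<in> {0, 1}" for i
  proof (cases "0 \<le> i \<and> i < int (length u)")
    case True
    then have "u ! nat i \<in> set u" by (intro nth_mem) linarith
    then show ?thesis using assms(3) True by (auto simp: tape_of_def)
  qed (auto simp: tape_of_def)
  then have "range (tape_of u) \<subseteq> {0, 1}" unfolding image_subset_iff by (intro ballI)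
  ultimately show ?thesis using assms(1,2) by (simp add: configs_def branch_config_def twin_def)
qed

text \<open>At most one separator: without any, \<open>part2 v\<close> is empty and the condition
  holds as well.\<close>

definition one_sep :: "nat list \<Rightarrow> bool" where
  "one_sep v \<longleftrightarrow> 2 \<notin> set (part2 v)"

lemma twin_in_configs:
  assumes "w = v @ rest" "set w \<subseteq> {0, 1, 2}" "one_sep v"
  shows "twin1 v \<in> configs twin w" "twin2 v \<in> configs twin w"
proof -
  have v: "set v \<subseteq> {0, 1, 2}" using assms(1,2) by auto
  have "set (part1 v) \<subseteq> {0, 1}" unfolding part1_def using v set_takeWhileD by fastforce
  moreover have "set (part2 v) \<subseteq> set v" unfolding part2_def
    by (metis list.set_sel(2) set_dropWhileD subsetI tl_Nil)
  then have "set (part2 v) \<subseteq> {0, 1}" using v assms(3) unfolding one_sep_def by blast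
  ultimately show "twin1 v \<in> configs twin w" "twin2 v \<in> configs twin w"
    unfolding twin1_def twin2_def using assms(1) by (auto intro!: branch_config_in_configs)
qed

lemma twin_step_snoc:
  assumes w: "w = v @ a # rest" and a: "a \<in> {0, 1, 2}" and ok: "one_sep (v @ [a])"
  shows "twin_step w 3 (twin1 v) (state (twin1 (v @ [a]))) = twin1 (v @ [a])"
    "twin_step w 3 (twin2 v) (state (twin2 (v @ [a]))) = twin2 (v @ [a])"
    "scan_amp w (twin1 v) q 3 = (if q = state (twin1 (v @ [a])) then 1 else 0)"
    "scan_amp w (twin2 v) q 3 = (if q = state (twin2 (v @ [a])) then 1 else 0)"
proof -
  have sc: "scanned w (int (length v) + 1) = Sym a" unfolding w by (rule scanned_append)
  have sep: "\<not> (2 \<in> set v \<and> a = 2)" using ok by (auto simp: one_sep_def part2_snoc)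
  have p2: "2 \<notin> set v \<Longrightarrow> part2 v = []" by (rule part2_no_sep)
  have upd: "(tape_of u)(int (length u) := 0) = tape_of u" for u
    using tape_of_length by (simp add: fun_upd_idem_iff)
  note defs = twin1_def twin2_def branch_config_def twin_step_def storing_def flipping_def sc part1_snoc part2_snoc
  have cases: "2 \<in> set v \<and> a = 0 \<or> 2 \<in> set v \<and> a = 1 \<or> 2 \<notin> set v \<and> a = 0 \<or> 2 \<notin> set v \<and> a = 1 \<or> 2 \<notin> set v \<and> a = 2"
    using a sep by auto
  show "twin_step w 3 (twin1 v) (state (twin1 (v @ [a]))) = twin1 (v @ [a])"
    using cases by (elim disjE) (simp_all add: defs tape_of_snoc upd tape_of_length)
  show "twin_step w 3 (twin2 v) (state (twin2 (v @ [a]))) = twin2 (v @ [a])"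
    using cases by (elim disjE) (simp_all add: defs tape_of_snoc upd tape_of_length p2)
  show "scan_amp w (twin1 v) q 3 = (if q = state (twin1 (v @ [a])) then 1 else 0)"
    using cases by (elim disjE) (simp_all add: defs twin_amp_def)
  show "scan_amp w (twin2 v) q 3 = (if q = state (twin2 (v @ [a])) then 1 else 0)"
    using cases by (elim disjE) (simp_all add: defs twin_amp_def)
qed

text \<open>The left end-marker takes a step of its own, hence \<open>Suc\<close>. During the scan
  the two branches are in different states and cannot interfere.\<close>

lemma qvec_twin:
  assumes "w = v @ rest" "set w \<subseteq> {0, 1, 2}" "one_sep v"
  shows "qvec twin w (replicate (Suc (length v)) 3) c
    = (if c = twin1 v \<or> c = twin2 v then complex_of_real (sqrt (1/2)) else 0)"
  using assms
proof (induction v arbitrary: rest c rule: rev_induct)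
  case Nil
  let ?i = "init_config twin"
  have i: "?i \<in> configs twin w" by (rule init_config_in_configs[OF wf_machine_twin])
  have "qvec twin w [3] c = (\<Sum>c'\<in>{?i}. qstep twin w 3 c c' * qvec twin w [] c')"
    by (rule qvec_Cons_eq_sum) (use i in \<open>auto simp: qsupport_def\<close>)
  also have "\<dots> = (if c = twin_step w 3 ?i (state c) then complex_of_real (scan_amp w ?i (state c) 3) else 0)"
    by (simp add: qstep_twin[OF i])
  also have "\<dots> = (if c = twin1 [] \<or> c = twin2 [] then complex_of_real (sqrt (1/2)) else 0)"
  proof -
    have sc: "state ?i = 0" "scanned w (in_pos ?i) = Lend" by (simp_all add: init_config_def twin_def scanned_def)
    have step: "twin_step w 3 ?i q = branch_config q [] []" for q
      using sc by (simp add: twin_step_def branch_config_def init_config_def storing_def flipping_def tape_of_def fun_eq_iff)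
    have tw: "twin1 [] = branch_config 1 [] []" "twin2 [] = branch_config 2 [] []"
      by (simp_all add: twin1_def twin2_def part1_def part2_def)
    have "scan_amp w ?i (state c) 3 = (if state c \<in> {1, 2} then sqrt (1/2) else 0)"
      unfolding sc by (simp add: twin_amp_def)
    moreover have "state (branch_config q [] []) = q" for q by (simp add: branch_config_def)
    ultimately show ?thesis unfolding step tw by auto
  qed
  finally show ?case by simp
next
  case (snoc a v)
  have w: "w = v @ a # rest" using snoc.prems(1) by simp
  have a: "a \<in> {0, 1, 2}" using snoc.prems(2) unfolding w by simp
  have ok: "one_sep v" using snoc.prems(3) by (auto simp: one_sep_def part2_snoc part2_no_sep split: if_splits)
  note IH = snoc.IH[OF w snoc.prems(2) ok]
  note conf = twin_in_configs[OF w snoc.prems(2) ok]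
  note step = twin_step_snoc[OF w a snoc.prems(3)]
  have "qvec twin w (3 # replicate (Suc (length v)) 3) c
     = (\<Sum>c'\<in>{twin1 v, twin2 v}. qstep twin w 3 c c' * qvec twin w (replicate (Suc (length v)) 3) c')"
    by (rule qvec_Cons_eq_sum) (use conf IH in \<open>auto simp: qsupport_def\<close>)
  also have "\<dots> = (qstep twin w 3 c (twin1 v) + qstep twin w 3 c (twin2 v)) * complex_of_real (sqrt (1/2))"
    using twin1_neq_twin2[of v] by (simp only: IH) (simp add: distrib_right)
  also have "qstep twin w 3 c (twin1 v) = (if c = twin1 (v @ [a]) then 1 else 0)"
    unfolding qstep_twin[OF conf(1)] step(3) using step(1) by auto
  also have "qstep twin w 3 c (twin2 v) = (if c = twin2 (v @ [a]) then 1 else 0)"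
    unfolding qstep_twin[OF conf(2)] step(4) using step(2) by auto
  finally show ?case using twin1_neq_twin2[of "v @ [a]"] by auto
qed

text \<open>\<open>z\<close> is the joint contribution of both branches before weighting, where
  interference shows. Their common amplitude \<open>sqrt (1/2)\<close> gives the divisor 2.\<close>

lemma obs_prob_twin:
  assumes w: "w = v @ rest" "set w \<subseteq> {0, 1, 2}" "one_sep v"
    and C: "finite C" "C \<subseteq> configs twin w"
    and z: "\<And>c. c \<in> configs twin w \<Longrightarrow>
      qstep twin w \<omega> c (twin1 v) + qstep twin w \<omega> c (twin2 v) = (if c \<in> C then complex_of_real (z c) else 0)"
  shows "obs_prob twin w (\<omega> # replicate (Suc (length v)) 3) = (\<Sum>c\<in>C. (z c)\<^sup>2 / 2)"
proof -
  note conf = twin_in_configs[OF w]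
  have q: "qvec twin w (\<omega> # replicate (Suc (length v)) 3) c
     = (if c \<in> C then complex_of_real (z c) else 0) * complex_of_real (sqrt (1/2))" if c: "c \<in> configs twin w" for c
  proof -
    have "qvec twin w (\<omega> # replicate (Suc (length v)) 3) c
       = (\<Sum>c'\<in>{twin1 v, twin2 v}. qstep twin w \<omega> c c' * qvec twin w (replicate (Suc (length v)) 3) c')"
      by (rule qvec_Cons_eq_sum) (use conf qvec_twin[OF w] in \<open>auto simp: qsupport_def\<close>)
    also have "\<dots> = (qstep twin w \<omega> c (twin1 v) + qstep twin w \<omega> c (twin2 v)) * complex_of_real (sqrt (1/2))"
      using twin1_neq_twin2[of v] by (simp only: qvec_twin[OF w]) (simp add: distrib_right)
    finally show ?thesis unfolding z[OF c] .
  qed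
  have "obs_prob twin w (\<omega> # replicate (Suc (length v)) 3)
      = (\<Sum>c\<in>C. (cmod (qvec twin w (\<omega> # replicate (Suc (length v)) 3) c))\<^sup>2)"
    by (rule obs_prob_eq_sum[OF C(1) _ C(2)]) (use q in \<open>auto simp: qsupport_def split: if_splits\<close>)
  also have "\<dots> = (\<Sum>c\<in>C. (z c)\<^sup>2 / 2)"
    using q C(2) by (intro sum.cong refl) (auto simp: norm_mult power_mult_distrib)
  finally show ?thesis .
qed

lemma sum_obs_le_qtm_acc_twin:
  assumes "set w \<subseteq> {0, 1, 2}"
  shows "obs_prob twin w (0 # replicate n 3) \<le> qtm_acc twin w"
  using sum_obs_prob_le_qtm_acc[OF wf_qtm_twin, of w "{0,1,2}" "{(0, replicate n 3)}"] assms
  by (auto simp: twin_def in_lists_conv_set)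

lemma sum_obs_le_qtm_rej_twin:
  assumes "set w \<subseteq> {0, 1, 2}" "R \<subseteq> {1, 2, 4}"
  shows "(\<Sum>\<omega>\<in>R. obs_prob twin w (\<omega> # replicate n 3)) \<le> qtm_rej twin w"
proof -
  have fin: "finite R" using assms(2) finite_subset by blast
  have "(\<Sum>\<omega>\<in>R. obs_prob twin w (\<omega> # replicate n 3))
     = (\<Sum>(\<omega>, ws)\<in>R \<times> {replicate n 3}. obs_prob twin w (\<omega> # ws))"
    using fin by (simp add: sum.cartesian_product[symmetric])
  also have "\<dots> \<le> qtm_rej twin w"
    by (rule sum_obs_prob_le_qtm_rej[OF wf_qtm_twin, of w "{0,1,2}"])
       (use assms fin in \<open>auto simp: twin_def in_lists_conv_set\<close>)
  finally show ?thesis .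
qed

text \<open>\<open>v\<close> is what has been read when the defect shows: the input ends without a
  separator, or a second one follows. Both branches then write 4 and stay in distinct
  configurations, so their probabilities 1/2 add up.\<close>

lemma twin_rejects_malformed:
  assumes w: "w = v @ rest" "set w \<subseteq> {0, 1, 2}" "one_sep v"
    and bad: "rest = [] \<and> 2 \<notin> set v \<or> 2 \<in> set v \<and> (\<exists>u. rest = 2 # u)"
  shows "1 \<le> qtm_rej twin w"
proof -
  note conf = twin_in_configs[OF w]
  have sc: "scanned w (int (length v) + 1) = (if rest = [] then Rend else Sym 2)"
    using bad unfolding w by (auto simp: scanned_Rend scanned_append)
  have step: "twin_step w 4 (twin1 v) (state (twin1 v)) = twin1 v" "twin_step w 4 (twin2 v) (state (twin2 v)) = twin2 v"
    using bad sc by (auto simp: twin_step_def twin1_def twin2_def branch_config_def storing_def flipping_def)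
  have amp: "scan_amp w (twin1 v) q 4 = (if q = state (twin1 v) then 1 else 0)"
    "scan_amp w (twin2 v) q 4 = (if q = state (twin2 v) then 1 else 0)" for q
    using bad sc by (auto simp: twin_amp_def twin1_def twin2_def branch_config_def)
  have "obs_prob twin w (4 # replicate (Suc (length v)) 3) = (\<Sum>c\<in>{twin1 v, twin2 v}. 1\<^sup>2 / 2)"
  proof (rule obs_prob_twin[OF w])
    fix c
    have "qstep twin w 4 c (twin1 v) = (if c = twin1 v then 1 else 0)"
      unfolding qstep_twin[OF conf(1)] amp using step(1) by auto
    moreover have "qstep twin w 4 c (twin2 v) = (if c = twin2 v then 1 else 0)"
      unfolding qstep_twin[OF conf(2)] amp using step(2) by auto
    ultimately show "qstep twin w 4 c (twin1 v) + qstep twin w 4 c (twin2 v)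
      = (if c \<in> {twin1 v, twin2 v} then complex_of_real 1 else 0)" using twin1_neq_twin2[of v] by auto
  qed (use conf in auto)
  also have "\<dots> = 1" using twin1_neq_twin2[of v] by simp
  finally show ?thesis using sum_obs_le_qtm_rej_twin[OF w(2), of "{4}" "Suc (length v)"] by simp
qed

text \<open>The two branches interfere in the last step iff they have stored the same word.\<close>

lemma twin_final:
  assumes w: "set w \<subseteq> {0, 1, 2}" "one_sep w" "2 \<in> set w"
  shows "part1 w = part2 w \<Longrightarrow> 3/4 \<le> qtm_acc twin w"
    and "part1 w \<noteq> part2 w \<Longrightarrow> 5/8 \<le> qtm_rej twin w"
proof -
  have w': "w = w @ []" by simp
  note conf = twin_in_configs[OF w' w(1,2)]
  have tw: "twin1 w = branch_config 3 w (part1 w)" "twin2 w = branch_config 4 w (part2 w)"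
    using w(3) by (simp_all add: twin1_def twin2_def)
  define D where "D = branch_config 5 w"
  have step: "twin_step w \<omega> (twin1 w) 5 = D (part1 w)" "twin_step w \<omega> (twin2 w) 5 = D (part2 w)" if "\<omega> \<noteq> 3" for \<omega>
    using that scanned_Rend[of w] by (simp_all add: tw twin_step_def branch_config_def D_def storing_def flipping_def)
  \<comment> \<open>Outcome 2 is the antisymmetric one and cancels for equal words. Outcomes 0 and 1
    share the weight 1/2: if all of it went to acceptance, unequal words would be rejected only with
    probability 1/2. The share 1/8 of the rejecting outcome 1 raises this to 5/8 and lowers
    acceptance of equal words from 1 to 3/4.\<close>
  define e where "e \<omega> = (if \<omega> = 0 then sqrt (3/8) else if \<omega> = 1 then sqrt (1/8) else sqrt (1/2))" for \<omega> :: nat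
  have amp: "scan_amp w (twin1 w) q \<omega> = (if q = 5 then e \<omega> else 0)"
    "scan_amp w (twin2 w) q \<omega> = (if q = 5 then (if \<omega> = 2 then - e \<omega> else e \<omega>) else 0)" if "\<omega> \<in> {0, 1, 2}" for q \<omega>
    using that scanned_Rend[of w] by (auto simp: tw branch_config_def twin_amp_def e_def)
  have st: "state (D u) = 5" for u by (simp add: D_def branch_config_def)
  have q1: "qstep twin w \<omega> c (twin1 w) = (if c = D (part1 w) then complex_of_real (e \<omega>) else 0)"
    and q2: "qstep twin w \<omega> c (twin2 w) = (if c = D (part2 w) then complex_of_real (if \<omega> = 2 then - e \<omega> else e \<omega>) else 0)"
    if \<omega>: "\<omega> \<in> {0, 1, 2}" for c \<omega>
  proof -
    have "\<omega> \<noteq> 3" using \<omega> by auto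
    note s = step[OF this]
    show "qstep twin w \<omega> c (twin1 w) = (if c = D (part1 w) then complex_of_real (e \<omega>) else 0)"
      unfolding qstep_twin[OF conf(1)] amp[OF \<omega>] by (cases "state c = 5") (use s(1) st in auto)
    show "qstep twin w \<omega> c (twin2 w) = (if c = D (part2 w) then complex_of_real (if \<omega> = 2 then - e \<omega> else e \<omega>) else 0)"
      unfolding qstep_twin[OF conf(2)] amp[OF \<omega>] by (cases "state c = 5") (use s(2) st in auto)
  qed
  have inD: "D (part1 w) \<in> configs twin w" "D (part2 w) \<in> configs twin w"
  proof -
    have "scan_amp w (twin1 w) 5 0 \<noteq> 0" "scan_amp w (twin2 w) 5 0 \<noteq> 0" using amp[of 0] by (simp_all add: e_def)
    from twin_step_in_configs[OF conf(1) this(1)] twin_step_in_configs[OF conf(2) this(2)]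
    show "D (part1 w) \<in> configs twin w" "D (part2 w) \<in> configs twin w" using step[of 0] by simp_all
  qed
  {
    assume eq: "part1 w = part2 w"
    have "obs_prob twin w (0 # replicate (Suc (length w)) 3) = (\<Sum>c\<in>{D (part1 w)}. (2 * e 0)\<^sup>2 / 2)"
      by (rule obs_prob_twin[OF w' w(1,2)]) (use inD q1[of 0] q2[of 0] eq in auto)
    also have "\<dots> = 3/4" by (simp add: e_def power_mult_distrib)
    finally show "3/4 \<le> qtm_acc twin w" using sum_obs_le_qtm_acc_twin[OF w(1)] by metis
  }
  {
    assume ne: "part1 w \<noteq> part2 w"
    have neD: "D (part1 w) \<noteq> D (part2 w)"
      using ne tape_of_eq_iff by (auto simp: D_def branch_config_def)
    have "obs_prob twin w (\<omega> # replicate (Suc (length w)) 3)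
       = (\<Sum>c\<in>{D (part1 w), D (part2 w)}. (if c = D (part1 w) then e \<omega> else if \<omega> = 2 then - e \<omega> else e \<omega>)\<^sup>2 / 2)"
      if "\<omega> \<in> {0, 1, 2}" for \<omega>
      by (rule obs_prob_twin[OF w' w(1,2)]) (use inD q1[OF that] q2[OF that] neD in auto)
    then have "obs_prob twin w (\<omega> # replicate (Suc (length w)) 3) = (e \<omega>)\<^sup>2" if "\<omega> \<in> {0, 1, 2}" for \<omega>
      using that neD by simp
    then have "(\<Sum>\<omega>\<in>{1, 2}. obs_prob twin w (\<omega> # replicate (Suc (length w)) 3)) = 5/8"
      by (simp add: e_def)
    then show "5/8 \<le> qtm_rej twin w"
      using sum_obs_le_qtm_rej_twin[OF w(1), of "{1, 2}" "Suc (length w)"] by simp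
  }
qed

section \<open>Bounded error and space of the comparing machine\<close>

lemma twin_words_iff:
  assumes "set w \<subseteq> {0, 1, 2}" "one_sep w" "2 \<in> set w"
  shows "w \<in> twin_words \<longleftrightarrow> part1 w = part2 w"
proof -
  obtain x y where w: "w = x @ 2 # y" "2 \<notin> set x" using split_list_first[OF assms(3)] by blast
  have tw: "takeWhile (\<lambda>a. a \<noteq> 2) (x @ 2 # z) = x" "dropWhile (\<lambda>a. a \<noteq> 2) (x @ 2 # z) = 2 # z" if "2 \<notin> set x" for x z :: "nat list"
    using that by (auto simp: takeWhile_append dropWhile_append)
  have p: "part1 w = x" "part2 w = y" using tw[OF w(2)] by (simp_all add: w part1_def part2_def)
  show ?thesis
  proof
    assume "w \<in> twin_words"
    then obtain u where u: "w = u @ 2 # u" "u \<in> lists {0, 1}" by (auto simp: twin_words_def)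
    have "2 \<notin> set u" using u(2) by auto
    then show "part1 w = part2 w" using tw[of u] by (simp add: u(1) part1_def part2_def)
  next
    assume "part1 w = part2 w"
    moreover have "x \<in> lists {0, 1}" using assms(1) w by (auto simp: in_lists_conv_set)
    ultimately show "w \<in> twin_words" using p w by (auto simp: twin_words_def)
  qed
qed

lemma twin_words_one_sep:
  assumes "w \<in> twin_words"
  shows "one_sep w" "2 \<in> set w" "set w \<subseteq> {0, 1, 2}"
proof -
  obtain x where x: "w = x @ 2 # x" "x \<in> lists {0, 1}" using assms by (auto simp: twin_words_def)
  have "2 \<notin> set x" using x(2) by auto
  then have "part2 w = x" by (simp add: x(1) part2_def dropWhile_append)
  then show "one_sep w" using \<open>2 \<notin> set x\<close> by (simp add: one_sep_def)
  show "2 \<in> set w" "set w \<subseteq> {0, 1, 2}" using x by auto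
qed

lemma bounded_error_twin:
  "bounded_error {0, 1, 2} twin_words (qtm_acc twin) (qtm_rej twin)"
  unfolding bounded_error_def
\<comment> \<open>The error 3/8 belongs to unequal stored words. Members are accepted with
  probability at least 3/4, malformed words rejected with certainty.\<close>
proof (intro exI[of _ "3/8"] conjI ballI impI)
  fix w assume w: "w \<in> lists {0, 1, 2::nat}"
  then have set: "set w \<subseteq> {0, 1, 2}" by auto
  show "1 - 3/8 \<le> qtm_acc twin w" if "w \<in> twin_words"
    using twin_final(1)[OF set] twin_words_one_sep[OF that] twin_words_iff[OF set] that by force
  show "1 - 3/8 \<le> qtm_rej twin w" if nt: "w \<notin> twin_words"
  proof (cases "2 \<in> set w")
    case False
    have "one_sep w" using part2_no_sep[OF False] by (simp add: one_sep_def)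
    then show ?thesis using twin_rejects_malformed[of w w "[]"] False set by simp
  next
    case sep: True
    show ?thesis
    proof (cases "one_sep w")
      case True
      then show ?thesis using twin_final(2)[OF set True sep] twin_words_iff[OF set True sep] nt by simp
    next
      case False
      obtain x y where xy: "w = x @ 2 # y" "2 \<notin> set x" using split_list_first[OF sep] by blast
      have p2: "part2 (x @ 2 # z) = z" for z using xy(2) by (simp add: part2_def dropWhile_append)
      then have "2 \<in> set y" using False by (simp add: xy(1) one_sep_def)
      then obtain y1 y2 where y: "y = y1 @ 2 # y2" "2 \<notin> set y1" using split_list_first by metis
      \<comment> \<open>The scan succeeds up to the second separator, where the machine
        rejects.\<close>
      have "one_sep (x @ 2 # y1)" using p2 y(2) by (simp add: one_sep_def)
      then show ?thesis
        using twin_rejects_malformed[of w "x @ 2 # y1" "2 # y2"] set by (simp add: xy(1) y(1))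
    qed
  qed
qed auto

lemma twin_paths_use_no_squares:
  assumes "cs \<in> qtm_paths twin w"
  shows "squares_used cs = 0"
proof -
  have "successively (\<lambda>c c'. \<exists>\<omega>\<in>regs twin. qstep twin w \<omega> c' c \<noteq> 0) cs" "hd cs = init_config twin" "cs \<noteq> []"
    using assms by (simp_all add: qtm_paths_def)
  then have "\<forall>c\<in>set cs. work_pos c = 0 \<and> work_tape c = (\<lambda>_. 0)"
  proof (induction cs rule: rev_induct)
    case (snoc c cs)
    show ?case
    proof (cases "cs = []")
      case True
      then show ?thesis using snoc.prems by (simp add: init_config_def)
    next
      case False
      then have IH: "\<forall>c\<in>set cs. work_pos c = 0 \<and> work_tape c = (\<lambda>_. 0)"
        using snoc by (auto simp: successively_append_iff)
      obtain \<omega> where step: "qstep twin w \<omega> c (last cs) \<noteq> 0"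
        using snoc.prems(1) False by (auto simp: successively_append_iff)
      let ?S = "{a \<in> actions twin (scanned w (in_pos (last cs))). apply_action a (last cs) = c}"
      obtain a where a: "a \<in> ?S" "qtrans twin (state (last cs)) (scanned w (in_pos (last cs)))
          (work_tape (last cs) (work_pos (last cs))) a \<omega> \<noteq> 0"
        using step sum.neutral unfolding qstep_def Let_def by (metis (mono_tags, lifting))
      then have "work_write a = 0" "work_move a = MStay" "c = apply_action a (last cs)"
        by (auto simp: twin_def split: if_splits)
      then have "work_pos c = 0 \<and> work_tape c = (\<lambda>_. 0)"
        using IH False by (simp add: apply_action_def fun_eq_iff)
      then show ?thesis using IH by simp
    qed
  qed simp
  then show ?thesis by (simp add: squares_used_def)
qed

lemma twin_words_subset: "twin_words \<subseteq> lists {0, 1, 2}"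
  using twin_words_one_sep(3) by (auto simp: in_lists_conv_set)

theorem twin_words_qtm_recognizable: "qtm_wom_recognizable {0, 1, 2} s twin_words"
  unfolding qtm_wom_recognizable_def
  using wf_qtm_twin twin_paths_use_no_squares bounded_error_twin by (intro exI[of _ twin]) simp

section \<open>Condensing a block of a Markov chain\<close>

text \<open>The left block is left only into \<open>E\<close>, and from the right it is entered only
  at \<open>LL\<close>. A starting state inside the left block may be added to \<open>LL\<close>.
  The rewards \<open>r\<close> and \<open>q\<close> stand for the two outcomes.\<close>

locale two_block =
  fixes SL SR E LL :: "'a set" and K :: "'a \<Rightarrow> 'a \<Rightarrow> real" and r q :: "'a \<Rightarrow> real"
  assumes disj: "SL \<inter> SR = {}" and E: "E \<subseteq> SR" and LL: "LL \<subseteq> SL"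
    and chain: "exit_chain (SL \<union> SR) K (\<lambda>c. r c + q c)"
    and nonneg: "\<And>c. c \<in> SL \<union> SR \<Longrightarrow> 0 \<le> r c \<and> 0 \<le> q c"
    and left_right: "\<And>c d. c \<in> SL \<Longrightarrow> d \<in> SR - E \<Longrightarrow> K c d = 0"
    and right_left: "\<And>c d. c \<in> SR \<Longrightarrow> d \<in> SL - LL \<Longrightarrow> K c d = 0"
begin

lemma finite_blocks: "finite SL" "finite SR" "finite E" "finite LL"
  using chain E LL finite_subset by (auto simp: exit_chain_def)

lemma K_nonneg: "c \<in> SL \<union> SR \<Longrightarrow> d \<in> SL \<union> SR \<Longrightarrow> 0 \<le> K c d"
  using chain by (simp add: exit_chain_def)

lemma sum_blocks: "(\<Sum>d\<in>SL \<union> SR. f d) = (\<Sum>d\<in>SL. f d) + (\<Sum>d\<in>SR. f d)" for f :: "'a \<Rightarrow> real"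
  by (rule sum.union_disjoint) (use finite_blocks disj in auto)

lemma sum_right_of_left:
  assumes "c \<in> SL"
  shows "(\<Sum>d\<in>SR. K c d * f d) = (\<Sum>e\<in>E. K c e * f e)"
  by (rule sum.mono_neutral_right) (use finite_blocks E left_right[OF assms] in auto)

lemma chain_left: "exit_chain SL K (\<lambda>c. r c + q c + (\<Sum>e\<in>E. K c e))"
  unfolding exit_chain_def
proof (intro conjI ballI)
  fix c assume c: "c \<in> SL"
  have "(\<Sum>d\<in>SR. K c d) = (\<Sum>e\<in>E. K c e)" using sum_right_of_left[OF c, of "\<lambda>_. 1"] by simp
  moreover have "r c + q c + (\<Sum>d\<in>SL \<union> SR. K c d) \<le> 1" using chain c by (simp add: exit_chain_def)
  ultimately show "r c + q c + (\<Sum>e\<in>E. K c e) + (\<Sum>d\<in>SL. K c d) \<le> 1" by (simp add: sum_blocks)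
  have "0 \<le> (\<Sum>e\<in>E. K c e)" by (rule sum_nonneg) (use K_nonneg c E in auto)
  then show "0 \<le> r c + q c + (\<Sum>e\<in>E. K c e)" using nonneg c by force
qed (use K_nonneg finite_blocks in auto)

lemma exit_chain_mono:
  assumes "exit_chain S K' f" "\<And>c. c \<in> S \<Longrightarrow> 0 \<le> g c \<and> g c \<le> f c"
  shows "exit_chain S K' g"
  using assms unfolding exit_chain_def by (smt (verit))

lemma chain_left_entry:
  assumes "e \<in> E"
  shows "exit_chain SL K (\<lambda>c. K c e)"
proof (rule exit_chain_mono[OF chain_left])
  fix c assume c: "c \<in> SL"
  have "K c e \<le> (\<Sum>e\<in>E. K c e)" by (rule member_le_sum) (use assms K_nonneg c E finite_blocks in auto)
  then show "0 \<le> K c e \<and> K c e \<le> r c + q c + (\<Sum>e\<in>E. K c e)"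
    using K_nonneg[of c e] nonneg[of c] assms c E by force
qed

lemma chain_left_rewards: "exit_chain SL K r" "exit_chain SL K q"
proof -
  have "0 \<le> (\<Sum>e\<in>E. K c e)" if "c \<in> SL" for c by (rule sum_nonneg) (use K_nonneg that E in auto)
  then show "exit_chain SL K r" "exit_chain SL K q"
    by (auto intro!: exit_chain_mono[OF chain_left] simp: add_nonneg_nonneg nonneg)
qed

lemma chain_rewards: "exit_chain (SL \<union> SR) K r" "exit_chain (SL \<union> SR) K q"
  by (rule exit_chain_mono[OF chain]; use nonneg in force)+

definition entry :: "'a \<Rightarrow> 'a \<Rightarrow> real" where
  "entry c e = total_reward SL K (\<lambda>c. K c e) c"

definition row_sum :: "'a \<Rightarrow> real" where
  "row_sum c = total_reward SL K r c + total_reward SL K q c + (\<Sum>e\<in>E. entry c e)"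

text \<open>The left block is replaced by its exit distribution from \<open>LL\<close>, conditioned on leaving it.
  Conditioning only increases the two rewards, and it makes these rows stochastic.  If the block is
  never left, the division by 0 yields 0, and the row is given to the second reward.\<close>

definition KN :: "'a \<Rightarrow> 'a \<Rightarrow> real" where
  "KN c d = (if c \<in> LL then (if d \<in> E then entry c d / row_sum c else 0) else K c d)"

definition rN :: "'a \<Rightarrow> real" where
  "rN c = (if c \<in> LL then total_reward SL K r c / row_sum c else r c)"

definition qN :: "'a \<Rightarrow> real" where
  "qN c = (if c \<in> LL then (if row_sum c = 0 then 1 else total_reward SL K q c / row_sum c) else q c)"

lemma entry_nonneg: "c \<in> SL \<Longrightarrow> e \<in> E \<Longrightarrow> 0 \<le> entry c e"
  unfolding entry_def by (rule total_reward_nonneg[OF chain_left_entry])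

lemma reward_nonneg: "c \<in> SL \<Longrightarrow> 0 \<le> total_reward SL K r c" "c \<in> SL \<Longrightarrow> 0 \<le> total_reward SL K q c"
  using total_reward_nonneg[OF chain_left_rewards(1)] total_reward_nonneg[OF chain_left_rewards(2)] by blast+

lemma row_sum_ge:
  assumes c: "c \<in> SL"
  shows "total_reward SL K r c \<le> row_sum c" "total_reward SL K q c \<le> row_sum c"
    "e \<in> E \<Longrightarrow> entry c e \<le> row_sum c" "0 \<le> row_sum c"
proof -
  have s: "0 \<le> (\<Sum>e\<in>E. entry c e)" by (rule sum_nonneg) (rule entry_nonneg[OF c])
  show "total_reward SL K r c \<le> row_sum c" "total_reward SL K q c \<le> row_sum c" "0 \<le> row_sum c"
    using s reward_nonneg[OF c] unfolding row_sum_def by linarith+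
  assume "e \<in> E"
  then have "entry c e \<le> (\<Sum>e\<in>E. entry c e)"
    by (intro member_le_sum) (use entry_nonneg[OF c] finite_blocks in auto)
  then show "entry c e \<le> row_sum c" using reward_nonneg[OF c] unfolding row_sum_def by linarith
qed

text \<open>Absorption with either outcome and departure into each state of \<open>E\<close> are
  mutually exclusive. Formally, the iteration is linear in the reward, and the combined reward forms
  an \<open>exit_chain\<close>.\<close>

lemma row_sum_le_1:
  assumes c: "c \<in> SL"
  shows "row_sum c \<le> 1"
proof -
  have lin: "reward_upto SL K (\<lambda>c. r c + q c + (\<Sum>e\<in>E. K c e)) t c
      = reward_upto SL K r t c + reward_upto SL K q t c + (\<Sum>e\<in>E. reward_upto SL K (\<lambda>c. K c e) t c)" for t c
  proof (induction t arbitrary: c)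
    case (Suc t)
    have "(\<Sum>d\<in>SL. K c d * (\<Sum>e\<in>E. reward_upto SL K (\<lambda>c. K c e) t d))
      = (\<Sum>e\<in>E. \<Sum>d\<in>SL. K c d * reward_upto SL K (\<lambda>c. K c e) t d)"
      unfolding sum_distrib_left by (rule sum.swap)
    then show ?case by (simp add: Suc distrib_left sum.distrib)
  qed simp
  have "(\<lambda>t. reward_upto SL K r t c + reward_upto SL K q t c + (\<Sum>e\<in>E. reward_upto SL K (\<lambda>c. K c e) t c))
     \<longlonglongrightarrow> row_sum c"
    unfolding row_sum_def entry_def
    by (intro tendsto_add tendsto_sum tendsto_total_reward chain_left_rewards chain_left_entry c)
  moreover have "reward_upto SL K r t c + reward_upto SL K q t c + (\<Sum>e\<in>E. reward_upto SL K (\<lambda>c. K c e) t c) \<le> 1" for t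
    unfolding lin[symmetric] by (rule reward_upto_le_1[OF chain_left c])
  ultimately show ?thesis by (intro LIMSEQ_le_const2) auto
qed

text \<open>Conditioning on an event raises the probability of anything it includes. If the row sum
  is 0, so is \<open>x\<close>, in agreement with division by 0.\<close>

lemma divide_row_sum_ge:
  assumes "c \<in> SL" "0 \<le> x" "x \<le> row_sum c"
  shows "x \<le> x / row_sum c"
proof (cases "row_sum c = 0")
  case False
  then have "0 < row_sum c" using row_sum_ge(4)[OF assms(1)] by simp
  then show ?thesis using row_sum_le_1[OF assms(1)] assms(2) by (simp add: pos_le_divide_eq mult_left_le)
qed (use assms in simp)

lemma sum_KN_left:
  assumes "c \<in> LL"
  shows "(\<Sum>d\<in>LL \<union> SR. KN c d * f d) = (\<Sum>e\<in>E. entry c e / row_sum c * f e)"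
proof -
  have "(\<Sum>d\<in>LL \<union> SR. KN c d * f d) = (\<Sum>e\<in>E. KN c e * f e)"
    by (rule sum.mono_neutral_right) (use finite_blocks E assms in \<open>auto simp: KN_def\<close>)
  then show ?thesis using assms by (simp add: KN_def)
qed

lemma row_KN: "c \<in> LL \<Longrightarrow> rN c + qN c + (\<Sum>d\<in>LL \<union> SR. KN c d) = 1"
proof -
  assume c: "c \<in> LL"
  then have cL: "c \<in> SL" using LL by blast
  have s: "(\<Sum>d\<in>LL \<union> SR. KN c d) = (\<Sum>e\<in>E. entry c e) / row_sum c"
    using sum_KN_left[OF c, of "\<lambda>_. 1"] by (simp add: sum_divide_distrib)
  show ?thesis
  proof (cases "row_sum c = 0")
    case False
    then show ?thesis unfolding s using c
      by (simp add: rN_def qN_def add_divide_distrib[symmetric]) (simp add: row_sum_def)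
  qed (use c s in \<open>simp add: rN_def qN_def\<close>)
qed

lemma sum_T: "(\<Sum>d\<in>LL \<union> SR. f d) = (\<Sum>d\<in>LL. f d) + (\<Sum>d\<in>SR. f d)" for f :: "'a \<Rightarrow> real"
  by (rule sum.union_disjoint) (use finite_blocks disj LL in auto)

lemma chain_N: "exit_chain (LL \<union> SR) KN (\<lambda>c. rN c + qN c)"
  unfolding exit_chain_def
proof (intro conjI ballI)
  show "finite (LL \<union> SR)" using finite_blocks by simp
  fix c assume c: "c \<in> LL \<union> SR"
  show "0 \<le> rN c + qN c"
  proof (cases "c \<in> LL")
    case True
    then have "c \<in> SL" using LL by blast
    then show ?thesis using True row_sum_ge(4) reward_nonneg by (auto simp: rN_def qN_def intro!: add_nonneg_nonneg)
  next
    case False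
    then show ?thesis using c nonneg[of c] by (simp add: rN_def qN_def)
  qed
  show "0 \<le> KN c d" if "d \<in> LL \<union> SR" for d
    using that c K_nonneg[of c d] LL entry_nonneg[of c d] row_sum_ge(4)[of c] by (auto simp: KN_def)
  show "rN c + qN c + (\<Sum>d\<in>LL \<union> SR. KN c d) \<le> 1"
  proof (cases "c \<in> LL")
    case False
    then have cR: "c \<in> SR" using c by blast
    have "(\<Sum>d\<in>LL \<union> SR. K c d) \<le> (\<Sum>d\<in>SL \<union> SR. K c d)"
      by (rule sum_mono2) (use finite_blocks LL K_nonneg c in auto)
    moreover have "r c + q c + (\<Sum>d\<in>SL \<union> SR. K c d) \<le> 1" using chain cR by (simp add: exit_chain_def)
    ultimately show ?thesis using False by (simp add: rN_def qN_def KN_def)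
  qed (simp add: row_KN)
qed

lemma rN_qN_nonneg: "c \<in> LL \<union> SR \<Longrightarrow> 0 \<le> rN c \<and> 0 \<le> qN c"
  using nonneg[of c] LL row_sum_ge(4)[of c] reward_nonneg[of c] by (auto simp: rN_def qN_def)

lemma chain_N_rewards: "exit_chain (LL \<union> SR) KN rN" "exit_chain (LL \<union> SR) KN qN"
  by (rule exit_chain_mono[OF chain_N]; use rN_qN_nonneg in force)+

text \<open>The condensed value is extended to the left block by decomposing at the first exit,
  which gives \<open>gL\<close>. The extension is a supersolution of the full chain; on entering
  \<open>LL\<close> it is at most the condensed value, by the effect of conditioning.\<close>

lemma total_reward_le_condensed:
  assumes \<rho>: "exit_chain (SL \<union> SR) K \<rho>" "exit_chain SL K \<rho>" and \<rho>N: "exit_chain (LL \<union> SR) KN \<rho>N"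
    and right: "\<And>c. c \<in> SR \<Longrightarrow> \<rho>N c = \<rho> c" and left: "\<And>c. c \<in> LL \<Longrightarrow> total_reward SL K \<rho> c \<le> \<rho>N c"
    and l: "l \<in> LL"
  shows "total_reward (SL \<union> SR) K \<rho> l \<le> total_reward (LL \<union> SR) KN \<rho>N l"
proof -
  let ?n = "total_reward (LL \<union> SR) KN \<rho>N" and ?R = "total_reward SL K \<rho>"
  define gL where "gL c = ?R c + (\<Sum>e\<in>E. entry c e * ?n e)" for c
  define g where "g c = (if c \<in> SR then ?n c else gL c)" for c
  have n0: "0 \<le> ?n c" if "c \<in> LL \<union> SR" for c using total_reward_nonneg[OF \<rho>N that] .
  have gL0: "0 \<le> gL c" if "c \<in> SL" for c
    unfolding gL_def using total_reward_nonneg[OF \<rho>(2) that] entry_nonneg[OF that] n0 E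
    by (intro add_nonneg_nonneg sum_nonneg mult_nonneg_nonneg) auto
  have gn: "gL c \<le> ?n c" if c: "c \<in> LL" for c
  proof -
    have cL: "c \<in> SL" using c LL by blast
    have "(\<Sum>e\<in>E. entry c e * ?n e) \<le> (\<Sum>e\<in>E. entry c e / row_sum c * ?n e)"
      using divide_row_sum_ge[OF cL entry_nonneg[OF cL] row_sum_ge(3)[OF cL]] n0 E
      by (intro sum_mono mult_right_mono) auto
    also have "\<dots> = (\<Sum>d\<in>LL \<union> SR. KN c d * ?n d)" using sum_KN_left[OF c] by simp
    also have "\<rho>N c + \<dots> = ?n c" using total_reward_fixpoint[OF \<rho>N, of c] c by simp
    finally show ?thesis unfolding gL_def using left[OF c] by linarith
  qed
  have "total_reward (SL \<union> SR) K \<rho> l \<le> g l"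
  proof (rule total_reward_le_supersolution[OF \<rho>(1)])
    show "l \<in> SL \<union> SR" using l LL by blast
    fix c assume c: "c \<in> SL \<union> SR"
    show "0 \<le> g c" using c n0 gL0 by (auto simp: g_def)
    have gsplit: "(\<Sum>d\<in>SL \<union> SR. K c d * g d) = (\<Sum>d\<in>SL. K c d * gL d) + (\<Sum>d\<in>SR. K c d * ?n d)"
      unfolding sum_blocks using disj by (intro arg_cong2[where f = "(+)"] sum.cong) (auto simp: g_def)
    show "\<rho> c + (\<Sum>d\<in>SL \<union> SR. K c d * g d) \<le> g c"
    proof (cases "c \<in> SR")
      case True
      have "(\<Sum>d\<in>SL. K c d * gL d) = (\<Sum>d\<in>LL. K c d * gL d)"
        by (rule sum.mono_neutral_right) (use finite_blocks LL right_left[OF True] in auto)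
      also have "\<dots> \<le> (\<Sum>d\<in>LL. K c d * ?n d)"
        using gn K_nonneg c LL by (intro sum_mono mult_left_mono) auto
      finally have "\<rho> c + (\<Sum>d\<in>SL \<union> SR. K c d * g d) \<le> \<rho>N c + (\<Sum>d\<in>LL \<union> SR. K c d * ?n d)"
        unfolding gsplit sum_T right[OF True] by linarith
      also have "(\<Sum>d\<in>LL \<union> SR. K c d * ?n d) = (\<Sum>d\<in>LL \<union> SR. KN c d * ?n d)"
        using True disj LL by (intro sum.cong) (auto simp: KN_def)
      also have "\<rho>N c + \<dots> = ?n c" using total_reward_fixpoint[OF \<rho>N, of c] True by simp
      finally show ?thesis using True by (simp add: g_def)
    next
      case False
      then have cL: "c \<in> SL" using c by blast
      have "(\<Sum>e\<in>E. entry c e * ?n e) = (\<Sum>e\<in>E. (K c e + (\<Sum>d\<in>SL. K c d * entry d e)) * ?n e)"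
        using total_reward_fixpoint[OF chain_left_entry cL] unfolding entry_def by (intro sum.cong refl) simp
      also have "\<dots> = (\<Sum>e\<in>E. K c e * ?n e) + (\<Sum>e\<in>E. \<Sum>d\<in>SL. K c d * (entry d e * ?n e))"
        by (simp add: distrib_right sum.distrib sum_distrib_right mult.assoc)
      also have "(\<Sum>e\<in>E. \<Sum>d\<in>SL. K c d * (entry d e * ?n e)) = (\<Sum>d\<in>SL. K c d * (\<Sum>e\<in>E. entry d e * ?n e))"
        unfolding sum_distrib_left by (rule sum.swap)
      finally have X: "(\<Sum>e\<in>E. entry c e * ?n e) = (\<Sum>e\<in>E. K c e * ?n e) + (\<Sum>d\<in>SL. K c d * (\<Sum>e\<in>E. entry d e * ?n e))" .
      have R: "?R c = \<rho> c + (\<Sum>d\<in>SL. K c d * ?R d)" by (rule total_reward_fixpoint[OF \<rho>(2) cL])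
      have "\<rho> c + (\<Sum>d\<in>SL \<union> SR. K c d * g d) = gL c"
        unfolding gsplit sum_right_of_left[OF cL] gL_def[of c] X
        by (subst R) (simp add: gL_def distrib_left sum.distrib)
      then show ?thesis using False by (simp add: g_def)
    qed
  qed
  also have "g l \<le> ?n l" using l LL disj gn by (auto simp: g_def)
  finally show ?thesis .
qed

lemma total_reward_le_rN: "l \<in> LL \<Longrightarrow> total_reward (SL \<union> SR) K r l \<le> total_reward (LL \<union> SR) KN rN l"
  by (rule total_reward_le_condensed[OF chain_rewards(1) chain_left_rewards(1) chain_N_rewards(1)])
     (use disj LL in \<open>auto simp: rN_def intro!: divide_row_sum_ge reward_nonneg row_sum_ge\<close>)

lemma total_reward_le_qN: "l \<in> LL \<Longrightarrow> total_reward (SL \<union> SR) K q l \<le> total_reward (LL \<union> SR) KN qN l"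
  by (rule total_reward_le_condensed[OF chain_rewards(2) chain_left_rewards(2) chain_N_rewards(2)])
     (use disj LL row_sum_ge(2) in \<open>force simp: qN_def intro!: divide_row_sum_ge reward_nonneg row_sum_ge\<close>)+

end

text \<open>Numerator and denominator cost a factor \<open>t\<close> each. A vanishing
  \<open>s'\<close> forces \<open>a'\<close> and then \<open>a\<close> to vanish, so division by 0
  does no harm.\<close>

lemma divide_le_square_divide:
  fixes a :: real
  assumes "0 \<le> a" "0 \<le> a'" "0 \<le> s" "0 \<le> s'" "1 \<le> t" "a \<le> t * a'" "s' \<le> t * s" "a' \<le> s'"
  shows "a / s \<le> t ^ 2 * a' / s'"
proof (cases "s = 0")
  case True
  then show ?thesis using assms by simp
next
  case False
  then have s: "0 < s" using assms by simp
  show ?thesis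
  proof (cases "s' = 0")
    case True
    then show ?thesis using assms by simp
  next
    case False
    then have s': "0 < s'" using assms by simp
    have "a * s' \<le> (t * a') * (t * s)" using assms by (intro mult_mono) auto
    then show ?thesis using s s' by (simp add: field_simps power2_eq_square)
  qed
qed

text \<open>The condensed chains differ only in the rows of \<open>LL\<close>, and there by factors
  up to \<open>t ^ 2\<close> owing to the division by the row sums. Exchanging one row costs the
  square of this. The two outcomes are compared crosswise because condensing bounds both rewards
  from above.\<close>

theorem two_block_perturbation:
  assumes 1: "two_block SL SR E LL K r q" and 2: "two_block SL SR E LL K' r q"
    and same: "\<And>c d. c \<in> SR \<Longrightarrow> d \<in> SL \<union> SR \<Longrightarrow> K c d = K' c d"
    and t: "1 \<le> t"
    and entry: "\<And>l e. l \<in> LL \<Longrightarrow> e \<in> E \<Longrightarrow>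
      total_reward SL K (\<lambda>c. K c e) l \<le> t * total_reward SL K' (\<lambda>c. K' c e) l \<and>
      total_reward SL K' (\<lambda>c. K' c e) l \<le> t * total_reward SL K (\<lambda>c. K c e) l"
    and rew: "\<And>l. l \<in> LL \<Longrightarrow> total_reward SL K r l \<le> t * total_reward SL K' r l \<and> total_reward SL K' r l \<le> t * total_reward SL K r l"
      "\<And>l. l \<in> LL \<Longrightarrow> total_reward SL K q l \<le> t * total_reward SL K' q l \<and> total_reward SL K' q l \<le> t * total_reward SL K q l"
    and l: "l \<in> LL"
  shows "total_reward (SL \<union> SR) K r l \<le> t ^ (4 * card LL) * (1 - total_reward (SL \<union> SR) K' q l)"
proof -
  interpret A: two_block SL SR E LL K r q by fact
  interpret B: two_block SL SR E LL K' r q by fact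
  have sum1: "A.row_sum l \<le> t * B.row_sum l" and sum2: "B.row_sum l \<le> t * A.row_sum l" if l: "l \<in> LL" for l
  proof -
    have "(\<Sum>e\<in>E. A.entry l e) \<le> (\<Sum>e\<in>E. t * B.entry l e)" "(\<Sum>e\<in>E. B.entry l e) \<le> (\<Sum>e\<in>E. t * A.entry l e)"
      using entry[OF l] unfolding A.entry_def B.entry_def by (auto intro!: sum_mono)
    then show "A.row_sum l \<le> t * B.row_sum l" "B.row_sum l \<le> t * A.row_sum l"
      using rew[OF l] unfolding A.row_sum_def B.row_sum_def by (simp_all add: distrib_left sum_distrib_left)
  qed
  \<comment> \<open>Hence both chains apply the convention for blocks that are never left to the
    same rows.\<close>
  have zero: "A.row_sum l = 0 \<longleftrightarrow> B.row_sum l = 0" if "l \<in> LL" for l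
    using sum1[OF that] sum2[OF that] A.row_sum_ge(4)[of l] B.row_sum_ge(4)[of l] that A.LL by auto
  have t2: "1 \<le> t ^ 2" using t by simp
  have LS: "l \<in> SL" if "l \<in> LL" for l using that A.LL by blast
  have "total_reward (SL \<union> SR) K r l \<le> total_reward (LL \<union> SR) A.KN A.rN l" by (rule A.total_reward_le_rN[OF l])
  also have "\<dots> \<le> (t ^ 2) ^ (2 * card LL) * total_reward (LL \<union> SR) B.KN B.rN l"
  proof (rule total_reward_perturb_rows[OF A.chain_N_rewards(1) B.chain_N_rewards(1) _ t2, where q = A.qN and q' = B.qN])
    show "l \<in> LL \<union> SR" "LL \<subseteq> LL \<union> SR" using l by auto
    show "A.rN c = B.rN c" if "c \<in> (LL \<union> SR) - LL" for c using that by (simp add: A.rN_def B.rN_def)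
    show "A.KN c d = B.KN c d" if "c \<in> (LL \<union> SR) - LL" "d \<in> LL \<union> SR" for c d
      using that same[of c d] A.LL by (auto simp: A.KN_def B.KN_def)
    fix c assume c: "c \<in> LL"
    show "A.rN c + A.qN c + (\<Sum>d\<in>LL \<union> SR. A.KN c d) = 1" by (rule A.row_KN[OF c])
    show "B.rN c + B.qN c + (\<Sum>d\<in>LL \<union> SR. B.KN c d) = 1" by (rule B.row_KN[OF c])
    note facts = A.reward_nonneg[OF LS[OF c]] B.reward_nonneg[OF LS[OF c]] A.row_sum_ge[OF LS[OF c]] B.row_sum_ge[OF LS[OF c]]
      t rew[OF c] sum1[OF c] sum2[OF c]
    show "A.rN c \<le> t\<^sup>2 * B.rN c" "B.rN c \<le> t\<^sup>2 * A.rN c"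
      using c facts unfolding A.rN_def B.rN_def by (auto intro!: divide_le_square_divide)
    show "B.qN c \<le> t\<^sup>2 * A.qN c"
      using c facts zero[OF c] t2 unfolding A.qN_def B.qN_def by (auto intro!: divide_le_square_divide)
    fix d assume d: "d \<in> LL \<union> SR"
    show "A.KN c d \<le> t\<^sup>2 * B.KN c d" "B.KN c d \<le> t\<^sup>2 * A.KN c d"
      using c facts A.entry_nonneg[OF LS[OF c], of d] B.entry_nonneg[OF LS[OF c], of d] entry[OF c, of d]
      unfolding A.KN_def B.KN_def A.entry_def[symmetric] B.entry_def[symmetric]
      by (auto intro!: divide_le_square_divide)
  qed
  also have "(t ^ 2) ^ (2 * card LL) = t ^ (4 * card LL)" by (simp flip: power_mult)
  also have "t ^ (4 * card LL) * total_reward (LL \<union> SR) B.KN B.rN l \<le> t ^ (4 * card LL) * (1 - total_reward (SL \<union> SR) K' q l)"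
  proof (rule mult_left_mono)
    have "total_reward (LL \<union> SR) B.KN B.rN l + total_reward (LL \<union> SR) B.KN B.qN l \<le> 1"
      by (rule total_reward_add_le_1[OF B.chain_N B.rN_qN_nonneg]) (use l in auto)
    then show "total_reward (LL \<union> SR) B.KN B.rN l \<le> 1 - total_reward (SL \<union> SR) K' q l"
      using B.total_reward_le_qN[OF l] by linarith
    show "0 \<le> t ^ (4 * card LL)" using t by simp
  qed
  finally show ?thesis .
qed

section \<open>Probabilistic machines in small space\<close>

definition between :: "int \<Rightarrow> int set" where
  "between i = {min 0 i..max 0 i}"

lemma card_between: "card (between i) = nat \<bar>i\<bar> + 1"
  by (auto simp: between_def)

lemma pstep_apply:
  assumes "c' \<in> set_pmf (pstep M w c)"
  shows "c' = c \<or> (\<exists>a. c' = apply_action a c)"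
  using assms by (auto simp: pstep_def split: if_splits)

lemma shift_abs_le_1: "\<bar>shift m\<bar> \<le> 1"
  by (cases m) simp_all

text \<open>The work head moves by at most one square, so it has visited everything between the
  start and its position, and only visited squares can be nonblank. A bound on the number of squares
  thus confines positions and tape content.\<close>

lemma path_visits:
  assumes "cs \<in> ptm_paths M w"
  shows "(\<forall>c\<in>set cs. between (work_pos c) \<subseteq> work_pos ` set cs)
    \<and> (\<forall>j. work_tape (last cs) j \<noteq> 0 \<longrightarrow> j \<in> work_pos ` set cs)"
proof -
  have "cs \<noteq> []" "hd cs = init_config M" "successively (\<lambda>c c'. c' \<in> set_pmf (pstep M w c)) cs"
    using assms by (simp_all add: ptm_paths_def)
  then show ?thesis
  proof (induction cs rule: rev_induct)
    case (snoc c cs)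
    show ?case
    proof (cases "cs = []")
      case True
      then show ?thesis using snoc.prems by (auto simp: init_config_def between_def)
    next
      case False
      have IH: "\<And>d. d \<in> set cs \<Longrightarrow> between (work_pos d) \<subseteq> work_pos ` set cs"
        "\<And>j. work_tape (last cs) j \<noteq> 0 \<Longrightarrow> j \<in> work_pos ` set cs"
        using snoc False by (auto simp: successively_append_iff)
      have "c \<in> set_pmf (pstep M w (last cs))"
        using snoc.prems False by (auto simp: successively_append_iff)
      then consider "c = last cs" | a where "c = apply_action a (last cs)" using pstep_apply by blast
      then show ?thesis
      proof cases
        case 1
        then have "set (cs @ [c]) = set cs" using False by auto
        then show ?thesis using IH 1 by simp
      next
        case (2 a)
        have last: "last cs \<in> set cs" using False by simp
        have "\<bar>work_pos c - work_pos (last cs)\<bar> \<le> 1" using 2 shift_abs_le_1 by (simp add: apply_action_def)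
        then have "between (work_pos c) \<subseteq> insert (work_pos c) (between (work_pos (last cs)))"
          unfolding between_def by auto
        then have "between (work_pos c) \<subseteq> work_pos ` set (cs @ [c])" using IH(1)[OF last] by auto
        moreover have "j \<in> work_pos ` set (cs @ [c])" if "work_tape c j \<noteq> 0" for j
        proof (cases "j = work_pos (last cs)")
          case True
          then show ?thesis using last by auto
        next
          case False
          then have "work_tape (last cs) j \<noteq> 0" using that 2 by (simp add: apply_action_def)
          then show ?thesis using IH(2) by auto
        qed
        ultimately show ?thesis using IH(1) by auto
      qed
    qed
  qed simp
qed

lemma path_stays_within_space:
  assumes cs: "cs \<in> ptm_paths M w" and sp: "squares_used cs \<le> B"
  shows "\<bar>work_pos (last cs)\<bar> \<le> int B" "work_tape (last cs) j \<noteq> 0 \<Longrightarrow> \<bar>j\<bar> \<le> int B"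
proof -
  have last: "last cs \<in> set cs" using cs by (simp add: ptm_paths_def)
  have bound: "\<bar>work_pos c\<bar> \<le> int B" if c: "c \<in> set cs" for c
  proof (cases "\<forall>c\<in>set cs. work_pos c = 0 \<and> work_tape c = (\<lambda>_. 0)")
    case True
    then show ?thesis using c by simp
  next
    case False
    then have "squares_used cs = card (work_pos ` set cs)" unfolding squares_used_def by (rule if_not_P)
    moreover have "card (between (work_pos c)) \<le> card (work_pos ` set cs)"
      by (rule card_mono) (use path_visits[OF cs] c in auto)
    ultimately show ?thesis using sp by (simp add: card_between)
  qed
  show "\<bar>work_pos (last cs)\<bar> \<le> int B" by (rule bound[OF last])
  assume "work_tape (last cs) j \<noteq> 0"
  then obtain c where "c \<in> set cs" "j = work_pos c" using path_visits[OF cs] by blast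
  then show "\<bar>j\<bar> \<le> int B" using bound by blast
qed

section \<open>The machine as an absorbing chain on finitely many configurations\<close>

context ptm_simulation
begin

text \<open>Transitions up to the WOM. Halting configurations get a zero row instead of a self-loop,
  since their mass is counted by \<open>reward_at\<close>.\<close>

definition kern :: "nat list \<Rightarrow> config \<Rightarrow> config \<Rightarrow> real" where
  "kern w c d = (if halted M c then 0
     else pmf (map_pmf (\<lambda>a. core (apply_action a c)) (choice M w c)) d)"

definition cells :: "int set \<Rightarrow> nat \<Rightarrow> config set" where
  "cells I B = {c. state c \<in> states M \<and> in_pos c \<in> I \<and> \<bar>work_pos c\<bar> \<le> int B \<and> range (work_tape c) \<subseteq> work_alph M
     \<and> (\<forall>j. work_tape c j \<noteq> 0 \<longrightarrow> \<bar>j\<bar> \<le> int B) \<and> wom_pos c = 0 \<and> wom_tape c = (\<lambda>_. 0)}"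

text \<open>The count for one input square: \<open>2 * B + 1\<close> is both the number of head
  positions and the number of squares that may be nonblank.\<close>

definition cell_bound :: "nat \<Rightarrow> nat" where
  "cell_bound B = card (states M) * (2 * B + 1) * card (work_alph M) ^ (2 * B + 1)"

lemma card_cells:
  assumes "finite I"
  shows "finite (cells I B)" "card (cells I B) \<le> card I * cell_bound B"
proof -
  let ?J = "{- int B..int B}"
  let ?f = "\<lambda>c. (in_pos c, state c, work_pos c, restrict (work_tape c) ?J)"
  let ?A = "I \<times> states M \<times> ?J \<times> PiE ?J (\<lambda>_. work_alph M)"
  have inj: "inj_on ?f (cells I B)"
  proof (rule inj_onI)
    fix c d assume c: "c \<in> cells I B" "d \<in> cells I B" and eq: "?f c = ?f d"
    have "work_tape c j = work_tape d j" for j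
    proof (cases "j \<in> ?J")
      case True
      have "restrict (work_tape c) ?J = restrict (work_tape d) ?J" using eq by (simp only: prod.inject)
      from fun_cong[OF this, of j] show ?thesis using True by simp
    next
      case False
      then have "\<not> \<bar>j\<bar> \<le> int B" by auto
      moreover have "work_tape x j \<noteq> 0 \<longrightarrow> \<bar>j\<bar> \<le> int B" if "x \<in> cells I B" for x
        using that unfolding cells_def by simp
      ultimately show ?thesis using c by simp
    qed
    then have "work_tape c = work_tape d" by blast
    then show "c = d" using eq c by (cases c; cases d) (simp add: cells_def)
  qed
  have sub: "?f ` cells I B \<subseteq> ?A" by (auto simp: cells_def image_subset_iff)
  have fin: "finite ?A" using assms wf_machine_M by (auto simp: wf_machine_def intro!: finite_PiE)
  show "finite (cells I B)" by (rule finite_imageD[OF finite_subset[OF sub fin] inj])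
  have "card (cells I B) \<le> card ?A" by (rule card_inj_on_le[OF inj sub fin])
  also have "\<dots> = card I * cell_bound B"
  proof -
    have J: "card ?J = 2 * B + 1" by simp
    have "card (PiE ?J (\<lambda>_. work_alph M)) = card (work_alph M) ^ (2 * B + 1)"
      by (subst card_PiE) (simp_all only: finite_atLeastAtMost_int prod_constant J)
    then show ?thesis unfolding card_cartesian_product J cell_bound_def by (simp only: mult.assoc)
  qed
  finally show "card (cells I B) \<le> card I * cell_bound B" .
qed

lemma cells_Un: "cells (I \<union> J) B = cells I B \<union> cells J B"
  by (auto simp: cells_def)

lemma init_in_cells: "0 \<in> I \<Longrightarrow> init_config M \<in> cells I B"
  using wf_machine_M by (auto simp: cells_def init_config_def wf_machine_def)

lemma kern_nonneg: "0 \<le> kern w c d"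
  by (simp add: kern_def)

lemma kern_nonzero:
  assumes "kern w c d \<noteq> 0"
  shows "\<not> halted M c \<and>
    (\<exists>a\<in>set_pmf (choice M w c). d = core (apply_action a c))"
proof -
  have run: "\<not> halted M c" using assms by (auto simp: kern_def)
  then have "d \<in> set_pmf (map_pmf (\<lambda>a. core (apply_action a c)) (choice M w c))"
    using assms unfolding kern_def set_pmf_iff by simp
  then show ?thesis using run by auto
qed

lemma kern_in_pos:
  assumes "kern w c d \<noteq> 0"
  shows "\<bar>in_pos d - in_pos c\<bar> \<le> 1"
proof -
  obtain a where "d = core (apply_action a c)" using kern_nonzero[OF assms] by blast
  then show ?thesis using shift_abs_le_1 by (simp add: apply_action_def)
qed

lemma kern_cong: "scanned w (in_pos c) = scanned w' (in_pos c) \<Longrightarrow> kern w c d = kern w' c d"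
  by (simp add: kern_def)

definition reward_at :: "nat \<Rightarrow> config \<Rightarrow> real" where
  "reward_at h c = (if state c = h then 1 else 0)"

lemma exit_chain_kern:
  assumes "finite I"
  shows "exit_chain (cells I B) (kern w) (\<lambda>c. reward_at (acc_state M) c + reward_at (rej_state M) c)"
  unfolding exit_chain_def
proof (intro conjI ballI)
  show fin: "finite (cells I B)" by (rule card_cells[OF assms])
  fix c
  have neq: "acc_state M \<noteq> rej_state M" using wf by (simp add: wf_ptm_def)
  show "reward_at (acc_state M) c + reward_at (rej_state M) c + (\<Sum>d\<in>cells I B. kern w c d) \<le> 1"
  proof (cases "halted M c")
    case True
    then show ?thesis using neq by (auto simp: kern_def reward_at_def)
  next
    case False
    then have "(\<Sum>d\<in>cells I B. kern w c d) \<le> 1"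
      unfolding kern_def by (simp add: measure_measure_pmf_finite[OF fin, symmetric])
    then show ?thesis using False by (simp add: reward_at_def)
  qed
qed (auto simp: reward_at_def kern_nonneg)

text \<open>The inserted 1 keeps the minimum meaningful if there are no branches, and guarantees
  that the rewards, being 0 or 1, obey the same gap.\<close>

definition min_prob :: real where
  "min_prob = Min (insert 1 ((\<lambda>(q, \<sigma>, g, b). pmf (ptrans M q \<sigma> g) b) ` branches))"

lemma min_prob: "0 < min_prob" "min_prob \<le> 1"
  "(q, \<sigma>, g, b) \<in> branches \<Longrightarrow> min_prob \<le> pmf (ptrans M q \<sigma> g) b"
proof -
  let ?P = "insert 1 ((\<lambda>(q, \<sigma>, g, b). pmf (ptrans M q \<sigma> g) b) ` branches)"
  have fin: "finite ?P" using finite_branches by simp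
  have "\<forall>x\<in>?P. 0 < x" by (auto simp: branches_def pmf_positive)
  then show "0 < min_prob" unfolding min_prob_def using fin by (subst Min_gr_iff) auto
  show "min_prob \<le> 1" unfolding min_prob_def using fin by (intro Min_le) auto
  assume "(q, \<sigma>, g, b) \<in> branches"
  then show "min_prob \<le> pmf (ptrans M q \<sigma> g) b" unfolding min_prob_def using fin by (intro Min_le) force+
qed

text \<open>Several actions may merge into one transition up to the WOM. This only adds to the
  probability of a single branch.\<close>

lemma kern_gap:
  assumes w: "w \<in> lists \<Sigma>" and c: "c \<in> cells I B"
  shows "kern w c d = 0 \<or> min_prob \<le> kern w c d"
proof (rule disjCI)
  assume nz: "\<not> min_prob \<le> kern w c d"
  show "kern w c d = 0"
  proof (rule ccontr)
    let ?p = "choice M w c"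
    assume "kern w c d \<noteq> 0"
    then obtain a where run: "\<not> halted M c" and a: "a \<in> set_pmf ?p" "d = core (apply_action a c)"
      using kern_nonzero by blast
    have "(state c, scanned w (in_pos c), work_tape c (work_pos c), a) \<in> branches"
      using run a(1) c scanned_in_in_syms[OF w] by (auto simp: branches_def cells_def)
    then have "min_prob \<le> pmf ?p a" by (rule min_prob(3))
    also have "\<dots> = measure_pmf.prob ?p {a}" by (simp add: measure_pmf_single)
    also have "\<dots> \<le> measure_pmf.prob ?p ((\<lambda>a. core (apply_action a c)) -` {d})"
      by (rule measure_pmf.finite_measure_mono) (use a(2) in auto)
    also have "\<dots> = kern w c d" using run by (simp add: kern_def pmf_map)
    finally show False using nz by simp
  qed
qed

definition reachable :: "nat list \<Rightarrow> config \<Rightarrow> bool" where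
  "reachable w c \<longleftrightarrow> (\<exists>cs\<in>ptm_paths M w. last cs = c)"

lemma reachable_init: "reachable w (init_config M)"
  unfolding reachable_def by (rule bexI[of _ "[init_config M]"]) (simp_all add: ptm_paths_def)

lemma reachable_step:
  assumes "reachable w c" "c' \<in> set_pmf (pstep M w c)"
  shows "reachable w c'"
proof -
  obtain cs where cs: "cs \<in> ptm_paths M w" "last cs = c" using assms(1) by (auto simp: reachable_def)
  then have "cs @ [c'] \<in> ptm_paths M w"
    using assms(2) by (auto simp: ptm_paths_def successively_append_iff)
  then show ?thesis unfolding reachable_def by (intro bexI[of _ "cs @ [c']"]) simp_all
qed

lemma reachable_in_configs:
  assumes w: "w \<in> lists \<Sigma>" and c: "reachable w c"
  shows "c \<in> configs M w"
proof -
  obtain cs where cs: "cs \<in> ptm_paths M w" "last cs = c" using c by (auto simp: reachable_def)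
  have "cs \<noteq> []" "hd cs = init_config M" "successively (\<lambda>c c'. c' \<in> set_pmf (pstep M w c)) cs"
    using cs(1) by (simp_all add: ptm_paths_def)
  then have "last cs \<in> configs M w"
  proof (induction cs rule: rev_induct)
    case (snoc c cs)
    show ?case
    proof (cases "cs = []")
      case True
      then show ?thesis using snoc.prems init_config_in_configs[OF wf_machine_M] by simp
    next
      case False
      have IH: "last cs \<in> configs M w" and step: "c \<in> set_pmf (pstep M w (last cs))"
        using snoc False by (auto simp: successively_append_iff)
      show ?thesis
      proof (cases "halted M (last cs)")
        case True
        then show ?thesis using step IH by (auto simp: pstep_def)
      next
        case False
        then obtain a where a: "c = apply_action a (last cs)"
          "a \<in> set_pmf (ptrans M (state (last cs)) (scanned w (in_pos (last cs))) (work_tape (last cs) (work_pos (last cs))))"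
          using step unfolding pstep_def by (subst (asm) if_not_P) auto
        show ?thesis
          using a ptrans_actions[OF config_scan(1)[OF w IH] False config_scan(2,3)[OF w IH] a(2)]
            apply_action_in_configs[OF IH] by simp
      qed
    qed
  qed simp
  then show ?thesis using cs(2) by simp
qed

lemma reachable_core_in_cells:
  assumes w: "w \<in> lists \<Sigma>" and sp: "\<And>cs. cs \<in> ptm_paths M w \<Longrightarrow> squares_used cs \<le> B" and c: "reachable w c"
  shows "core c \<in> cells {0..int (length w) + 1} B"
proof -
  obtain cs where cs: "cs \<in> ptm_paths M w" "last cs = c" using c by (auto simp: reachable_def)
  have "\<bar>work_pos c\<bar> \<le> int B" "\<forall>j. work_tape c j \<noteq> 0 \<longrightarrow> \<bar>j\<bar> \<le> int B"
    using path_stays_within_space[OF cs(1) sp[OF cs(1)]] cs(2) by blast+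
  moreover have "wom_pos (core c) = 0" "wom_tape (core c) = (\<lambda>_. 0)" by (simp_all add: core_def)
  ultimately show ?thesis
    using reachable_in_configs[OF w c] by (auto simp: cells_def configs_def)
qed

text \<open>The space bound keeps all reachable configurations inside the cells, so the restricted
  sum loses nothing. \<open>Suc t\<close> is needed because collecting the reward at the last
  configuration takes an iteration of its own.\<close>

lemma hit_le_reward_upto:
  assumes w: "w \<in> lists \<Sigma>" and sp: "\<And>cs. cs \<in> ptm_paths M w \<Longrightarrow> squares_used cs \<le> B" and c: "reachable w c"
    and h: "h \<in> {acc_state M, rej_state M}"
  shows "hit M w h t c \<le> reward_upto (cells {0..int (length w) + 1} B) (kern w) (reward_at h) (Suc t) (core c)"
  using c
proof (induction t arbitrary: c)
  case 0
  then show ?case by (simp add: hit_0 reward_at_def)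
next
  case (Suc t)
  let ?S = "cells {0..int (length w) + 1} B"
  let ?p = "choice M w c"
  have fin: "finite ?S" by (rule card_cells) simp
  show ?case
  proof (cases "halted M c")
    case True
    then show ?thesis by (simp add: hit_halted reward_at_def kern_def)
  next
    case False
    let ?\<mu> = "map_pmf (\<lambda>a. core (apply_action a c)) ?p"
    have kern: "kern w (core c) d = pmf ?\<mu> d" for d
    proof -
      have "(\<lambda>a. core (apply_action a (core c))) = (\<lambda>a. core (apply_action a c))"
        using core_apply_action_cong[of "core c" c] by simp
      then show ?thesis using False by (simp add: kern_def)
    qed
    have succ: "apply_action a c \<in> set_pmf (pstep M w c)" if "a \<in> set_pmf ?p" for a
      using that False by (auto simp: pstep_def)
    have sub: "set_pmf ?\<mu> \<subseteq> ?S"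
      using reachable_core_in_cells[OF w sp reachable_step[OF Suc.prems succ]] by auto
    have "hit M w h (Suc t) c = (LINT a|measure_pmf ?p. hit M w h t (apply_action a c))"
      unfolding hit_Suc pstep_def using False by (subst if_not_P) auto
    also have "\<dots> = (LINT d|measure_pmf ?\<mu>. hit M w h t d)"
      using hit_core_cong[of "core (apply_action _ c)" "apply_action _ c" M w h t] by simp
    also have "\<dots> = (\<Sum>d\<in>?S. hit M w h t d * pmf ?\<mu> d)"
      by (rule integral_measure_pmf_real[OF fin]) (use sub in auto)
    also have "\<dots> \<le> (\<Sum>d\<in>?S. kern w (core c) d * reward_upto ?S (kern w) (reward_at h) (Suc t) d)"
    proof (rule sum_mono)
      fix d assume "d \<in> ?S"
      show "hit M w h t d * pmf ?\<mu> d \<le> kern w (core c) d * reward_upto ?S (kern w) (reward_at h) (Suc t) d"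
      proof (cases "d \<in> set_pmf ?\<mu>")
        case True
        then obtain a where a: "a \<in> set_pmf ?p" "d = core (apply_action a c)" by auto
        have "hit M w h t d = hit M w h t (apply_action a c)" unfolding a(2) by (rule hit_core_cong) simp
        also have "\<dots> \<le> reward_upto ?S (kern w) (reward_at h) (Suc t) d"
          unfolding a(2) by (rule Suc.IH[OF reachable_step[OF Suc.prems succ[OF a(1)]]])
        finally have "hit M w h t d * pmf ?\<mu> d \<le> reward_upto ?S (kern w) (reward_at h) (Suc t) d * pmf ?\<mu> d"
          by (rule mult_right_mono) simp
        then show ?thesis unfolding kern by (simp only: mult.commute)
      next
        case False
        then have "pmf ?\<mu> d = 0" unfolding set_pmf_iff by blast
        then show ?thesis unfolding kern by (simp only: mult_zero_left mult_zero_right order.refl)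
      qed
    qed
    also have "\<dots> \<le> reward_upto ?S (kern w) (reward_at h) (Suc (Suc t)) (core c)"
      by (simp add: reward_at_def)
    finally show ?thesis .
  qed
qed

lemma chain_reward_at:
  assumes "finite I"
  shows "exit_chain (cells I B) (kern w) (reward_at (acc_state M))" "exit_chain (cells I B) (kern w) (reward_at (rej_state M))"
proof -
  have "0 \<le> reward_at h c" for h c by (simp add: reward_at_def)
  then show "exit_chain (cells I B) (kern w) (reward_at (acc_state M))" "exit_chain (cells I B) (kern w) (reward_at (rej_state M))"
    using exit_chain_kern[OF assms, of B w] unfolding exit_chain_def by (smt (verit))+
qed

lemma ptm_prob_le_total_reward:
  assumes w: "w \<in> lists \<Sigma>" and sp: "\<And>cs. cs \<in> ptm_paths M w \<Longrightarrow> squares_used cs \<le> B"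
  defines "S \<equiv> cells {0..int (length w) + 1} B"
  shows "ptm_acc M w \<le> total_reward S (kern w) (reward_at (acc_state M)) (init_config M)"
    "ptm_rej M w \<le> total_reward S (kern w) (reward_at (rej_state M)) (init_config M)"
proof -
  have init: "init_config M \<in> S" "core (init_config M) = init_config M"
    unfolding S_def using init_in_cells by (auto simp: core_def init_config_def)
  have "hit M w h t (init_config M) \<le> total_reward S (kern w) (reward_at h) (init_config M)"
    if h: "h \<in> {acc_state M, rej_state M}" for h t
  proof -
    have "exit_chain S (kern w) (reward_at h)" using h chain_reward_at unfolding S_def by auto
    from reward_upto_le_total_reward[OF this init(1), of "Suc t"] show ?thesis
      using hit_le_reward_upto[OF w sp reachable_init h, of t] unfolding S_def[symmetric] init(2) by linarith
  qed
  then show "ptm_acc M w \<le> total_reward S (kern w) (reward_at (acc_state M)) (init_config M)"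
    "ptm_rej M w \<le> total_reward S (kern w) (reward_at (rej_state M)) (init_config M)"
    unfolding ptm_acc_eq ptm_rej_eq by (auto intro!: cSUP_least)
qed

text \<open>The input head moves by at most one square, so the blocks communicate only between
  squares \<open>m\<close> and \<open>m + 1\<close>. The initial configuration joins the entry
  states as the place where the chain is evaluated.\<close>

lemma two_block_kern:
  assumes "m \<le> n"
  shows "two_block (cells {0..int m} B) (cells {int m + 1..int n + 1} B) (cells {int m + 1} B)
    (insert (init_config M) (cells {int m} B)) (kern w) (reward_at (acc_state M)) (reward_at (rej_state M))"
proof
  have un: "{0..int m} \<union> {int m + 1..int n + 1} = {0..int n + 1}" using assms by auto
  show "exit_chain (cells {0..int m} B \<union> cells {int m + 1..int n + 1} B) (kern w)
      (\<lambda>c. reward_at (acc_state M) c + reward_at (rej_state M) c)"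
    unfolding cells_Un[symmetric] by (rule exit_chain_kern) simp
  show "insert (init_config M) (cells {int m} B) \<subseteq> cells {0..int m} B"
    using init_in_cells[of "{0..int m}" B] by (auto simp: cells_def)
  show "kern w c d = 0" if "c \<in> cells {0..int m} B" "d \<in> cells {int m + 1..int n + 1} B - cells {int m + 1} B" for c d
    by (rule ccontr, drule kern_in_pos) (use that in \<open>auto simp: cells_def\<close>)
  show "kern w c d = 0" if "c \<in> cells {int m + 1..int n + 1} B"
    "d \<in> cells {0..int m} B - insert (init_config M) (cells {int m} B)" for c d
    by (rule ccontr, drule kern_in_pos) (use that in \<open>auto simp: cells_def\<close>)
qed (use assms in \<open>auto simp: cells_def reward_at_def\<close>)

end

text \<open>Class 0 is reserved for the value 0, which no factor relates to a positive number. The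
  other classes are intervals of length \<delta> on the logarithmic scale.\<close>

definition log_class :: "real \<Rightarrow> real \<Rightarrow> nat" where
  "log_class \<delta> v = (if v = 0 then 0 else nat \<lfloor>- ln v / \<delta>\<rfloor> + 1)"

lemma log_class_le:
  assumes "0 < \<delta>" "v = 0 \<or> P \<le> v" "0 < P"
  shows "log_class \<delta> v \<le> nat \<lfloor>- ln P / \<delta>\<rfloor> + 1"
proof (cases "v = 0")
  case False
  then have "P \<le> v" "0 < v" using assms by auto
  then have "- ln v / \<delta> \<le> - ln P / \<delta>" using assms by (intro divide_right_mono) auto
  then show ?thesis using False by (simp add: log_class_def nat_mono floor_mono)
qed (simp add: log_class_def)

lemma log_class_eq_imp_close:
  assumes \<delta>: "0 < \<delta>" and v: "0 \<le> v" "v \<le> 1" "0 \<le> v'" "v' \<le> 1" and eq: "log_class \<delta> v = log_class \<delta> v'"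
  shows "v \<le> exp \<delta> * v'"
proof (cases "v = 0")
  case True
  then show ?thesis using v by simp
next
  case False
  then have pos: "0 < v" "0 < v'" and fl: "nat \<lfloor>- ln v / \<delta>\<rfloor> = nat \<lfloor>- ln v' / \<delta>\<rfloor>"
    using eq v by (auto simp: log_class_def split: if_splits)
  have "0 \<le> - ln v / \<delta>" "0 \<le> - ln v' / \<delta>" using v pos \<delta> by (auto simp: divide_nonpos_pos)
  then have "\<lfloor>- ln v / \<delta>\<rfloor> = \<lfloor>- ln v' / \<delta>\<rfloor>" using fl by (metis eq_nat_nat_iff zero_le_floor)
  then have "- ln v' / \<delta> < - ln v / \<delta> + 1" by linarith
  then have "ln v < \<delta> + ln v'" using \<delta> by (simp add: field_simps)
  then have "exp (ln v) < exp (\<delta> + ln v')" by simp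
  then show ?thesis using pos by (simp add: exp_add)
qed

lemma scanned_left: "i \<le> int (length x) \<Longrightarrow> scanned (x @ y) i = scanned (x @ z) i"
proof -
  assume "i \<le> int (length x)"
  then have "nat (i - 1) < length x" if "0 < i" using that by linarith
  then show ?thesis using \<open>i \<le> int (length x)\<close> by (auto simp: scanned_def nth_append)
qed

lemma scanned_right: "length x = length x' \<Longrightarrow> int (length x) < i \<Longrightarrow> scanned (x @ y) i = scanned (x' @ y) i"
proof -
  assume l: "length x = length x'" "int (length x) < i"
  then have "\<not> nat (i - 1) < length x" by linarith
  then show ?thesis using l by (simp add: scanned_def nth_append)
qed

section \<open>Pigeonhole on the tables of exit probabilities\<close>

context ptm_simulation
begin

text \<open>A table has at most \<open>cell_bound B + 1\<close> rows, each with at most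
  \<open>cell_bound B\<close> exits and two rewards; every entry falls into one of the classes 0 to
  \<open>N + 1\<close>. Two words with the same table make x2x accepted at most
  \<open>exp \<delta> ^ (4 * card LL)\<close> times as likely as x'2x escapes rejection, against the
  choice of \<delta>.\<close>

lemma no_small_space:
  assumes \<Sigma>: "{0, 1, 2} \<subseteq> \<Sigma>"
    and space: "\<And>w cs. w \<in> lists \<Sigma> \<Longrightarrow> length w = 2 * m + 1 \<Longrightarrow> cs \<in> ptm_paths M w \<Longrightarrow> squares_used cs \<le> B"
    and acc: "\<And>x. x \<in> lists {0, 1} \<Longrightarrow> 1 - \<epsilon> \<le> ptm_acc M (x @ 2 # x)"
    and rej: "\<And>x y. x \<in> lists {0, 1} \<Longrightarrow> y \<in> lists {0, 1} \<Longrightarrow> x \<noteq> y \<Longrightarrow> 1 - \<epsilon> \<le> ptm_rej M (x @ 2 # y)"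
    and \<delta>: "0 < \<delta>" "exp (4 * \<delta> * real (cell_bound B + 1)) * \<epsilon> < 1 - \<epsilon>" and \<epsilon>: "0 \<le> \<epsilon>"
  defines "N \<equiv> nat \<lfloor>real (m + 1) * real (cell_bound B) * - ln min_prob / \<delta>\<rfloor>"
  shows "2 ^ m \<le> (N + 2) ^ ((cell_bound B + 1) * (cell_bound B + 2))"
proof (rule ccontr)
  assume big: "\<not> ?thesis"
  define SL where "SL = cells {0..int m} B"
  define SR where "SR = cells {int m + 1..int (2 * m + 1) + 1} B"
  define E where "E = cells {int m + 1} B"
  define LL where "LL = insert (init_config M) (cells {int m} B)"
  define word where "word x y = (x @ 2 # y :: nat list)" for x y
  let ?ra = "reward_at (acc_state M)" and ?rr = "reward_at (rej_state M)"
  define W where "W = {x. set x \<subseteq> {0, 1::nat} \<and> length x = m}"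
  have W: "x \<in> lists {0, 1}" "length (word x y) = 2 * m + 1" "word x y \<in> lists \<Sigma>" if "x \<in> W" "y \<in> W" for x y
    using that \<Sigma> by (auto simp: W_def word_def in_lists_conv_set)
  have tb: "two_block SL SR E LL (kern w) ?ra ?rr" for w
    unfolding SL_def SR_def E_def LL_def by (rule two_block_kern) simp
  have fin: "finite SL" "finite E" "finite LL" unfolding SL_def E_def LL_def by (auto intro: card_cells)
  have LLsub: "LL \<subseteq> SL" and Esub: "E \<subseteq> SR" using tb by (auto simp: two_block_def)
  have cards: "card SL \<le> (m + 1) * cell_bound B" "card E \<le> cell_bound B" "card LL \<le> cell_bound B + 1"
  proof -
    show "card SL \<le> (m + 1) * cell_bound B" using card_cells(2)[of "{0..int m}" B] by (simp add: SL_def nat_add_distrib)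
    show "card E \<le> cell_bound B" using card_cells(2)[of "{int m + 1}" B] by (simp add: E_def)
    have "card LL \<le> card (cells {int m} B) + 1" unfolding LL_def using card_cells(1)[of "{int m}" B] by (simp add: card_insert_if)
    then show "card LL \<le> cell_bound B + 1" using card_cells(2)[of "{int m}" B] by simp
  qed
  \<comment> \<open>The right part is chosen as \<open>x\<close> merely to have some word. Left rows
    of the kernel do not depend on it, which is what \<open>K'_left\<close> exploits for the mixed
    word.\<close>
  define vE where "vE x l e = total_reward SL (kern (word x x)) (\<lambda>c. kern (word x x) c e) l" for x l e
  define vA where "vA x l = total_reward SL (kern (word x x)) ?ra l" for x l
  define vR where "vR x l = total_reward SL (kern (word x x)) ?rr l" for x l
  define P where "P = min_prob ^ card SL"
  have P: "0 < P" using min_prob(1) by (simp add: P_def)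
  have gap: "total_reward SL (kern w) f l = 0 \<or> P \<le> total_reward SL (kern w) f l"
    and unit: "0 \<le> total_reward SL (kern w) f l" "total_reward SL (kern w) f l \<le> 1"
    if "w \<in> lists \<Sigma>" "l \<in> SL" "exit_chain SL (kern w) f" "\<And>c. c \<in> SL \<Longrightarrow> f c = 0 \<or> min_prob \<le> f c" for w f l
  proof -
    show "total_reward SL (kern w) f l = 0 \<or> P \<le> total_reward SL (kern w) f l"
      unfolding P_def
      by (rule total_reward_gap[OF that(3,2) min_prob(1,2) that(4)])
         (use kern_gap[OF that(1)] in \<open>unfold SL_def, blast\<close>)
    show "0 \<le> total_reward SL (kern w) f l" by (rule total_reward_nonneg[OF that(3,2)])
    show "total_reward SL (kern w) f l \<le> 1" by (rule total_reward_le_1[OF that(3,2)])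
  qed
  have chE: "exit_chain SL (kern w) (\<lambda>c. kern w c e)" if "e \<in> E" for w e
    by (rule two_block.chain_left_entry[OF tb that])
  have chR: "exit_chain SL (kern w) ?ra" "exit_chain SL (kern w) ?rr" for w
    by (rule two_block.chain_left_rewards[OF tb])+
  have rew_gap: "reward_at h c = 0 \<or> min_prob \<le> reward_at h c" for h c
    using min_prob(2) by (simp add: reward_at_def)
  have gapE: "vE x l e = 0 \<or> P \<le> vE x l e" "0 \<le> vE x l e" "vE x l e \<le> 1" if "x \<in> W" "l \<in> LL" "e \<in> E" for x l e
    using gap[OF W(3)[OF that(1,1)] _ chE[OF that(3)]] unit[OF W(3)[OF that(1,1)] _ chE[OF that(3)]]
      kern_gap[OF W(3)[OF that(1,1)]] that LLsub unfolding vE_def SL_def by blast+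
  have gapA: "vA x l = 0 \<or> P \<le> vA x l" "0 \<le> vA x l" "vA x l \<le> 1" if "x \<in> W" "l \<in> LL" for x l
    using gap[OF W(3)[OF that(1,1)] _ chR(1) rew_gap] unit[OF W(3)[OF that(1,1)] _ chR(1) rew_gap] that LLsub
    unfolding vA_def by blast+
  have gapR: "vR x l = 0 \<or> P \<le> vR x l" "0 \<le> vR x l" "vR x l \<le> 1" if "x \<in> W" "l \<in> LL" for x l
    using gap[OF W(3)[OF that(1,1)] _ chR(2) rew_gap] unit[OF W(3)[OF that(1,1)] _ chR(2) rew_gap] that LLsub
    unfolding vR_def by blast+
  have NP: "nat \<lfloor>- ln P / \<delta>\<rfloor> + 1 \<le> N + 1"
  proof -
    have "- ln P = real (card SL) * - ln min_prob" using min_prob(1) by (simp add: P_def ln_realpow)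
    also have "\<dots> \<le> real ((m + 1) * cell_bound B) * - ln min_prob"
      using cards(1) min_prob(1,2) by (intro mult_right_mono) (simp_all only: of_nat_le_iff neg_0_le_iff_le ln_le_zero_iff)
    also have "\<dots> = real (m + 1) * real (cell_bound B) * - ln min_prob" by (simp only: of_nat_mult)
    finally have "- ln P / \<delta> \<le> real (m + 1) * real (cell_bound B) * - ln min_prob / \<delta>"
      by (rule divide_right_mono) (use \<delta>(1) in simp)
    then show ?thesis unfolding N_def by (simp add: nat_mono floor_mono)
  qed
  define prof where "prof x = (\<lambda>l\<in>LL. (\<lambda>e\<in>E. log_class \<delta> (vE x l e), log_class \<delta> (vA x l), log_class \<delta> (vR x l)))" for x
  have range: "prof ` W \<subseteq> PiE LL (\<lambda>_. PiE E (\<lambda>_. {..N + 1}) \<times> {..N + 1} \<times> {..N + 1})"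
  proof -
    have "log_class \<delta> v \<le> N + 1" if "v = 0 \<or> P \<le> v" for v
      using log_class_le[OF \<delta>(1) that P] NP by linarith
    then show ?thesis using gapE(1) gapA(1) gapR(1) by (auto simp: prof_def intro!: PiE_I)
  qed
  have "card (prof ` W) \<le> card (PiE LL (\<lambda>_. PiE E (\<lambda>_. {..N + 1}) \<times> {..N + 1} \<times> {..N + 1}))"
    by (rule card_mono[OF _ range]) (use fin in \<open>auto intro!: finite_PiE\<close>)
  also have "\<dots> = (N + 2) ^ ((card E + 2) * card LL)"
  proof -
    have c: "card {..N + 1} = N + 2" by simp
    show ?thesis
      using fin by (simp only: card_PiE card_cartesian_product prod_constant c power_mult power_add power2_eq_square)
  qed
  also have "\<dots> \<le> (N + 2) ^ ((cell_bound B + 1) * (cell_bound B + 2))"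
    using mult_le_mono[of "card E + 2" "cell_bound B + 2" "card LL" "cell_bound B + 1"] cards(2,3)
    by (intro power_increasing) (auto simp: mult.commute)
  also have "\<dots> < 2 ^ m" using big by simp
  also have "(2::nat) ^ m = card W" using card_lists_length_eq[of "{0, 1::nat}" m] by (simp add: W_def numeral_2_eq_2)
  finally have "\<not> inj_on prof W" by (rule pigeonhole)
  then obtain x x' where x: "x \<in> W" "x' \<in> W" "x \<noteq> x'" "prof x = prof x'" by (auto simp: inj_on_def)
  have same: "log_class \<delta> (vE x l e) = log_class \<delta> (vE x' l e)" "log_class \<delta> (vA x l) = log_class \<delta> (vA x' l)"
    "log_class \<delta> (vR x l) = log_class \<delta> (vR x' l)" if "l \<in> LL" "e \<in> E" for l e
  proof -
    have p: "(\<lambda>e\<in>E. log_class \<delta> (vE x l e), log_class \<delta> (vA x l), log_class \<delta> (vR x l))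
       = (\<lambda>e\<in>E. log_class \<delta> (vE x' l e), log_class \<delta> (vA x' l), log_class \<delta> (vR x' l))"
      using fun_cong[OF x(4), of l] that(1) by (simp add: prof_def)
    then show "log_class \<delta> (vA x l) = log_class \<delta> (vA x' l)" "log_class \<delta> (vR x l) = log_class \<delta> (vR x' l)" by simp_all
    have "(\<lambda>e\<in>E. log_class \<delta> (vE x l e)) = (\<lambda>e\<in>E. log_class \<delta> (vE x' l e))" using p by simp
    from fun_cong[OF this, of e] show "log_class \<delta> (vE x l e) = log_class \<delta> (vE x' l e)" using that(2) by simp
  qed
  have init: "init_config M \<in> LL" by (simp add: LL_def)
  have SU: "SL \<union> SR = cells {0..int (2 * m + 1) + 1} B"
    unfolding SL_def SR_def cells_Un[symmetric] by (rule arg_cong[of _ _ "\<lambda>I. cells I B"]) auto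
  let ?K = "kern (word x x)" and ?K' = "kern (word x' x)"
  have K'_left: "?K' c d = kern (word x' x') c d" if "c \<in> SL" for c d
    unfolding word_def by (rule kern_cong, rule scanned_left) (use that x(2) in \<open>auto simp: SL_def cells_def W_def\<close>)
  have tr': "total_reward SL ?K' f l = total_reward SL (kern (word x' x')) f' l" if "\<And>c. c \<in> SL \<Longrightarrow> f c = f' c" "l \<in> LL" for f f' l
    by (rule total_reward_cong) (use that K'_left LLsub in auto)
  \<comment> \<open>\<open>same\<close> speaks about pairs of \<open>l\<close> and \<open>e\<close>.
    Applying it to the rewards requires some \<open>e\<close>.\<close>
  have E_ne: "\<exists>e. e \<in> E"
  proof -
    have "(init_config M)\<lparr>in_pos := int m + 1\<rparr> \<in> E"
      using wf_machine_M by (auto simp: E_def cells_def init_config_def wf_machine_def)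
    then show ?thesis by blast
  qed
  have e1: "1 \<le> exp \<delta>" using \<delta>(1) by simp
  have "1 - \<epsilon> \<le> ptm_acc M (word x x)" using acc W(1)[OF x(1,1)] by (simp add: word_def)
  also have "\<dots> \<le> total_reward (SL \<union> SR) ?K ?ra (init_config M)"
    using ptm_prob_le_total_reward(1)[OF W(3)[OF x(1,1)] space[OF W(3)[OF x(1,1)] W(2)[OF x(1,1)]]]
    unfolding SU W(2)[OF x(1,1)] by simp
  also have "\<dots> \<le> exp \<delta> ^ (4 * card LL) * (1 - total_reward (SL \<union> SR) ?K' ?rr (init_config M))"
  proof (rule two_block_perturbation[OF tb tb _ e1 _ _ _ init])
    show "?K c d = ?K' c d" if "c \<in> SR" "d \<in> SL \<union> SR" for c d
      unfolding word_def by (rule kern_cong, rule scanned_right) (use that x(1,2) in \<open>auto simp: SR_def cells_def W_def\<close>)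
    fix l assume l: "l \<in> LL"
    obtain e0 where e0: "e0 \<in> E" using E_ne by blast
    show "total_reward SL ?K ?ra l \<le> exp \<delta> * total_reward SL ?K' ?ra l \<and> total_reward SL ?K' ?ra l \<le> exp \<delta> * total_reward SL ?K ?ra l"
      unfolding tr'[OF refl l] using log_class_eq_imp_close[OF \<delta>(1)] gapA(2,3)[OF x(1) l] gapA(2,3)[OF x(2) l] same(2)[OF l e0]
      unfolding vA_def by metis
    show "total_reward SL ?K ?rr l \<le> exp \<delta> * total_reward SL ?K' ?rr l \<and> total_reward SL ?K' ?rr l \<le> exp \<delta> * total_reward SL ?K ?rr l"
      unfolding tr'[OF refl l] using log_class_eq_imp_close[OF \<delta>(1)] gapR(2,3)[OF x(1) l] gapR(2,3)[OF x(2) l] same(3)[OF l e0]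
      unfolding vR_def by metis
    fix e assume e: "e \<in> E"
    have tE: "total_reward SL ?K' (\<lambda>c. ?K' c e) l = vE x' l e" unfolding vE_def by (rule tr'[OF K'_left l])
    show "total_reward SL ?K (\<lambda>c. ?K c e) l \<le> exp \<delta> * total_reward SL ?K' (\<lambda>c. ?K' c e) l \<and>
      total_reward SL ?K' (\<lambda>c. ?K' c e) l \<le> exp \<delta> * total_reward SL ?K (\<lambda>c. ?K c e) l"
      unfolding tE using log_class_eq_imp_close[OF \<delta>(1)] gapE(2,3)[OF x(1) l e] gapE(2,3)[OF x(2) l e] same(1)[OF l e]
      unfolding vE_def[of x] by metis
  qed
  also have "\<dots> \<le> exp \<delta> ^ (4 * card LL) * \<epsilon>"
  proof (rule mult_left_mono)
    have "1 - \<epsilon> \<le> ptm_rej M (word x' x)"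
      using rej[OF W(1)[OF x(2,2)] W(1)[OF x(1,1)]] x(3) by (auto simp: word_def)
    also have "\<dots> \<le> total_reward (SL \<union> SR) ?K' ?rr (init_config M)"
      using ptm_prob_le_total_reward(2)[OF W(3)[OF x(2,1)] space[OF W(3)[OF x(2,1)] W(2)[OF x(2,1)]]]
      unfolding SU W(2)[OF x(2,1)] by simp
    finally show "1 - total_reward (SL \<union> SR) ?K' ?rr (init_config M) \<le> \<epsilon>" by linarith
  qed simp
  also have "\<dots> \<le> exp (4 * \<delta> * real (cell_bound B + 1)) * \<epsilon>"
  proof (rule mult_right_mono[OF _ \<epsilon>])
    have "exp \<delta> ^ (4 * card LL) = exp (real (4 * card LL) * \<delta>)" by (rule exp_of_nat_mult[symmetric])
    also have "\<dots> \<le> exp (4 * \<delta> * real (cell_bound B + 1))"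
    proof -
      have "real (card LL) * \<delta> \<le> real (cell_bound B + 1) * \<delta>"
        using cards(3) \<delta>(1) by (intro mult_right_mono) (simp_all only: of_nat_le_iff)
      then show ?thesis by (simp add: algebra_simps)
    qed
    finally show "exp \<delta> ^ (4 * card LL) \<le> exp (4 * \<delta> * real (cell_bound B + 1))" .
  qed
  finally show False using \<delta>(2) by linarith
qed

end

text \<open>The left side has order m^(1/4) log m, because the bound on the configurations enters
  squared. Any exponent below 1/2 in place of 1/8 would give sublinear growth.\<close>

lemma eventually_polynomial_in_root_below_linear:
  fixes K C :: real assumes "0 < K" "0 < C"
  shows "eventually (\<lambda>m::nat. (K * (2 * real m + 1) powr (1/8) + 1) * (K * (2 * real m + 1) powr (1/8) + 2)
    * ln (2 + (real m + 1) * (K * (2 * real m + 1) powr (1/8)) * (K * (2 * real m + 1) powr (1/8) + 1) * C) < real m * ln 2) at_top"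
  using assms by real_asymp

context ptm_simulation
begin

lemma cell_bound_le:
  obtains A :: real where "2 \<le> A" "\<And>B. real (cell_bound B) \<le> A ^ (2 * B + 2)"
proof
  \<comment> \<open>Twice the size of the work alphabet absorbs the number of head positions, by 2 *
    B + 1 \<le> 2 ^ (2 * B + 1). The state count takes one further factor.\<close>
  let ?A = "max 2 (max (real (card (states M))) (2 * real (card (work_alph M))))"
  show "2 \<le> ?A" by simp
  fix B
  have "real (2 * B + 1) \<le> 2 ^ (2 * B + 1)"
    using less_exp[of "2 * B + 1"] by (metis less_imp_le of_nat_le_iff of_nat_numeral of_nat_power)
  then have "real (2 * B + 1) * real (card (work_alph M)) ^ (2 * B + 1) \<le> (2 * real (card (work_alph M))) ^ (2 * B + 1)"
    unfolding power_mult_distrib by (rule mult_right_mono) simp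
  also have "\<dots> \<le> ?A ^ (2 * B + 1)" by (rule power_mono) auto
  finally have "real (card (states M)) * (real (2 * B + 1) * real (card (work_alph M)) ^ (2 * B + 1)) \<le> ?A * ?A ^ (2 * B + 1)"
    by (intro mult_mono) auto
  moreover have "?A * ?A ^ (2 * B + 1) = ?A ^ (2 * B + 2)" by simp
  moreover have "real (cell_bound B) = real (card (states M)) * (real (2 * B + 1) * real (card (work_alph M)) ^ (2 * B + 1))"
    by (simp only: cell_bound_def of_nat_mult of_nat_power mult.assoc)
  ultimately show "real (cell_bound B) \<le> ?A ^ (2 * B + 2)" by (simp only:)
qed

lemma eventually_cell_bound_le:
  assumes s: "(\<lambda>n. real (s n)) \<in> o(\<lambda>n. ln (real n))"
  obtains K :: real where "0 < K" "eventually (\<lambda>m. real (cell_bound (s (2 * m + 1))) \<le> K * (2 * real m + 1) powr (1/8)) at_top"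
proof -
  obtain A :: real where A: "2 \<le> A" "\<And>B. real (cell_bound B) \<le> A ^ (2 * B + 2)" using cell_bound_le by metis
  \<comment> \<open>Chosen so that 2 * \<eta> * ln A = 1/8, which is the exponent of the
    root.\<close>
  define \<eta> where "\<eta> = 1 / (16 * ln A)"
  have lnA: "0 < ln A" using A(1) by simp
  have "0 < \<eta>" using lnA by (simp add: \<eta>_def)
  then have "eventually (\<lambda>n. norm (real (s n)) \<le> \<eta> * norm (ln (real n))) at_top" using landau_o.smallD[OF s] by blast
  moreover have "filterlim (\<lambda>m::nat. 2 * m + 1) at_top at_top"
    by (rule filterlim_at_top_mono[OF filterlim_ident]) auto
  ultimately have "eventually (\<lambda>m. norm (real (s (2 * m + 1))) \<le> \<eta> * norm (ln (real (2 * m + 1)))) at_top"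
    by (rule eventually_compose_filterlim)
  then have "eventually (\<lambda>m. real (cell_bound (s (2 * m + 1))) \<le> A ^ 2 * (2 * real m + 1) powr (1/8)) at_top"
  proof eventually_elim
    case (elim m)
    let ?B = "s (2 * m + 1)"
    have "real ?B \<le> \<eta> * ln (2 * real m + 1)" using elim by (simp add: add.commute)
    then have "2 * real ?B * ln A \<le> 2 * (\<eta> * ln (2 * real m + 1)) * ln A"
      using lnA by (intro mult_right_mono) auto
    also have "\<dots> = ln (2 * real m + 1) / 8" using lnA by (simp add: \<eta>_def)
    finally have le: "2 * real ?B * ln A \<le> ln (2 * real m + 1) / 8" .
    have "real (cell_bound ?B) \<le> A ^ 2 * A ^ (2 * ?B)" using A(2)[of ?B] by (simp add: power_add mult.commute power2_eq_square)
    also have "A ^ (2 * ?B) = exp (2 * real ?B * ln A)"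
      using A(1) exp_of_nat_mult[of "2 * ?B" "ln A"] by simp
    also have "\<dots> \<le> exp (ln (2 * real m + 1) / 8)" using le by simp
    also have "\<dots> = (2 * real m + 1) powr (1/8)" by (simp add: powr_def)
    finally show ?case using A(1) by (simp add: mult_left_mono)
  qed
  then show ?thesis using that[of "A ^ 2"] A(1) by simp
qed

text \<open>The divisor \<open>c / (4 * real (cell_bound (s (2 * m + 1)) + 1))\<close> is the
  \<delta> of \<open>no_small_space\<close>: the total distortion is then \<open>exp c\<close> for
  every \<open>m\<close>. It adds a factor to the number of classes that only enters under a
  logarithm.\<close>

lemma profile_count_small:
  assumes s: "(\<lambda>n. real (s n)) \<in> o(\<lambda>n. ln (real n))" and c: "0 < c"
  obtains m where
    "(nat \<lfloor>real (m + 1) * real (cell_bound (s (2 * m + 1))) * - ln min_prob / (c / (4 * real (cell_bound (s (2 * m + 1)) + 1)))\<rfloor> + 2)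
       ^ ((cell_bound (s (2 * m + 1)) + 1) * (cell_bound (s (2 * m + 1)) + 2)) < 2 ^ m"
proof -
  obtain K where K: "0 < K" "eventually (\<lambda>m. real (cell_bound (s (2 * m + 1))) \<le> K * (2 * real m + 1) powr (1/8)) at_top"
    by (rule eventually_cell_bound_le[OF s])
  define L where "L = - ln min_prob"
  have L: "0 \<le> L" using min_prob(1,2) by (simp add: L_def)
  \<comment> \<open>The added 1 keeps \<open>C\<close> positive also for a deterministic machine,
    where \<open>L\<close> is 0.\<close>
  define C where "C = 4 * (L + 1) / c"
  have C: "0 < C" "4 * L / c \<le> C" using c L by (auto simp: C_def divide_right_mono)
  obtain m where m: "real (cell_bound (s (2 * m + 1))) \<le> K * (2 * real m + 1) powr (1/8)"
    "(K * (2 * real m + 1) powr (1/8) + 1) * (K * (2 * real m + 1) powr (1/8) + 2)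
    * ln (2 + (real m + 1) * (K * (2 * real m + 1) powr (1/8)) * (K * (2 * real m + 1) powr (1/8) + 1) * C) < real m * ln 2"
    using eventually_happens[OF eventually_conj[OF K(2) eventually_polynomial_in_root_below_linear[OF K(1) C(1)]]] by auto
  define b where "b = cell_bound (s (2 * m + 1))"
  define f where "f = K * (2 * real m + 1) powr (1/8)"
  have bf: "real b \<le> f" using m(1) by (simp add: b_def f_def)
  define N where "N = nat \<lfloor>real (m + 1) * real b * - ln min_prob / (c / (4 * real (b + 1)))\<rfloor>"
  have base: "real (N + 2) \<le> 2 + (real m + 1) * f * (f + 1) * C"
  proof -
    have "real (m + 1) * real b * L / (c / (4 * real (b + 1))) = (real m + 1) * real b * (real b + 1) * (4 * L / c)"
      using c by (simp add: field_simps)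
    also have "\<dots> \<le> (real m + 1) * f * (f + 1) * C"
      using bf C L c by (intro mult_mono) auto
    finally have "real (m + 1) * real b * L / (c / (4 * real (b + 1))) \<le> (real m + 1) * f * (f + 1) * C" .
    moreover have "0 \<le> real (m + 1) * real b * L / (c / (4 * real (b + 1)))" using L c by simp
    ultimately show ?thesis unfolding N_def L_def[symmetric] by linarith
  qed
  have "ln (real ((N + 2) ^ ((b + 1) * (b + 2)))) = real ((b + 1) * (b + 2)) * ln (real (N + 2))"
    unfolding of_nat_power by (rule ln_realpow)
  also have "\<dots> \<le> ((f + 1) * (f + 2)) * ln (2 + (real m + 1) * f * (f + 1) * C)"
  proof (rule mult_mono)
    show "real ((b + 1) * (b + 2)) \<le> (f + 1) * (f + 2)"
      unfolding of_nat_mult using bf by (intro mult_mono) auto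
    show "ln (real (N + 2)) \<le> ln (2 + (real m + 1) * f * (f + 1) * C)" using base by simp
    show "0 \<le> (f + 1) * (f + 2)" using bf by (intro mult_nonneg_nonneg) linarith+
  qed simp
  also have "\<dots> < real m * ln 2" using m(2) by (simp add: f_def)
  also have "\<dots> = ln (real (2 ^ m))" by (simp add: ln_realpow)
  finally have "real ((N + 2) ^ ((b + 1) * (b + 2))) < real (2 ^ m)"
    by (subst (asm) ln_less_cancel_iff) (simp_all only: of_nat_0_less_iff zero_less_power add_gr_0 zero_less_numeral simp_thms)
  then have "(N + 2) ^ ((b + 1) * (b + 2)) < 2 ^ m" by (simp only: of_nat_less_iff)
  then show ?thesis using that[of m] unfolding N_def b_def by blast
qed

end

theorem twin_words_not_ptm_recognizable:
  assumes s: "(\<lambda>n. real (s n)) \<in> o(\<lambda>n. ln (real n))"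
  shows "\<not> ptm_wom_recognizable {0, 1, 2} s twin_words"
proof
  assume "ptm_wom_recognizable {0, 1, 2} s twin_words"
  then obtain M where M: "wf_ptm {0, 1, 2} M"
    "\<forall>w\<in>lists {0, 1, 2}. \<forall>cs\<in>ptm_paths M w. squares_used cs \<le> s (length w)"
    and be: "bounded_error {0, 1, 2} twin_words (ptm_acc M) (ptm_rej M)"
    unfolding ptm_wom_recognizable_def by (elim exE conjE)
  obtain \<epsilon>\<^sub>0 where \<epsilon>\<^sub>0: "0 \<le> \<epsilon>\<^sub>0" "\<epsilon>\<^sub>0 < 1/2"
    and ar: "\<forall>w\<in>lists {0, 1, 2}. (w \<in> twin_words \<longrightarrow> ptm_acc M w \<ge> 1 - \<epsilon>\<^sub>0) \<and> (w \<notin> twin_words \<longrightarrow> ptm_rej M w \<ge> 1 - \<epsilon>\<^sub>0)"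
    using be unfolding bounded_error_def by (elim exE conjE)
  have acc: "1 - \<epsilon>\<^sub>0 \<le> ptm_acc M w" if "w \<in> lists {0, 1, 2}" "w \<in> twin_words" for w
    using bspec[OF ar that(1)] that(2) by simp
  have rej: "1 - \<epsilon>\<^sub>0 \<le> ptm_rej M w" if "w \<in> lists {0, 1, 2}" "w \<notin> twin_words" for w
    using bspec[OF ar that(1)] that(2) by simp
  interpret ptm_simulation "{0, 1, 2}" M branch_code
    by unfold_locales (simp, fact M(1), fact inj_branch_code)
  \<comment> \<open>A positive error bound is needed for the ratio below; enlarging the error to 1/4
    keeps it under 1/2.\<close>
  define \<epsilon> where "\<epsilon> = max \<epsilon>\<^sub>0 (1/4)"
  have \<epsilon>: "0 < \<epsilon>" "\<epsilon> < 1/2" "\<epsilon>\<^sub>0 \<le> \<epsilon>" using \<epsilon>\<^sub>0 by (auto simp: \<epsilon>_def)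
  \<comment> \<open>Half of the admissible logarithm leaves the distortion \<open>exp c\<close>
    strictly below the ratio.\<close>
  define c where "c = ln ((1 - \<epsilon>) / \<epsilon>) / 2"
  have "1 < (1 - \<epsilon>) / \<epsilon>" using \<epsilon> by simp
  then have "0 < ln ((1 - \<epsilon>) / \<epsilon>)" by simp
  then have c: "0 < c" "c < ln ((1 - \<epsilon>) / \<epsilon>)" by (auto simp: c_def)
  then have "exp c < exp (ln ((1 - \<epsilon>) / \<epsilon>))" by simp
  then have ec: "exp c * \<epsilon> < 1 - \<epsilon>" using \<epsilon> by (simp add: field_simps)
  obtain m where m: "(nat \<lfloor>real (m + 1) * real (cell_bound (s (2 * m + 1))) * - ln min_prob / (c / (4 * real (cell_bound (s (2 * m + 1)) + 1)))\<rfloor> + 2)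
       ^ ((cell_bound (s (2 * m + 1)) + 1) * (cell_bound (s (2 * m + 1)) + 2)) < 2 ^ m"
    by (rule profile_count_small[OF s c(1)])
  let ?b = "cell_bound (s (2 * m + 1))"
  have words: "x @ 2 # y \<in> lists {0, 1, 2}" if "x \<in> lists {0, 1}" "y \<in> lists {0, 1}" for x y :: "nat list"
    using that by (auto simp: in_lists_conv_set)
  have ne: "x @ 2 # y \<notin> twin_words" if xy: "x \<in> lists {0, 1}" "y \<in> lists {0, 1}" "x \<noteq> y" for x y
  proof
    assume "x @ 2 # y \<in> twin_words"
    then obtain z where z: "x @ 2 # y = z @ 2 # z" "z \<in> lists {0, 1}" by (auto simp: twin_words_def)
    have "2 \<notin> set x" "2 \<notin> set z" using xy(1) z(2) by auto
    then have "x = z \<and> y = z" using z(1) by (metis append_Cons_eq_iff)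
    then show False using xy(3) by simp
  qed
  have "2 ^ m \<le> (nat \<lfloor>real (m + 1) * real ?b * - ln min_prob / (c / (4 * real (?b + 1)))\<rfloor> + 2) ^ ((?b + 1) * (?b + 2))"
  proof (rule no_small_space[where \<epsilon> = \<epsilon>])
    show "squares_used cs \<le> s (2 * m + 1)" if "w \<in> lists {0, 1, 2}" "length w = 2 * m + 1" "cs \<in> ptm_paths M w" for w cs
      using bspec[OF bspec[OF M(2) that(1)] that(3)] that(2) by simp
    show "1 - \<epsilon> \<le> ptm_acc M (x @ 2 # x)" if "x \<in> lists {0, 1}" for x
    proof -
      have "x @ 2 # x \<in> twin_words" using that by (auto simp: twin_words_def)
      then show ?thesis using acc[OF words[OF that that]] \<epsilon>(3) by linarith
    qed
    show "1 - \<epsilon> \<le> ptm_rej M (x @ 2 # y)" if "x \<in> lists {0, 1}" "y \<in> lists {0, 1}" "x \<noteq> y" for x y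
      using rej[OF words[OF that(1,2)] ne[OF that]] \<epsilon>(3) by linarith
    have "4 * (c / (4 * real (?b + 1))) * real (?b + 1) = c" by (simp add: field_simps)
    then show "exp (4 * (c / (4 * real (?b + 1))) * real (?b + 1)) * \<epsilon> < 1 - \<epsilon>" using ec by simp
    show "0 < c / (4 * real (?b + 1))" using c by simp
  qed (use \<epsilon> in auto)
  then show False using m by linarith
qed

theorem corollary6:
  fixes s :: "nat \<Rightarrow> nat"
  assumes "(\<lambda>n. real (s n)) \<in> o(\<lambda>n. ln (real n))"
  shows "(\<forall>\<Sigma> L. finite \<Sigma> \<longrightarrow> L \<subseteq> lists \<Sigma> \<longrightarrow>
            ptm_wom_recognizable \<Sigma> s L \<longrightarrow> qtm_wom_recognizable \<Sigma> s L)
       \<and> (\<exists>\<Sigma> L. finite \<Sigma> \<and> L \<subseteq> lists \<Sigma> \<and>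
            qtm_wom_recognizable \<Sigma> s L \<and> \<not> ptm_wom_recognizable \<Sigma> s L)"
  using qtm_simulates_ptm twin_words_subset twin_words_qtm_recognizable twin_words_not_ptm_recognizable[OF assms]
  by (intro conjI allI impI exI[of _ "{0, 1, 2}"] exI[of _ twin_words]) auto

end
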